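(* Let $0<\alpha<\beta$ and let $\rho\in ID$. Then $\mathcal{J}^{\beta}(\rho)\in\mathcal{U}_{\alpha}$ if and only if $\rho$ admits the convolution factorization $$\rho=\mathcal{J}^{\alpha}\bigl(\nu^{\ast(1-\alpha/\beta)}\bigr)\ast\nu^{\ast\alpha/\beta}=\bigl(\mathcal{J}^{\alpha}(\nu)\bigr)^{\ast(1-\alpha/\beta)}\ast\nu^{\ast\alpha/\beta}$$ for some $\nu\in ID$.
   Context: $ID$ is the set of all infinitely divisible Borel probability measures on $\mathbb{R}^d$; $\ast$ denotes convolution. For $\mu\in ID$ and $c>0$, $\mu^{\ast c}\in ID$ is the convolution power, i.e. the measure with characteristic function $\exp(c\log\hat\mu)$, where $\log\hat\mu$ is the unique continuous logarithm of the characteristic function $\hat\mu$ vanishing at $0$. $\mathcal{L}(X)$ denotes the probability distribution of a random vector $X$. For $\nu\in ID$, $(Y_\nu(t))_{t\ge 0}$ denotes an $\mathbb{R}^d$-valued Lévy process (started at zero, stationary independent increments, right continuous paths with finite left limits) with $\mathcal{L}(Y_\nu(1))=\nu$. Random integrals are defined pathwise by formal integration by parts: for a continuous function $h$ of bounded variation on $[0,1]$ and a continuous nondecreasing $r:[0,1]\to[0,\infty)$, $$\int_0^1 h(t)\,dY(r(t)):=h(1)Y(r(1))-h(0)Y(r(0))-\int_{(0,1]}Y(r(t)-)\,dh(t).$$ For $\beta>0$ the mapping $\mathcal{J}^\beta: ID\to ID$ and the class $\mathcal{U}_\beta$ are defined by $$\mathcal{J}^\beta(\nu):=\mathcal{L}\Bigl(\int_0^1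 t^{1/\beta}\,dY_\nu(t)\Bigr)=\mathcal{L}\Bigl(\int_0^1 t\,dY_\nu(t^\beta)\Bigr),\qquad \mathcal{U}_\beta:=\mathcal{J}^\beta(ID).$$ *)

theory Defs
  imports "HOL-Probability.Probability"
begin

section \<open>Infinitely divisible measures and convolution powers\<close>

definition borel_probs :: "(real ^ 'd) measure set" where
  "borel_probs = {\<mu>. prob_space \<mu> \<and> sets \<mu> = sets borel}"

primrec convolution_npow :: "nat \<Rightarrow> (real ^ 'd) measure \<Rightarrow> (real ^ 'd) measure" where
  "convolution_npow 0 \<mu> = return borel 0"
| "convolution_npow (Suc n) \<mu> = (\<mu> \<star> convolution_npow n \<mu>)"

definition ID :: "(real ^ 'd) measure set" where
  "ID = {\<mu> \<in> borel_probs. \<forall>n\<ge>1. \<exists>\<kappa>\<in>borel_probs. convolution_npow n \<kappa> = \<mu>}"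

definition charfun :: "(real ^ 'd) measure \<Rightarrow> real ^ 'd \<Rightarrow> complex" where
  "charfun \<mu> y = (CLINT x|\<mu>. iexp (y \<bullet> x))"

definition log_charfun :: "(real ^ 'd) measure \<Rightarrow> real ^ 'd \<Rightarrow> complex" where
  "log_charfun \<mu> =
     (THE \<phi>. continuous_on UNIV \<phi> \<and> \<phi> 0 = 0 \<and> (\<forall>y. exp (\<phi> y) = charfun \<mu> y))"

definition convolution_powr :: "(real ^ 'd) measure \<Rightarrow> real \<Rightarrow> (real ^ 'd) measure" where
  "convolution_powr \<mu> c =
     (THE \<kappa>. \<kappa> \<in> borel_probs \<and> (\<forall>y. charfun \<kappa> y = exp (of_real c * log_charfun \<mu> y)))"

section \<open>Levy processes and random integrals\<close>

text \<open>Only times \<open>t \<ge> 0\<close> are relevant; values at negative times are unconstrained.\<close>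

definition levy_process :: "'w measure \<Rightarrow> (real \<Rightarrow> 'w \<Rightarrow> real ^ 'd) \<Rightarrow> bool" where
  "levy_process M Y \<longleftrightarrow>
     prob_space M \<and>
     (\<forall>t\<ge>0. Y t \<in> borel_measurable M) \<and>
     (\<forall>\<omega>\<in>space M. Y 0 \<omega> = 0) \<and>
     (\<forall>n (t :: nat \<Rightarrow> real). 0 \<le> t 0 \<and> (\<forall>i<n. t i \<le> t (Suc i)) \<longrightarrow>
        prob_space.indep_vars M (\<lambda>_. borel) (\<lambda>i \<omega>. Y (t (Suc i)) \<omega> - Y (t i) \<omega>) {..<n}) \<and>
     (\<forall>s\<ge>0. \<forall>t\<ge>0. distr M borel (\<lambda>\<omega>. Y (s + t) \<omega> - Y s \<omega>) = distr M borel (Y t)) \<and>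
     (\<forall>\<omega>\<in>space M. (\<forall>t\<ge>0. continuous (at_right t) (\<lambda>s. Y s \<omega>)) \<and>
                   (\<forall>t>0. \<exists>l. ((\<lambda>s. Y s \<omega>) \<longlongrightarrow> l) (at_left t)))"

text \<open>
  The integral of \<open>h\<close> over \<open>[0, 1]\<close> with respect to the path \<open>t \<mapsto> y (r t)\<close>, by formal
  integration by parts, for \<open>h\<close> continuous and nondecreasing on \<open>[0, 1]\<close>; the right-hand
  integral is then a Lebesgue-Stieltjes integral.  Since \<open>interval_measure\<close> needs an integrator
  that is monotone on the whole line, \<open>h\<close> is extended by constants outside \<open>[0, 1]\<close>.
\<close>

definition path_integral ::
    "(real \<Rightarrow> real) \<Rightarrow> (real \<Rightarrow> real) \<Rightarrow> (real \<Rightarrow> real ^ 'd) \<Rightarrow> real ^ 'd" where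
  "path_integral h r y =
     h 1 *\<^sub>R y (r 1) - h 0 *\<^sub>R y (r 0) -
     (LINT t:{0<..1}|interval_measure (\<lambda>t. h (max 0 (min 1 t))). Lim (at_left (r t)) y)"

text \<open>
  The law does not depend on the process chosen.  Taking the sample space inside the type of
  paths loses no generality: every Levy process can be transferred to its own path space.
\<close>

definition J :: "real \<Rightarrow> (real ^ 'd) measure \<Rightarrow> (real ^ 'd) measure" where
  "J \<beta> \<nu> = (THE \<mu>. \<exists>(M :: (real \<Rightarrow> real ^ 'd) measure) Y.
       levy_process M Y \<and> distr M borel (Y 1) = \<nu> \<and>
       \<mu> = distr M borel (\<lambda>\<omega>. path_integral (\<lambda>t. t powr (1 / \<beta>)) (\<lambda>t. t) (\<lambda>t. Y t \<omega>)))"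

definition U :: "real \<Rightarrow> (real ^ 'd) measure set" where
  "U \<beta> = J \<beta> ` ID"

end

theory Submission
  imports Defs
begin

text \<open>
  Write \<open>\<phi> = log_charfun \<rho>\<close>, \<open>\<psi> = log_charfun \<nu>\<close>. Approximating the path integral by Riemann sums of
  increments shows that \<open>J \<beta>\<close> acts on logarithms of characteristic functions by the radial mean
  \<open>(R\<^sub>\<beta> \<phi>) y\<close>, the integral of \<open>\<phi> (t powr (1 / \<beta>) *\<^sub>R y)\<close> over \<open>t\<close> in \<open>[0, 1]\<close>. The substitution \<open>u = s powr \<beta> * t\<close>
  gives \<open>\<beta> (\<phi> - R\<^sub>\<beta> \<phi>)\<close> for the radial derivative of \<open>R\<^sub>\<beta> \<phi>\<close>. Comparing radial derivatives, \<open>R\<^sub>\<beta> \<phi> = R\<^sub>\<alpha> \<psi>\<close> is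
  equivalent to \<open>\<phi> = (1 - \<alpha> / \<beta>) R\<^sub>\<alpha> \<psi> + (\<alpha> / \<beta>) \<psi>\<close>, which is the asserted factorization.

  Since \<open>J\<close> and \<open>convolution_powr\<close> are definite descriptions, a Levy process with a given infinitely divisible
  law has to be constructed. Its dyadic increments are the projective limit of i.i.d. sequences with laws
  \<open>\<nu>\<close> to the power \<open>1 / 2 ^ n\<close>; Ottaviani's inequality bounds the expected number of oscillations of
  size \<open>e\<close> on short intervals uniformly in \<open>n\<close>, so that the dyadic path has one-sided limits almost surely.
\<close>

section \<open>Uniqueness of characteristic functions\<close>

text \<open>Laws are compared through logarithms, because there powers, convolution and
  \<open>J\<close> act linearly. Such logarithms exist only if the characteristic function of an
  infinitely divisible law has no zeros; this is forced by a doubling inequality for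
  \<open>1 - norm (charfun \<mu> y) ^ 2\<close>, applied to roots of high order. A continuous
  logarithm vanishing at 0 is unique, so no multiples of 2 pi i have to be tracked. One Levy process
  serves two purposes: its law at time \<open>c\<close> is the real power with exponent
  \<open>c\<close>, and its paths give \<open>J\<close>. All dyadic levels must live on one
  probability space, since path regularity concerns all of them at once. The expected number of
  resets on a short interval is at most 1 at every level, so by Fatou's lemma the number of
  oscillations there is almost surely bounded. The weights come from a linear equation: a common
  mean F has radial derivative \<beta> (\<phi> - F) and also \<alpha> (\<psi> - F), and solving for
  \<phi> gives the coefficients 1 - \<alpha> / \<beta> and \<alpha> / \<beta>, both nonnegative
  because \<alpha> < \<beta>.\<close>

lemma weighted_marginal_unique:
  fixes \<mu> \<nu> :: "(real ^ 'd) measure" and w :: "real ^ 'd \<Rightarrow> real"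
  assumes \<mu>: "prob_space \<mu>" "sets \<mu> = sets borel" and \<nu>: "prob_space \<nu>" "sets \<nu> = sets borel"
    and w[measurable]: "w \<in> borel_measurable borel" and w0: "\<And>x. 0 \<le> w x" and wB: "\<And>x. w x \<le> B"
    and eq: "\<And>t. (CLINT x|\<mu>. w x * iexp (t * x $ i)) = (CLINT x|\<nu>. w x * iexp (t * x $ i))"
    and A: "A \<in> sets borel"
  shows "(\<integral>x. w x * indicator A (x $ i) \<partial>\<mu>) = (\<integral>x. w x * indicator A (x $ i) \<partial>\<nu>)"
proof -
  note [measurable_cong] = \<mu>(2) \<nu>(2) and [measurable] = A
  have intw: "integrable M w" if "prob_space M" "sets M = sets borel" for M :: "(real^'d) measure"
  proof -
    interpret prob_space M by fact
    note [measurable_cong] = that(2)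
    show ?thesis
      by (rule integrable_const_bound[where B=B]) (use w0 wB in auto)
  qed
  define c where "c = (\<integral>x. w x \<partial>\<mu>)"
  have c': "c = (\<integral>x. w x \<partial>\<nu>)"
  proof -
    have "complex_of_real c = of_real (\<integral>x. w x \<partial>\<nu>)"
      using eq[of 0] by (simp add: c_def)
    then show ?thesis by (simp only: of_real_eq_iff)
  qed
  have "c \<ge> 0" unfolding c_def using w0 by simp
  show ?thesis
  proof (cases "c = 0")
    case True
    have "(\<integral>x. w x * indicator A (x $ i) \<partial>M) = 0"
      if "prob_space M" "sets M = sets borel" "(\<integral>x. w x \<partial>M) = 0" for M :: "(real^'d) measure"
    proof -
      have "AE x in M. w x = 0"
        using integral_nonneg_eq_0_iff_AE[OF intw[OF that(1,2)]] that(3) w0 by simp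
      then show ?thesis
        by (intro integral_eq_zero_AE) (elim AE_mp, auto)
    qed
    then show ?thesis using True c' c_def \<mu> \<nu> by simp
  next
    case False
    with \<open>c \<ge> 0\<close> have c: "c > 0" by simp
    \<comment> \<open>The weight, normalized by its total mass \<open>c\<close>, becomes a
      probability density; \<open>D M\<close> is the law of coordinate \<open>i\<close> under it.
      Its characteristic function is the given transform divided by \<open>c\<close>, so
      one-dimensional uniqueness applies.\<close>
    define D where "D M = distr (density M (\<lambda>x. ennreal (w x / c))) borel (\<lambda>x. x $ i)" for M :: "(real^'d) measure"
    have D: "real_distribution (D M)" "\<And>t. char (D M) t = (CLINT x|M. w x * iexp (t * x $ i)) / c"
      "measure (D M) A = (\<integral>x. w x * indicator A (x $ i) \<partial>M) / c"
      if M: "prob_space M" "sets M = sets borel" "(\<integral>x. w x \<partial>M) = c" for M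
    proof -
      note [measurable_cong] = M(2)
      have em: "emeasure (density M (\<lambda>x. ennreal (w x / c))) (space M) = 1"
        using c w0 intw[OF M(1,2)] M(3)
        by (subst emeasure_density) (auto simp: nn_integral_eq_integral cong: nn_integral_cong)
      have p: "prob_space (density M (\<lambda>x. ennreal (w x / c)))"
        by (rule prob_spaceI) (use em in simp)
      then show 1: "real_distribution (D M)"
        unfolding D_def real_distribution_def real_distribution_axioms_def
        by (auto intro!: prob_space.prob_space_distr)
      show "char (D M) t = (CLINT x|M. w x * iexp (t * x $ i)) / c" for t
        unfolding char_def D_def using c w0
        apply (subst integral_distr, simp, simp)
        apply (subst integral_density)
        apply (auto simp: scaleR_conv_of_real)
        done
      have "(\<integral>x. indicator A x \<partial>D M) = (\<integral>x. w x * indicator A (x $ i) \<partial>M) / c"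
        unfolding D_def using c w0
        apply (subst integral_distr, simp, simp)
        apply (subst integral_density)
        apply (auto simp: )
        done
      moreover have "(\<integral>x. indicator A x \<partial>D M) = measure (D M) A"
        by (simp add: D_def)
      ultimately show "measure (D M) A = (\<integral>x. w x * indicator A (x $ i) \<partial>M) / c" by simp
    qed
    have "D \<mu> = D \<nu>"
      by (intro Levy_uniqueness D(1) \<mu> \<nu> c_def[symmetric] c'[symmetric])
         (rule ext, simp only: D(2)[OF \<mu> c_def[symmetric]] D(2)[OF \<nu> c'[symmetric]] eq)
    then show ?thesis
      using D(3)[OF \<mu> c_def[symmetric]] D(3)[OF \<nu> c'[symmetric]] c by simp
  qed
qed

lemma integrable_bounded_prob:
  fixes f :: "_ \<Rightarrow> 'b :: {banach, second_countable_topology}"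
  assumes "prob_space M" "f \<in> borel_measurable M" "\<And>x. norm (f x) \<le> B"
  shows "integrable M f"
proof -
  interpret prob_space M by fact
  show ?thesis by (rule integrable_const_bound[where B=B]) (use assms in auto)
qed

text \<open>
  Restricting one coordinate at a time: the weight \<open>g x * (1 + cos (y \<bullet> x + \<theta>))\<close> is nonnegative, so the
  one-dimensional uniqueness theorem applies to its marginal, and varying \<open>\<theta>\<close> recovers \<open>iexp (y \<bullet> x)\<close>.
\<close>

lemma weighted_charfun_restrict:
  fixes \<mu> \<nu> :: "(real ^ 'd) measure" and g :: "real ^ 'd \<Rightarrow> real"
  assumes \<mu>: "prob_space \<mu>" "sets \<mu> = sets borel" and \<nu>: "prob_space \<nu>" "sets \<nu> = sets borel"
    and g[measurable]: "g \<in> borel_measurable borel" and g0: "\<And>x. 0 \<le> g x" and g1: "\<And>x. g x \<le> 1"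
    and eq: "\<And>y. (CLINT x|\<mu>. g x * iexp (y \<bullet> x)) = (CLINT x|\<nu>. g x * iexp (y \<bullet> x))"
    and A: "A \<in> sets borel"
  shows "(CLINT x|\<mu>. (g x * indicator A (x $ i)) * iexp (y \<bullet> x)) =
         (CLINT x|\<nu>. (g x * indicator A (x $ i)) * iexp (y \<bullet> x))"
proof -
  note [measurable_cong] = \<mu>(2) \<nu>(2) and [measurable] = A
  have gn: "\<bar>g x\<bar> \<le> 1" for x using g0[of x] g1[of x] by simp
  have int_c: "integrable M (\<lambda>x. g x * h x)"
    if "prob_space M" "sets M = sets borel" "h \<in> borel_measurable borel" "\<And>x. norm (h x) \<le> 4"
    for M and h :: "real^'d \<Rightarrow> complex"
  proof -
    note [measurable] = that(3) and [measurable_cong] = that(2)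
    show ?thesis
      by (rule integrable_bounded_prob[OF that(1), where B=4])
         (auto simp: norm_mult intro!: mult_le_one order.trans[OF mult_mono[OF gn that(4)]])
  qed
  have int_r: "integrable M (\<lambda>x. g x * h x)"
    if "prob_space M" "sets M = sets borel" "h \<in> borel_measurable borel" "\<And>x. norm (h x) \<le> 4"
    for M and h :: "real^'d \<Rightarrow> real"
  proof -
    note [measurable] = that(3) and [measurable_cong] = that(2)
    show ?thesis
      by (rule integrable_bounded_prob[OF that(1), where B=4])
         (auto simp: abs_mult intro!: mult_le_one order.trans[OF mult_mono[OF gn that(4)[unfolded real_norm_def]]])
  qed
  \<comment> \<open>Expanding the cosine gives three transforms of \<open>g\<close>, at the
    frequency \<open>axis i t\<close> and its shifts by \<open>y\<close> and \<open>- y\<close>; the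
    hypothesis \<open>eq\<close> covers each of them.\<close>
  have cosexp: "complex_of_real (1 + cos (y \<bullet> x + \<theta>)) * iexp (t * x $ i) =
     iexp (axis i t \<bullet> x) + exp (\<i> * \<theta>) / 2 * iexp ((y + axis i t) \<bullet> x) +
     exp (- \<i> * \<theta>) / 2 * iexp ((axis i t - y) \<bullet> x)" for y x :: "real^'d" and \<theta> t
    by (simp add: inner_axis' inner_add_left inner_diff_left cos_of_real[symmetric] cos_exp_eq
        exp_add[symmetric] algebra_simps del: cos_of_real)
  have W: "(\<integral>x. (g x * (1 + cos (y \<bullet> x + \<theta>))) * indicator A (x $ i) \<partial>\<mu>) =
           (\<integral>x. (g x * (1 + cos (y \<bullet> x + \<theta>))) * indicator A (x $ i) \<partial>\<nu>)" for y \<theta>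
  proof (rule weighted_marginal_unique[OF \<mu> \<nu> _ _ _ _ A, where B=2])
    show "(\<lambda>x. g x * (1 + cos (y \<bullet> x + \<theta>))) \<in> borel_measurable borel" by measurable
    have c: "0 \<le> 1 + cos (y \<bullet> x + \<theta>)" "1 + cos (y \<bullet> x + \<theta>) \<le> 2" for x
      using cos_ge_minus_one[of "y \<bullet> x + \<theta>"] cos_le_one[of "y \<bullet> x + \<theta>"] by (auto simp del: cos_ge_minus_one)
    show "0 \<le> g x * (1 + cos (y \<bullet> x + \<theta>))" for x using g0 c by simp
    show "g x * (1 + cos (y \<bullet> x + \<theta>)) \<le> 2" for x
      using mult_mono[OF g1[of x] c(2)[of x]] c g0 by simp
    fix t
    have "(CLINT x|M. complex_of_real (g x * (1 + cos (y \<bullet> x + \<theta>))) * iexp (t * x $ i)) =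
      (CLINT x|M. g x * iexp (axis i t \<bullet> x)) +
      exp (\<i> * \<theta>) / 2 * (CLINT x|M. g x * iexp ((y + axis i t) \<bullet> x)) +
      exp (- \<i> * \<theta>) / 2 * (CLINT x|M. g x * iexp ((axis i t - y) \<bullet> x))"
      if "prob_space M" "sets M = sets borel" for M
    proof -
      have "(CLINT x|M. complex_of_real (g x * (1 + cos (y \<bullet> x + \<theta>))) * iexp (t * x $ i)) =
        (CLINT x|M. g x * iexp (axis i t \<bullet> x) + exp (\<i> * \<theta>) / 2 * (g x * iexp ((y + axis i t) \<bullet> x)) +
           exp (- \<i> * \<theta>) / 2 * (g x * iexp ((axis i t - y) \<bullet> x)))"
        by (intro Bochner_Integration.integral_cong refl, subst of_real_mult, subst mult.assoc, subst cosexp)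
           (simp add: algebra_simps)
      also have "\<dots> = (CLINT x|M. g x * iexp (axis i t \<bullet> x)) +
          (CLINT x|M. exp (\<i> * \<theta>) / 2 * (g x * iexp ((y + axis i t) \<bullet> x))) +
          (CLINT x|M. exp (- \<i> * \<theta>) / 2 * (g x * iexp ((axis i t - y) \<bullet> x)))"
        by (subst Bochner_Integration.integral_add | intro Bochner_Integration.integrable_add integrable_mult_right int_c that | simp)+
      also have "\<dots> = (CLINT x|M. g x * iexp (axis i t \<bullet> x)) +
      exp (\<i> * \<theta>) / 2 * (CLINT x|M. g x * iexp ((y + axis i t) \<bullet> x)) +
      exp (- \<i> * \<theta>) / 2 * (CLINT x|M. g x * iexp ((axis i t - y) \<bullet> x))"
        by (simp only: integral_mult_right_zero)
      finally show ?thesis .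
    qed
    from this[OF \<mu>] this[OF \<nu>] eq show
      "(CLINT x|\<mu>. complex_of_real (g x * (1 + cos (y \<bullet> x + \<theta>))) * iexp (t * x $ i)) =
       (CLINT x|\<nu>. complex_of_real (g x * (1 + cos (y \<bullet> x + \<theta>))) * iexp (t * x $ i))" by simp
  qed
  have split: "(\<integral>x. (g x * (1 + cos (y \<bullet> x + \<theta>))) * indicator A (x $ i) \<partial>M) =
     (\<integral>x. g x * indicator A (x $ i) \<partial>M) + (\<integral>x. g x * (indicator A (x $ i) * cos (y \<bullet> x + \<theta>)) \<partial>M)"
    if "prob_space M" "sets M = sets borel" for M and y :: "real^'d" and \<theta>
  proof (subst Bochner_Integration.integral_add[symmetric])
    show "integrable M (\<lambda>x. g x * indicator A (x $ i))"
      by (intro int_r that) (auto split: split_indicator)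
    have "\<bar>cos z\<bar> \<le> 4" for z :: real using abs_cos_le_one[of z] by linarith
    then show "integrable M (\<lambda>x. g x * (indicator A (x $ i) * cos (y \<bullet> x + \<theta>)))"
      by (intro int_r that) (auto split: split_indicator simp: abs_mult)
  qed (auto intro!: Bochner_Integration.integral_cong simp: algebra_simps)
  \<comment> \<open>For \<open>y = 0\<close> and \<open>\<theta> = 0\<close> the weight is
    \<open>2 * g x\<close>; this settles the constant term of the weight, so that the cosine term
    can be isolated.\<close>
  have I0: "(\<integral>x. g x * indicator A (x $ i) \<partial>\<mu>) = (\<integral>x. g x * indicator A (x $ i) \<partial>\<nu>)"
  proof -
    have "2 * (\<integral>x. g x * indicator A (x $ i) \<partial>\<mu>) = 2 * (\<integral>x. g x * indicator A (x $ i) \<partial>\<nu>)"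
      using W[of 0 0] by (simp add: algebra_simps flip: integral_mult_right_zero)
    then show ?thesis by simp
  qed
  have C: "(\<integral>x. g x * (indicator A (x $ i) * cos (y \<bullet> x + \<theta>)) \<partial>\<mu>) =
     (\<integral>x. g x * (indicator A (x $ i) * cos (y \<bullet> x + \<theta>)) \<partial>\<nu>)" for \<theta>
    using W[of y \<theta>] I0 by (simp add: split[OF \<mu>] split[OF \<nu>])
  \<comment> \<open>The phases 0 and \<open>- (pi/2)\<close> turn the cosine into the real and the
    imaginary part of \<open>iexp (y \<bullet> x)\<close>.\<close>
  have ex: "(CLINT x|M. (g x * indicator A (x $ i)) * iexp (y \<bullet> x)) =
     Complex (\<integral>x. g x * (indicator A (x $ i) * cos (y \<bullet> x + 0)) \<partial>M)
             (\<integral>x. g x * (indicator A (x $ i) * cos (y \<bullet> x + - (pi/2))) \<partial>M)"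
    if "prob_space M" "sets M = sets borel" for M
  proof -
    have i: "complex_integrable M (\<lambda>x. g x * (indicator A (x $ i) * iexp (y \<bullet> x)))"
      by (intro int_c that) (auto split: split_indicator simp: norm_mult)
    have "(CLINT x|M. (g x * indicator A (x $ i)) * iexp (y \<bullet> x)) = (CLINT x|M. g x * (indicator A (x $ i) * iexp (y \<bullet> x)))"
      by (intro Bochner_Integration.integral_cong) (auto split: split_indicator)
    also have "\<dots> = Complex (\<integral>x. Re (g x * (indicator A (x $ i) * iexp (y \<bullet> x))) \<partial>M)
           (\<integral>x. Im (g x * (indicator A (x $ i) * iexp (y \<bullet> x))) \<partial>M)"
      by (intro complex_eqI) (simp_all only: integral_Re[OF i] integral_Im[OF i] complex.sel)
    also have "\<dots> = Complex (\<integral>x. g x * (indicator A (x $ i) * cos (y \<bullet> x + 0)) \<partial>M)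
             (\<integral>x. g x * (indicator A (x $ i) * cos (y \<bullet> x + - (pi/2))) \<partial>M)"
      by (intro arg_cong2[of _ _ _ _ Complex] Bochner_Integration.integral_cong)
         (auto split: split_indicator simp: Re_exp Im_exp cos_add sin_diff cos_diff)
    finally show ?thesis .
  qed
  show ?thesis
    by (simp only: ex[OF \<mu>] ex[OF \<nu>] C)
qed

text \<open>Coordinates are restricted one at a time. The induction carries equality of all
  transforms weighted by a product of indicators, not just of masses, so that the next coordinate
  can be treated; \<open>y = 0\<close> finally gives equality on boxes with Borel sides, an
  intersection-stable generator.\<close>

lemma charfun_unique:
  fixes \<mu> \<nu> :: "(real ^ 'd) measure"
  assumes "\<mu> \<in> borel_probs" "\<nu> \<in> borel_probs" and eq: "\<And>y. charfun \<mu> y = charfun \<nu> y"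
  shows "\<mu> = \<nu>"
proof -
  have \<mu>: "prob_space \<mu>" "sets \<mu> = sets borel" and \<nu>: "prob_space \<nu>" "sets \<nu> = sets borel"
    using assms by (auto simp: borel_probs_def)
  interpret \<mu>: prob_space \<mu> by fact
  interpret \<nu>: prob_space \<nu> by fact
  note [measurable_cong] = \<mu>(2) \<nu>(2)
  have boxes: "(CLINT x|\<mu>. (\<Prod>i\<in>S. indicator (A i) (x $ i)::real) * iexp (y \<bullet> x)) =
        (CLINT x|\<nu>. (\<Prod>i\<in>S. indicator (A i) (x $ i)::real) * iexp (y \<bullet> x))"
    if A: "\<And>i. A i \<in> sets borel" for A :: "'d \<Rightarrow> real set" and S :: "'d set" and y
    using finite_class.finite_UNIV[THEN finite_subset[OF subset_UNIV], of S]
  proof (induction S arbitrary: y rule: finite_induct)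
    case empty
    then show ?case using eq[of y] by (simp add: charfun_def)
  next
    case (insert i S)
    note [measurable] = A
    have "(CLINT x|\<mu>. ((\<Prod>i\<in>S. indicator (A i) (x $ i)::real) * indicator (A i) (x $ i)) * iexp (y \<bullet> x)) =
        (CLINT x|\<nu>. ((\<Prod>i\<in>S. indicator (A i) (x $ i)::real) * indicator (A i) (x $ i)) * iexp (y \<bullet> x))"
      using A insert.IH
      by (intro weighted_charfun_restrict[OF \<mu> \<nu>] borel_measurable_prod prod_nonneg prod_le_1)
         (auto)
    then show ?case using insert.hyps by (simp add: mult.commute)
  qed
  define E where "E = {{x :: real^'d. \<forall>i. x $ i \<in> A i} | A. \<forall>i. A i \<in> sets borel}"
  have E_sets: "E \<subseteq> sets borel"
  proof
    fix X assume "X \<in> E"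
    then obtain A where X: "X = {x. \<forall>i. x $ i \<in> A i}" and [measurable]: "\<And>i. A i \<in> sets (borel::real measure)"
      unfolding E_def by auto
    have "{x :: real^'d \<in> space borel. \<forall>i. x $ i \<in> A i} \<in> sets borel" by measurable
    then show "X \<in> sets borel" using X by simp
  qed
  have E_gen: "sets borel = sigma_sets UNIV E"
  proof
    show "sigma_sets UNIV E \<subseteq> sets borel"
      using sets.sigma_sets_subset[OF E_sets] by simp
    have "box a b \<in> E" for a b :: "real^'d"
      unfolding E_def by (intro CollectI exI[of _ "\<lambda>i. {a $ i<..<b $ i}"])
                 (auto simp: mem_box_cart)
    then have "range (\<lambda>(a,b). box a b) \<subseteq> E" by auto
    then show "sets (borel :: (real^'d) measure) \<subseteq> sigma_sets UNIV E"
      by (subst borel_eq_box, subst sets_measure_of) (auto intro!: sigma_sets_mono')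
  qed
  show ?thesis
  proof (rule measure_eqI_generator_eq[where E=E and \<Omega>=UNIV and A="\<lambda>_. UNIV"])
    show "Int_stable E"
      unfolding Int_stable_def E_def
      by clarsimp (rule_tac x="\<lambda>i. A i \<inter> Aa i" in exI, auto)
    show "E \<subseteq> Pow UNIV" by simp
    show "range (\<lambda>_. UNIV) \<subseteq> E" unfolding E_def by (auto intro!: exI[of _ "\<lambda>_. UNIV"])
    show "emeasure \<mu> UNIV \<noteq> \<infinity>" by simp
    fix X assume "X \<in> E"
    then obtain A where X: "X = {x. \<forall>i. x $ i \<in> A i}" and A: "\<And>i. A i \<in> sets (borel::real measure)"
      unfolding E_def by auto
    have ind: "(\<Prod>i\<in>UNIV. indicator (A i) (x $ i)::real) = indicator X x" for x
      unfolding X by (auto simp: indicator_def prod_zero_iff intro!: prod.neutral)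
    have box0: "(CLINT x|\<mu>. (\<Prod>i\<in>UNIV. indicator (A i) (x $ i)::real) * iexp (0 \<bullet> x)) =
        (CLINT x|\<nu>. (\<Prod>i\<in>UNIV. indicator (A i) (x $ i)::real) * iexp (0 \<bullet> x))"
      by (rule boxes) (rule A)
    have "complex_of_real (\<integral>x. indicator X x \<partial>\<mu>) = of_real (\<integral>x. indicator X x \<partial>\<nu>)"
      using box0 by (simp only: ind) simp
    moreover have "space \<mu> = UNIV" "space \<nu> = UNIV"
      using sets_eq_imp_space_eq[OF \<mu>(2)] sets_eq_imp_space_eq[OF \<nu>(2)] by auto
    ultimately have "measure \<mu> X = measure \<nu> X"
      by simp
    then show "emeasure \<mu> X = emeasure \<nu> X"
      by (simp add: \<mu>.emeasure_eq_measure \<nu>.emeasure_eq_measure)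
  qed (use \<mu> \<nu> E_gen in auto)
qed

section \<open>Logarithms of infinitely divisible characteristic functions\<close>

lemma borel_probsD:
  assumes "\<mu> \<in> borel_probs"
  shows "prob_space \<mu>" "sets \<mu> = sets borel" "space \<mu> = UNIV"
  using assms sets_eq_imp_space_eq[of \<mu> borel] by (auto simp: borel_probs_def)

lemma borel_probs_distr:
  assumes "prob_space M" "X \<in> borel_measurable M"
  shows "distr M borel X \<in> borel_probs"
  using assms by (auto simp: borel_probs_def intro: prob_space.prob_space_distr)

lemma charfun_distr:
  assumes "X \<in> borel_measurable M"
  shows "charfun (distr M borel X) y = (CLINT \<omega>|M. iexp (y \<bullet> X \<omega>))"
  unfolding charfun_def by (rule integral_distr[OF assms]) simp

lemma complex_integrable_iexp:
  assumes "prob_space M" "f \<in> borel_measurable M"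
  shows "complex_integrable M (\<lambda>x. iexp (f x))"
  by (rule integrable_bounded_prob[OF assms(1), where B=1]) (use assms(2) in auto)

lemma charfun_0 [simp]:
  assumes "\<mu> \<in> borel_probs" shows "charfun \<mu> 0 = 1"
  using prob_space.prob_space[OF borel_probsD(1)[OF assms]] borel_probsD(3)[OF assms]
  by (simp add: charfun_def)

lemma continuous_charfun:
  assumes "\<mu> \<in> borel_probs" shows "continuous_on UNIV (charfun \<mu>)"
proof -
  interpret prob_space \<mu> using borel_probsD[OF assms] by simp
  note [measurable_cong] = borel_probsD(2)[OF assms]
  have "isCont (charfun \<mu>) y" for y
    unfolding continuous_at_sequentially comp_def charfun_def
    by (intro allI impI integral_dominated_convergence[where w="\<lambda>_. 1"]) (auto intro!: tendsto_intros)
  then show ?thesis by (simp add: continuous_at_imp_continuous_on)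
qed

lemma convolution_borel_probs:
  fixes \<mu> \<nu> :: "(real ^ 'd) measure"
  assumes "\<mu> \<in> borel_probs" "\<nu> \<in> borel_probs"
  shows "(\<mu> \<star> \<nu>) \<in> borel_probs"
proof -
  note \<mu> = borel_probsD[OF assms(1)] and \<nu> = borel_probsD[OF assms(2)]
  interpret pair_prob_space \<mu> \<nu> using \<mu> \<nu> by (simp add: pair_prob_space_def pair_sigma_finite_def prob_space_imp_sigma_finite)
  note [measurable_cong] = \<mu>(2) \<nu>(2)
  show ?thesis unfolding convolution_def
    by (intro borel_probs_distr) (auto intro: prob_space_axioms simp: split_beta)
qed

lemma charfun_convolution:
  fixes \<mu> \<nu> :: "(real ^ 'd) measure"
  assumes "\<mu> \<in> borel_probs" "\<nu> \<in> borel_probs"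
  shows "charfun (\<mu> \<star> \<nu>) y = charfun \<mu> y * charfun \<nu> y"
proof -
  note \<mu> = borel_probsD[OF assms(1)] and \<nu> = borel_probsD[OF assms(2)]
  interpret pair_prob_space \<mu> \<nu> using \<mu> \<nu> by (simp add: pair_prob_space_def pair_sigma_finite_def prob_space_imp_sigma_finite)
  note [measurable_cong] = \<mu>(2) \<nu>(2)
  have "charfun (\<mu> \<star> \<nu>) y = (CLINT z|\<mu> \<Otimes>\<^sub>M \<nu>. iexp (y \<bullet> (fst z + snd z)))"
    unfolding convolution_def by (subst charfun_distr) (auto simp: split_beta)
  also have "\<dots> = (CLINT x|\<mu>. CLINT x'|\<nu>. iexp (y \<bullet> (x + x')))"
    by (subst integral_fst'[symmetric]) (auto intro!: complex_integrable_iexp prob_space_axioms)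
  also have "\<dots> = charfun \<mu> y * charfun \<nu> y"
    by (simp add: charfun_def inner_add_right ring_distribs exp_add)
  finally show ?thesis .
qed

lemma convolution_npow_borel_probs:
  fixes \<mu> :: "(real ^ 'd) measure"
  assumes "\<mu> \<in> borel_probs" shows "convolution_npow n \<mu> \<in> borel_probs"
proof (induction n)
  case 0
  then show ?case by (auto simp: borel_probs_def prob_space_return)
qed (simp add: convolution_borel_probs assms)

lemma charfun_return_0: "charfun (return borel 0) y = 1"
  unfolding charfun_def by (subst integral_return) auto

lemma charfun_convolution_npow:
  fixes \<mu> :: "(real ^ 'd) measure"
  assumes "\<mu> \<in> borel_probs" shows "charfun (convolution_npow n \<mu>) y = charfun \<mu> y ^ n"
  by (induction n)
     (simp_all add: charfun_return_0 charfun_convolution convolution_npow_borel_probs assms)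

lemma ID_iff_charfun:
  fixes \<nu> :: "(real ^ 'd) measure"
  shows "\<nu> \<in> ID \<longleftrightarrow> \<nu> \<in> borel_probs \<and>
     (\<forall>n\<ge>1. \<exists>\<kappa>\<in>borel_probs. \<forall>y. charfun \<kappa> y ^ n = charfun \<nu> y)"
proof -
  have "convolution_npow n \<kappa> = \<nu> \<longleftrightarrow> (\<forall>y. charfun \<kappa> y ^ n = charfun \<nu> y)"
    if "\<kappa> \<in> borel_probs" "\<nu> \<in> borel_probs" for \<kappa> n
    using that charfun_unique[of "convolution_npow n \<kappa>" \<nu>]
    by (auto simp: charfun_convolution_npow[symmetric] convolution_npow_borel_probs)
  then show ?thesis unfolding ID_def by auto
qed

lemma charfun_double_le:
  fixes \<mu> :: "(real ^ 'd) measure"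
  assumes "\<mu> \<in> borel_probs"
  shows "1 - (norm (charfun \<mu> (2 *\<^sub>R y)))\<^sup>2 \<le> 4 * (1 - (norm (charfun \<mu> y))\<^sup>2)"
proof -
  note \<mu> = borel_probsD[OF assms]
  interpret pair_prob_space \<mu> \<mu> using \<mu> by (simp add: pair_prob_space_def pair_sigma_finite_def prob_space_imp_sigma_finite)
  note [measurable_cong] = \<mu>(2)
  \<comment> \<open>\<open>norm (charfun \<mu> y)\<^sup>2\<close> is the characteristic function of \<open>X - X'\<close> for i.i.d. \<open>X\<close>, \<open>X'\<close>.\<close>
  have sym: "(norm (charfun \<mu> y))\<^sup>2 = (\<integral>z. cos (y \<bullet> (fst z - snd z)) \<partial>(\<mu> \<Otimes>\<^sub>M \<mu>))" for y
  proof -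
    have "complex_of_real ((norm (charfun \<mu> y))\<^sup>2) = charfun \<mu> y * cnj (charfun \<mu> y)"
      by (rule complex_norm_square)
    also have "\<dots> = (CLINT x|\<mu>. CLINT x'|\<mu>. iexp (y \<bullet> (x - x')))"
    proof -
      have "iexp (y \<bullet> (x - x')) = iexp (y \<bullet> x) * cnj (iexp (y \<bullet> x'))" for x x'
        by (simp add: inner_diff_right exp_cnj algebra_simps flip: exp_add)
      then show ?thesis by (simp add: charfun_def del: complex_cnj_mult flip: integral_cnj exp_cnj)
    qed
    also have "\<dots> = (CLINT z|\<mu> \<Otimes>\<^sub>M \<mu>. iexp (y \<bullet> (fst z - snd z)))"
      by (subst integral_fst'[symmetric]) (auto intro!: complex_integrable_iexp prob_space_axioms)
    finally have "(norm (charfun \<mu> y))\<^sup>2 = Re (CLINT z|\<mu> \<Otimes>\<^sub>M \<mu>. iexp (y \<bullet> (fst z - snd z)))"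
      by (metis Re_complex_of_real)
    also have "\<dots> = (\<integral>z. Re (iexp (y \<bullet> (fst z - snd z))) \<partial>(\<mu> \<Otimes>\<^sub>M \<mu>))"
      by (intro integral_Re[symmetric] complex_integrable_iexp prob_space_axioms) simp
    finally show ?thesis by (simp add: Re_exp)
  qed
  have intc: "integrable (\<mu> \<Otimes>\<^sub>M \<mu>) (\<lambda>z. cos (y \<bullet> (fst z - snd z)))" for y
    by (rule integrable_bounded_prob[where B=1]) (auto intro: prob_space_axioms)
  have one: "(\<integral>z. (1::real) \<partial>(\<mu> \<Otimes>\<^sub>M \<mu>)) = 1" using prob_space by simp
  have "1 - (norm (charfun \<mu> (2 *\<^sub>R y)))\<^sup>2 = (\<integral>z. 1 - cos (2 *\<^sub>R y \<bullet> (fst z - snd z)) \<partial>(\<mu> \<Otimes>\<^sub>M \<mu>))"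
    using intc[of "2 *\<^sub>R y"] one unfolding sym by (subst Bochner_Integration.integral_diff) auto
  also have "\<dots> \<le> (\<integral>z. 4 * (1 - cos (y \<bullet> (fst z - snd z))) \<partial>(\<mu> \<Otimes>\<^sub>M \<mu>))"
  proof (rule integral_mono)
    fix z :: "(real^'d) \<times> (real^'d)"
    let ?t = "y \<bullet> (fst z - snd z)"
    \<comment> \<open>The inequality comes from the identity 1 - cos 2t = 4 (1 - cos t) - 2 (1 - cos
      t)^2.\<close>
    have "0 \<le> (1 - cos ?t)\<^sup>2" by simp
    then show "1 - cos (2 *\<^sub>R y \<bullet> (fst z - snd z)) \<le> 4 * (1 - cos ?t)"
      using cos_double_cos[of ?t] by (simp add: power2_eq_square ring_distribs mult.commute)
  qed (use intc[of y] intc[of "2 *\<^sub>R y"] in auto)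
  also have "\<dots> = 4 * (1 - (norm (charfun \<mu> y))\<^sup>2)"
    using intc[of "y"] one unfolding sym by simp
  finally show ?thesis .
qed

text \<open>Near 0 a root \<kappa> of high order has modulus close to 1, and \<open>k\<close>
  doublings carry \<open>x = y / 2 ^ k\<close> to \<open>y\<close> while enlarging the defect
  \<open>1 - norm (charfun \<kappa> x) ^ 2\<close> by at most \<open>4 ^ k\<close>. The order of the
  root is chosen after \<open>k\<close>, so the defect at \<open>y\<close> stays below 1 and neither
  \<kappa> nor \<nu> has a zero there.\<close>

lemma charfun_ID_nonzero:
  fixes \<nu> :: "(real ^ 'd) measure"
  assumes "\<nu> \<in> ID" shows "charfun \<nu> y \<noteq> 0"
proof -
  have \<nu>: "\<nu> \<in> borel_probs" using assms by (simp add: ID_iff_charfun)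
  have "(\<lambda>x. (norm (charfun \<nu> x))\<^sup>2) \<midarrow>0\<rightarrow> (norm (charfun \<nu> 0))\<^sup>2"
    using continuous_charfun[OF \<nu>] by (auto simp: continuous_on_def intro!: tendsto_intros)
  then have "\<forall>\<^sub>F x in at 0. (norm (charfun \<nu> x))\<^sup>2 > 1/2"
    by (rule order_tendstoD) (simp add: \<nu>)
  then obtain r where r: "r > 0" "\<And>x. x \<noteq> 0 \<Longrightarrow> norm x < r \<Longrightarrow> (norm (charfun \<nu> x))\<^sup>2 > 1/2"
    unfolding eventually_at by auto
  obtain k where k: "norm y / r < 2 ^ k" using real_arch_pow[of 2] by auto
  define x where "x = (1 / 2^k) *\<^sub>R y"
  have x: "(norm (charfun \<nu> x))\<^sup>2 > 1/2"
    using r(2)[of x] k r(1) \<nu> by (cases "x = 0") (simp_all add: x_def field_simps)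
  have "(\<lambda>n. 4 ^ k * (1 - (1/2) powr (1 / real (Suc n)))) \<longlonglongrightarrow> 4 ^ k * (1 - (1/2) powr 0)"
    by (intro tendsto_intros LIMSEQ_Suc lim_1_over_n) auto
  then have "\<forall>\<^sub>F n in sequentially. 4 ^ k * (1 - (1/2) powr (1 / real (Suc n))) < (1::real)"
    by (rule order_tendstoD) simp
  then obtain n where n: "4 ^ k * (1 - (1/2) powr (1 / real (Suc n))) < (1::real)"
    by (auto simp: eventually_sequentially)
  obtain \<kappa> where \<kappa>: "\<kappa> \<in> borel_probs" "\<And>y. charfun \<kappa> y ^ Suc n = charfun \<nu> y"
    using assms unfolding ID_iff_charfun by (metis le_add1 plus_1_eq_Suc)
  have *: "1 - (norm (charfun \<kappa> (2^j *\<^sub>R x)))\<^sup>2 \<le> 4^j * (1 - (norm (charfun \<kappa> x))\<^sup>2)" for j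
  proof (induction j)
    case (Suc j)
    show ?case using charfun_double_le[OF \<kappa>(1), of "2^j *\<^sub>R x"] Suc by simp
  qed simp
  have "(1/2) powr (1 / real (Suc n)) \<le> ((norm (charfun \<nu> x))\<^sup>2) powr (1 / real (Suc n))"
    using x by (intro powr_mono2) auto
  also have "\<dots> = ((norm (charfun \<kappa> x))\<^sup>2)"
  proof -
    have nz: "norm (charfun \<kappa> x) > 0" using x \<kappa>(2)[of x] by (cases "charfun \<kappa> x = 0") auto
    have "(norm (charfun \<nu> x))\<^sup>2 = ((norm (charfun \<kappa> x))\<^sup>2) ^ Suc n"
      by (simp only: \<kappa>(2)[symmetric] norm_power power_mult[symmetric] mult.commute)
    also have "\<dots> = ((norm (charfun \<kappa> x))\<^sup>2) powr real (Suc n)"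
      using nz by (subst powr_realpow) auto
    finally show ?thesis using nz by (simp add: powr_powr)
  qed
  finally have "4 ^ k * (1 - (norm (charfun \<kappa> x))\<^sup>2) < 1"
    using n by (smt (verit) mult_left_mono zero_le_power)
  with *[of k] have "charfun \<kappa> y \<noteq> 0"
    by (auto simp: x_def)
  then show ?thesis using \<kappa>(2)[of y] by (metis power_eq_0_iff)
qed

text \<open>The difference takes values among the multiples of 2 pi i, which are 2 pi apart; by
  continuity on a connected space it is constant.\<close>

lemma continuous_log_unique:
  fixes f g :: "'a::real_normed_vector \<Rightarrow> complex"
  assumes "continuous_on UNIV f" "continuous_on UNIV g" "f 0 = g 0" "\<And>x. exp (f x) = exp (g x)"
  shows "f = g"
proof -
  have "(\<lambda>x. f x - g x) constant_on UNIV"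
  proof (rule continuous_discrete_range_constant)
    fix x :: 'a assume "x \<in> UNIV"
    show "\<exists>e>0. \<forall>y. y \<in> UNIV \<and> f y - g y \<noteq> f x - g x \<longrightarrow> e \<le> norm (f y - g y - (f x - g x))"
    proof (intro exI[of _ "2*pi"] conjI allI impI)
      fix y assume y: "y \<in> UNIV \<and> f y - g y \<noteq> f x - g x"
      obtain n :: int where n: "f x = g x + (of_int (2 * n) * pi) * \<i>" using assms(4)[of x] exp_eq by blast
      obtain m :: int where m: "f y = g y + (of_int (2 * m) * pi) * \<i>" using assms(4)[of y] exp_eq by blast
      have eq: "f y - g y - (f x - g x) = (of_int (2 * (m - n)) * pi) * \<i>" by (simp add: n m algebra_simps)
      then have "m \<noteq> n" using y by auto
      then have "1 \<le> \<bar>real_of_int (m - n)\<bar>" by linarith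
      then have "2*pi*1 \<le> 2*pi*\<bar>real_of_int (m - n)\<bar>" by (intro mult_left_mono) auto
      then show "2*pi \<le> norm (f y - g y - (f x - g x))"
        unfolding eq by (simp add: norm_mult algebra_simps flip: of_int_diff)
    qed simp
  qed (use assms in \<open>auto intro!: continuous_intros\<close>)
  then obtain c where "\<And>x. f x - g x = c" by (auto simp: constant_on_def)
  then show ?thesis using assms(3) by (metis eq_iff_diff_eq_0 ext)
qed

lemma log_charfun_eqI:
  assumes "continuous_on UNIV \<phi>" "\<phi> 0 = 0" "\<And>y. exp (\<phi> y) = charfun \<mu> y"
  shows "log_charfun \<mu> = \<phi>"
  unfolding log_charfun_def
  by (rule the_equality) (use assms in \<open>auto intro!: continuous_log_unique\<close>)

lemma log_charfun_nonzero:
  fixes \<mu> :: "(real ^ 'd) measure"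
  assumes "\<mu> \<in> borel_probs" "\<And>y. charfun \<mu> y \<noteq> 0"
  shows "continuous_on UNIV (log_charfun \<mu>)" "log_charfun \<mu> 0 = 0"
    "\<And>y. exp (log_charfun \<mu> y) = charfun \<mu> y"
proof -
  obtain g where g: "continuous_on UNIV g" "\<And>y. charfun \<mu> y = exp (g y)"
    using continuous_logarithm_on_contractible[of "UNIV :: (real^'d) set" "charfun \<mu>"]
      continuous_charfun[OF assms(1)] assms(2) by auto
  have eg: "exp (g 0) = 1" using g(2)[of 0] assms(1) by simp
  have "log_charfun \<mu> = (\<lambda>y. g y - g 0)"
    by (rule log_charfun_eqI) (use g eg in \<open>auto intro!: continuous_intros simp: exp_diff\<close>)
  with g eg show "continuous_on UNIV (log_charfun \<mu>)" "log_charfun \<mu> 0 = 0"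
    "\<And>y. exp (log_charfun \<mu> y) = charfun \<mu> y"
    by (auto intro!: continuous_intros simp: exp_diff)
qed

lemma log_charfun_ID:
  fixes \<nu> :: "(real ^ 'd) measure"
  assumes "\<nu> \<in> ID"
  shows "continuous_on UNIV (log_charfun \<nu>)" "log_charfun \<nu> 0 = 0"
    "\<And>y. exp (log_charfun \<nu> y) = charfun \<nu> y"
  using log_charfun_nonzero[of \<nu>] charfun_ID_nonzero[OF assms] assms by (auto simp: ID_iff_charfun)

text \<open>This selects the branch of the root. Since \<open>charfun \<kappa>\<close> has no zeros,
  it has a continuous logarithm itself, and \<open>n\<close> times that logarithm is one for \<nu>;
  uniqueness identifies the two.\<close>

lemma charfun_root:
  fixes \<nu> :: "(real ^ 'd) measure" and n :: nat
  assumes "\<nu> \<in> ID" "n \<ge> 1" "\<kappa> \<in> borel_probs" "\<And>y. charfun \<kappa> y ^ n = charfun \<nu> y"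
  shows "charfun \<kappa> y = exp (log_charfun \<nu> y / n)"
proof -
  have nz: "charfun \<kappa> y \<noteq> 0" for y
    using assms(2) assms(4)[of y] charfun_ID_nonzero[OF assms(1), of y] by (auto simp: power_0_left)
  note \<kappa> = log_charfun_nonzero[OF assms(3) nz]
  have "log_charfun \<nu> = (\<lambda>y. n * log_charfun \<kappa> y)"
    by (rule log_charfun_eqI)
       (use \<kappa> in \<open>auto intro!: continuous_intros simp: exp_of_nat_mult assms(4)\<close>)
  then show ?thesis using \<kappa>(3)[of y] assms(2) by simp
qed

lemma ID_root:
  fixes \<nu> :: "(real ^ 'd) measure" and n :: nat
  assumes "\<nu> \<in> ID" "n \<ge> 1"
  obtains \<kappa> where "\<kappa> \<in> borel_probs" "\<And>y. charfun \<kappa> y = exp (log_charfun \<nu> y / n)"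
proof -
  obtain \<kappa> where \<kappa>: "\<kappa> \<in> borel_probs" "\<And>y. charfun \<kappa> y ^ n = charfun \<nu> y"
    using assms unfolding ID_iff_charfun by metis
  with charfun_root[OF assms] that show ?thesis by blast
qed

section \<open>Counting the oscillations of a random walk\<close>

text \<open>
  The state consists of the displacement since the last reset and the number of resets; a reset happens
  when the displacement exceeds \<open>c\<close>. Two times at distance more than \<open>2 * c\<close> are separated by a reset.
\<close>

definition greedy_step :: "real \<Rightarrow> 'a::real_normed_vector \<times> nat \<Rightarrow> 'a \<Rightarrow> 'a \<times> nat" where
  "greedy_step c s x = (if norm (fst s + x) > c then (0, Suc (snd s)) else (fst s + x, snd s))"

primrec greedy :: "real \<Rightarrow> (nat \<Rightarrow> 'a::real_normed_vector) \<Rightarrow> 'a \<times> nat \<Rightarrow> nat \<Rightarrow> 'a \<times> nat" where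
  "greedy c \<xi> s 0 = s"
| "greedy c \<xi> s (Suc n) = greedy_step c (greedy c \<xi> s n) (\<xi> n)"

lemma greedy_case_nat:
  "greedy c (case_nat x \<xi>) s (Suc n) = greedy c \<xi> (greedy_step c s x) n"
  by (induction n) auto

lemma greedy_count_shift:
  "greedy c \<xi> (u, k + l) n = (fst (greedy c \<xi> (u, k) n), snd (greedy c \<xi> (u, k) n) + l)"
  by (induction n) (auto simp: greedy_step_def)

lemma snd_greedy_mono: "m \<le> n \<Longrightarrow> snd (greedy c \<xi> s m) \<le> snd (greedy c \<xi> s n)"
  by (induction rule: dec_induct) (auto simp: greedy_step_def)

lemma norm_fst_greedy_le:
  "0 \<le> c \<Longrightarrow> norm (fst s) \<le> c \<Longrightarrow> norm (fst (greedy c \<xi> s n)) \<le> c"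
  by (induction n) (auto simp: greedy_step_def)

lemma greedy_no_count:
  assumes "a \<le> b" "snd (greedy c \<xi> s b) = snd (greedy c \<xi> s a)"
  shows "fst (greedy c \<xi> s b) = fst (greedy c \<xi> s a) + (\<Sum>j=a..<b. \<xi> j)"
  using assms
proof (induction rule: dec_induct)
  case (step m)
  have "snd (greedy c \<xi> s a) \<le> snd (greedy c \<xi> s m)" "snd (greedy c \<xi> s m) \<le> snd (greedy c \<xi> s (Suc m))"
    using step.hyps by (intro snd_greedy_mono; simp)+
  with step.prems have eq: "snd (greedy c \<xi> s m) = snd (greedy c \<xi> s a)" by simp
  with step.prems have "fst (greedy c \<xi> s (Suc m)) = fst (greedy c \<xi> s m) + \<xi> m"
    by (auto simp: greedy_step_def split: if_splits)
  then show ?case using step.IH[OF eq] step.hyps by (simp add: add.assoc)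
qed simp

lemma greedy_count_ge:
  assumes "0 \<le> c" "norm (fst s) \<le> c"
    and "\<And>i. i < p \<Longrightarrow> a i \<le> b i" "\<And>i. Suc i < p \<Longrightarrow> b i \<le> a (Suc i)" "\<And>i. i < p \<Longrightarrow> b i \<le> n"
    and "\<And>i. i < p \<Longrightarrow> norm (\<Sum>j=a i..<b i. \<xi> j) > 2 * c"
  shows "p \<le> snd (greedy c \<xi> s n)"
proof -
  have jump: "snd (greedy c \<xi> s (a i)) < snd (greedy c \<xi> s (b i))" if "i < p" for i
  proof (rule ccontr)
    assume "\<not> ?thesis"
    with snd_greedy_mono[OF assms(3)[OF that], of c \<xi> s]
    have "fst (greedy c \<xi> s (b i)) = fst (greedy c \<xi> s (a i)) + (\<Sum>j=a i..<b i. \<xi> j)"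
      by (intro greedy_no_count assms that) auto
    then have "norm (\<Sum>j=a i..<b i. \<xi> j) \<le> c + c"
      using norm_fst_greedy_le[OF assms(1,2), of \<xi>]
      by (metis add_diff_cancel_left' add_mono norm_triangle_ineq4 order_trans)
    with assms(6)[OF that] show False by simp
  qed
  have "i < p \<Longrightarrow> Suc i \<le> snd (greedy c \<xi> s (b i))" for i
  proof (induction i)
    case 0
    then show ?case using jump[of 0] by simp
  next
    case (Suc i)
    have "Suc i \<le> snd (greedy c \<xi> s (a (Suc i)))"
      using Suc snd_greedy_mono[OF assms(4)[OF Suc.prems], of c \<xi> s] by simp
    then show ?case using jump[of "Suc i"] Suc by simp
  qed
  then show ?thesis
    using snd_greedy_mono[OF assms(5)[of "p - 1"], of c \<xi> s] by (cases p) fastforce+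
qed

section \<open>Maximal inequality and expected number of resets for i.i.d. steps\<close>

locale iid_sequence = sequence_space \<kappa>
  for \<kappa> :: "'a::{real_normed_vector, second_countable_topology} measure" +
  assumes sets_\<kappa>: "sets \<kappa> = sets borel"
begin

lemma measurable_component: "(\<lambda>\<xi>. \<xi> i) \<in> borel_measurable S"
  using measurable_component_singleton[of i UNIV "\<lambda>_. \<kappa>"] by (simp add: measurable_cong_sets[OF refl sets_\<kappa>])

text \<open>First-step decomposition: given the first entry, the remaining sequence again has law
  \<open>S\<close>. The recursions for \<open>exceed\<close> and for the expected count rest on
  it.\<close>

lemma nn_integral_S_Suc:
  assumes f[measurable]: "f \<in> borel_measurable S"
  shows "(\<integral>\<^sup>+\<xi>. f \<xi> \<partial>S) = (\<integral>\<^sup>+x. \<integral>\<^sup>+\<xi>. f (case_nat x \<xi>) \<partial>S \<partial>\<kappa>)"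
proof -
  have "(\<integral>\<^sup>+\<xi>. f \<xi> \<partial>S) = (\<integral>\<^sup>+\<xi>. f \<xi> \<partial>distr (\<kappa> \<Otimes>\<^sub>M S) S (\<lambda>(s, \<omega>). case_nat s \<omega>))"
    by (simp add: PiM_iter)
  also have "\<dots> = (\<integral>\<^sup>+z. f (case_nat (fst z) (snd z)) \<partial>(\<kappa> \<Otimes>\<^sub>M S))"
    by (subst nn_integral_distr) (auto simp: split_beta)
  also have "\<dots> = (\<integral>\<^sup>+x. \<integral>\<^sup>+\<xi>. f (case_nat x \<xi>) \<partial>S \<partial>\<kappa>)"
    by (subst P.nn_integral_fst[symmetric]) (auto)
  finally show ?thesis .
qed

lemma measurable_greedy[measurable]: "(\<lambda>\<xi>. greedy c \<xi> s n) \<in> S \<rightarrow>\<^sub>M borel \<Otimes>\<^sub>M count_space UNIV"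
proof (induction n)
  case (Suc n)
  note [measurable] = Suc measurable_component
  show ?case unfolding greedy.simps greedy_step_def by measurable
qed (simp add: space_pair_measure)

text \<open>Exceedance at the single time \<open>n\<close>; the starting point \<open>u\<close>
  stays free because first-step recursions move it.\<close>

definition exceed :: "real \<Rightarrow> nat \<Rightarrow> 'a \<Rightarrow> ennreal" where
  "exceed e n u = emeasure S {\<xi>\<in>space S. norm (u + (\<Sum>i<n. \<xi> i)) > e}"

lemma exceed_nn: "exceed e n u = (\<integral>\<^sup>+\<xi>. indicator {v. norm v > e} (u + (\<Sum>i<n. \<xi> i)) \<partial>S)"
proof -
  have "exceed e n u = (\<integral>\<^sup>+\<xi>. indicator {\<xi>\<in>space S. norm (u + (\<Sum>i<n. \<xi> i)) > e} \<xi> \<partial>S)"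
    unfolding exceed_def using measurable_component[measurable] by (intro nn_integral_indicator[symmetric]) measurable
  also have "\<dots> = (\<integral>\<^sup>+\<xi>. indicator {v. norm v > e} (u + (\<Sum>i<n. \<xi> i)) \<partial>S)"
    by (rule nn_integral_cong) (simp split: split_indicator)
  finally show ?thesis .
qed

lemma exceed_0: "exceed e 0 u = indicator {v. norm v > e} u"
  unfolding exceed_nn by (simp add: P.emeasure_space_1)

lemma exceed_Suc: "exceed e (Suc n) u = (\<integral>\<^sup>+x. exceed e n (u + x) \<partial>\<kappa>)"
proof -
  have "exceed e (Suc n) u = (\<integral>\<^sup>+x. \<integral>\<^sup>+\<xi>. indicator {v. norm v > e} (u + (\<Sum>i<Suc n. case_nat x \<xi> i)) \<partial>S \<partial>\<kappa>)"
    unfolding exceed_nn using measurable_component[measurable] by (intro nn_integral_S_Suc) measurable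
  then show ?thesis unfolding exceed_nn by (simp add: sum.lessThan_Suc_shift add.assoc del: sum.lessThan_Suc)
qed

lemma measurable_exceed: "exceed e n \<in> borel_measurable borel"
proof (induction n)
  case (Suc n)
  note [measurable_cong] = sets_\<kappa>
  have "(\<lambda>z. exceed e n (fst z + snd z)) \<in> borel_measurable (borel \<Otimes>\<^sub>M \<kappa>)"
    by (rule measurable_compose[OF _ Suc]) measurable
  then have [measurable]: "(\<lambda>u. \<integral>\<^sup>+x. exceed e n (u + x) \<partial>\<kappa>) \<in> borel_measurable borel"
    by (intro M.borel_measurable_nn_integral) (simp add: split_beta')
  have "exceed e (Suc n) = (\<lambda>u. \<integral>\<^sup>+x. exceed e n (u + x) \<partial>\<kappa>)"
    by (rule ext) (rule exceed_Suc)
  then show ?case by simp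
qed (simp add: exceed_0 fun_eq_iff[symmetric])

lemma measurable_exceed_add: "(\<lambda>x. exceed e n (u + x)) \<in> borel_measurable \<kappa>"
proof (rule measurable_compose[OF _ measurable_exceed])
  note [measurable_cong] = sets_\<kappa>
  show "(\<lambda>x. u + x) \<in> borel_measurable \<kappa>" by measurable
qed

text \<open>Walks from \<open>u\<close> and \<open>v\<close> driven by the same steps keep their
  distance, which is larger than \<open>2 * e\<close>; at time \<open>n\<close> at least one of them
  is therefore outside the ball of radius \<open>e\<close>.\<close>

lemma exceed_add_ge_1:
  assumes "norm (u - v) > 2 * e"
  shows "1 \<le> exceed e n u + exceed e n v"
  using assms
proof (induction n arbitrary: u v)
  case 0
  have "norm u > e \<or> norm v > e" using 0 norm_triangle_ineq4[of u v] by linarith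
  then show ?case by (auto simp: exceed_0)
next
  case (Suc n)
  note [measurable_cong] = sets_\<kappa>
  have "1 = (\<integral>\<^sup>+x. 1 \<partial>\<kappa>)" by (simp add: M.emeasure_space_1)
  also have "\<dots> \<le> (\<integral>\<^sup>+x. exceed e n (u + x) + exceed e n (v + x) \<partial>\<kappa>)"
    by (intro nn_integral_mono Suc.IH) (use Suc.prems in simp)
  also have "\<dots> = exceed e (Suc n) u + exceed e (Suc n) v"
    unfolding exceed_Suc by (intro nn_integral_add measurable_exceed_add)
  finally show ?case .
qed

text \<open>The probability that a walk started in \<open>u\<close> exceeds \<open>c\<close> at some time up to \<open>n\<close>, by first-step analysis.\<close>

primrec exceed_some :: "real \<Rightarrow> nat \<Rightarrow> 'a \<Rightarrow> ennreal" where
  "exceed_some c 0 u = indicator {v. norm v > c} u"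
| "exceed_some c (Suc n) u = (if norm u > c then 1 else \<integral>\<^sup>+x. exceed_some c n (u + x) \<partial>\<kappa>)"

lemma measurable_exceed_some: "exceed_some c n \<in> borel_measurable borel"
proof (induction n)
  case (Suc n)
  note [measurable_cong] = sets_\<kappa>
  have "(\<lambda>z. exceed_some c n (fst z + snd z)) \<in> borel_measurable (borel \<Otimes>\<^sub>M \<kappa>)"
    by (rule measurable_compose[OF _ Suc]) measurable
  then have [measurable]: "(\<lambda>u. \<integral>\<^sup>+x. exceed_some c n (u + x) \<partial>\<kappa>) \<in> borel_measurable borel"
    by (intro M.borel_measurable_nn_integral) (simp add: split_beta')
  have "exceed_some c (Suc n) = (\<lambda>u. if norm u > c then 1 else \<integral>\<^sup>+x. exceed_some c n (u + x) \<partial>\<kappa>)"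
    by (rule ext) (rule exceed_some.simps)
  then show ?case by simp
qed (simp add: fun_eq_iff[symmetric])

lemma measurable_exceed_some_add: "(\<lambda>x. exceed_some c n (u + x)) \<in> borel_measurable \<kappa>"
proof (rule measurable_compose[OF _ measurable_exceed_some])
  note [measurable_cong] = sets_\<kappa>
  show "(\<lambda>x. u + x) \<in> borel_measurable \<kappa>" by measurable
qed

lemma exceed_some_eq_1: "norm u > c \<Longrightarrow> exceed_some c n u = 1"
  by (cases n) auto

text \<open>Ottaviani's maximal inequality.\<close>

lemma exceed_some_le:
  assumes "\<And>k. k \<le> n \<Longrightarrow> 3 * exceed e k 0 \<le> 1" "0 \<le> e"
  shows "2 * exceed_some (2 * e) n u \<le> 3 * exceed e n u"
proof -
  \<comment> \<open>The walk from 0 is outside the ball with probability at most 1/3, so by the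
    coupling the walk from a far point \<open>v\<close> is outside with probability at least 2/3.
    This is the origin of the factors 2 and 3.\<close>
  have big: "2 \<le> 3 * exceed e k v" if "norm v > 2 * e" "k \<le> n" for k v
  proof -
    have "1 + 2 \<le> 3 * (exceed e k v + exceed e k 0)"
      using mult_left_mono[OF exceed_add_ge_1[of e v 0 k], of 3] that by simp
    also have "\<dots> \<le> 1 + 3 * exceed e k v"
      using add_left_mono[OF assms(1)[OF that(2)], of "3 * exceed e k v"] by (simp add: ring_distribs add.commute)
    finally show ?thesis by (subst (asm) ennreal_add_left_cancel_le) auto
  qed
  have "m \<le> n \<Longrightarrow> 2 * exceed_some (2 * e) m u \<le> 3 * exceed e m u" for m
  proof (induction m arbitrary: u)
    case 0
    then show ?case using big[of u 0] assms(2) by (cases "norm u > 2 * e") (auto simp: )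
  next
    case (Suc m)
    note [measurable_cong] = sets_\<kappa>
    show ?case
    proof (cases "norm u > 2 * e")
      case True
      then show ?thesis using big[of u "Suc m"] Suc.prems by simp
    next
      case False
      then have "2 * exceed_some (2 * e) (Suc m) u = (\<integral>\<^sup>+x. 2 * exceed_some (2 * e) m (u + x) \<partial>\<kappa>)"
        by (simp add: nn_integral_cmult[OF measurable_exceed_some_add])
      also have "\<dots> \<le> (\<integral>\<^sup>+x. 3 * exceed e m (u + x) \<partial>\<kappa>)"
        using Suc by (intro nn_integral_mono Suc.IH) simp
      also have "\<dots> = 3 * exceed e (Suc m) u"
        unfolding exceed_Suc by (intro nn_integral_cmult measurable_exceed_add)
      finally show ?thesis .
    qed
  qed
  then show ?thesis by simp
qed

text \<open>
  By induction on \<open>k\<close>, the expected count from \<open>u\<close> is at most \<open>2 * exceed_some (2 * e) k u\<close>: after the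
  first reset the walk restarts in \<open>0\<close>, where this bound is at most \<open>1\<close>.
\<close>

lemma nn_integral_greedy_le:
  assumes small: "\<And>k. k \<le> n \<Longrightarrow> 3 * exceed e k 0 \<le> 1" and "0 \<le> e"
  shows "(\<integral>\<^sup>+\<xi>. of_nat (snd (greedy (2 * e) \<xi> (0, 0) n)) \<partial>S) \<le> 1"
proof -
  note [measurable_cong] = sets_\<kappa>
  define m where "m k u = (\<integral>\<^sup>+\<xi>. of_nat (snd (greedy (2 * e) \<xi> (u, 0) k)) \<partial>S)" for k u
  have q0: "2 * exceed_some (2 * e) k 0 \<le> 1" if "k \<le> n" for k
    using exceed_some_le[of k e 0] small assms(2) that by (metis order_trans le_trans)
  have m_Suc: "m (Suc k) u = (\<integral>\<^sup>+x. (if norm (u + x) > 2 * e then 1 + m k 0 else m k (u + x)) \<partial>\<kappa>)" for k u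
  proof -
    have "m (Suc k) u = (\<integral>\<^sup>+x. \<integral>\<^sup>+\<xi>. of_nat (snd (greedy (2 * e) (case_nat x \<xi>) (u, 0) (Suc k))) \<partial>S \<partial>\<kappa>)"
      unfolding m_def by (rule nn_integral_S_Suc) measurable
    also have "\<dots> = (\<integral>\<^sup>+x. (if norm (u + x) > 2 * e then 1 + m k 0 else m k (u + x)) \<partial>\<kappa>)"
    proof (rule nn_integral_cong)
      fix x
      have "snd (greedy (2 * e) \<xi> (0, Suc 0) k) = Suc (snd (greedy (2 * e) \<xi> (0, 0) k))" for \<xi> :: "nat \<Rightarrow> 'a"
        using greedy_count_shift[of "2 * e" \<xi> 0 0 1 k] by simp
      then have "(\<integral>\<^sup>+\<xi>. of_nat (snd (greedy (2 * e) \<xi> (0, Suc 0) k)) \<partial>S) = (\<integral>\<^sup>+\<xi>. 1 + of_nat (snd (greedy (2 * e) \<xi> (0, 0) k)) \<partial>S)"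
        by (intro nn_integral_cong) simp
      also have "\<dots> = 1 + m k 0"
        unfolding m_def by (subst nn_integral_add) (auto simp: P.emeasure_space_1)
      finally show "(\<integral>\<^sup>+\<xi>. of_nat (snd (greedy (2 * e) (case_nat x \<xi>) (u, 0) (Suc k))) \<partial>S) = (if norm (u + x) > 2 * e then 1 + m k 0 else m k (u + x))"
        unfolding greedy_case_nat by (simp add: greedy_step_def m_def)
    qed
    finally show ?thesis .
  qed
  have "k \<le> n \<Longrightarrow> m k u \<le> 2 * exceed_some (2 * e) k u" for k u
  proof (induction k arbitrary: u)
    case 0
    then show ?case by (simp add: m_def)
  next
    case (Suc k)
    have m0: "m k 0 \<le> 1" using Suc.IH[of 0] q0[of k] Suc.prems by simp
    \<comment> \<open>The case \<open>norm u > 2 * e\<close> needs an argument: there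
      \<open>exceed_some\<close> stops at once with value 1, whereas the count continues from
      \<open>u\<close>, which has not been reset.\<close>
    have le: "(\<integral>\<^sup>+x. exceed_some (2 * e) k (u + x) \<partial>\<kappa>) \<le> exceed_some (2 * e) (Suc k) u"
    proof (cases "norm u > 2 * e")
      case True
      have "exceed_some (2 * e) j v \<le> 1" for j v
      proof (induction j arbitrary: v)
        case (Suc j)
        have "(\<integral>\<^sup>+x. exceed_some (2 * e) j (v + x) \<partial>\<kappa>) \<le> (\<integral>\<^sup>+x. 1 \<partial>\<kappa>)"
          by (intro nn_integral_mono Suc)
        then show ?case by (simp add: M.emeasure_space_1)
      qed (simp split: split_indicator)
      then have "(\<integral>\<^sup>+x. exceed_some (2 * e) k (u + x) \<partial>\<kappa>) \<le> (\<integral>\<^sup>+x. 1 \<partial>\<kappa>)" by (intro nn_integral_mono)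
      then show ?thesis using True by (simp add: M.emeasure_space_1)
    qed simp
    \<comment> \<open>Where the first step triggers a reset, the count is at most
      \<open>1 + m k 0 \<le> 2\<close>, and \<open>exceed_some\<close> equals 1 there; elsewhere the
      induction hypothesis applies. This is why the bound carries the factor 2.\<close>
    have "m (Suc k) u \<le> (\<integral>\<^sup>+x. 2 * exceed_some (2 * e) k (u + x) \<partial>\<kappa>)"
      unfolding m_Suc
      using Suc m0 by (intro nn_integral_mono) (auto simp: exceed_some_eq_1 intro: order_trans[OF add_left_mono[OF m0]])
    also have "\<dots> = 2 * (\<integral>\<^sup>+x. exceed_some (2 * e) k (u + x) \<partial>\<kappa>)"
      by (intro nn_integral_cmult measurable_exceed_some_add)
    also have "\<dots> \<le> 2 * exceed_some (2 * e) (Suc k) u"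
      using le by (intro mult_left_mono) auto
    finally show ?case .
  qed
  from this[of n 0] q0[of n] show ?thesis unfolding m_def by simp
qed

end

section \<open>Independent increments along the dyadics\<close>

lemma sets_PiM_borel_probs:
  fixes \<kappa> :: "(real ^ 'd) measure"
  assumes "\<kappa> \<in> borel_probs"
  shows "sets (\<Pi>\<^sub>M i\<in>(UNIV::nat set). \<kappa>) = sets (borel :: (nat \<Rightarrow> real ^ 'd) measure)"
  by (subst sets_PiM_cong[OF refl borel_probsD(2)[OF assms]]) (auto simp: sets_PiM_equal_borel)

lemma prob_space_iid:
  assumes "\<kappa> \<in> borel_probs" shows "prob_space (\<Pi>\<^sub>M i\<in>(UNIV::nat set). \<kappa>)"
  by (intro prob_space_PiM borel_probsD assms)

lemma iid_component_measurable:
  assumes "\<kappa> \<in> borel_probs"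
  shows "(\<lambda>\<omega>. \<omega> i) \<in> borel_measurable (\<Pi>\<^sub>M i\<in>(UNIV::nat set). \<kappa>)"
  using measurable_component_singleton[of i "UNIV::nat set" "\<lambda>_. \<kappa>"]
  by (simp add: measurable_cong_sets[OF refl borel_probsD(2)[OF assms]])

lemma iid_indep_vars:
  fixes \<kappa> :: "(real ^ 'd) measure"
  assumes "\<kappa> \<in> borel_probs"
  shows "prob_space.indep_vars (\<Pi>\<^sub>M i\<in>(UNIV::nat set). \<kappa>) (\<lambda>_. borel) (\<lambda>i \<omega>. \<omega> i) UNIV"
proof -
  interpret prob_space "\<Pi>\<^sub>M i\<in>(UNIV::nat set). \<kappa>" by (rule prob_space_iid[OF assms])
  have *: "distr (\<Pi>\<^sub>M i\<in>(UNIV::nat set). \<kappa>) borel (\<lambda>\<omega>. \<omega> i) = \<kappa>" for i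
    using distr_PiM_component[of "UNIV::nat set" "\<lambda>_. \<kappa>" i] borel_probsD[OF assms]
    by (subst distr_cong[OF refl borel_probsD(2)[OF assms, symmetric] refl]) auto
  show ?thesis
    by (subst indep_vars_iff_distr_eq_PiM)
       (auto simp: * restrict_UNIV iid_component_measurable[OF assms] intro!: distr_id2 sets_PiM_cong borel_probsD(2)[OF assms, symmetric])
qed

lemma iid_blocks_indep_vars:
  fixes \<kappa> :: "(real ^ 'd) measure" and K :: "'i \<Rightarrow> nat set"
  assumes "\<kappa> \<in> borel_probs" "disjoint_family_on K L"
  shows "prob_space.indep_vars (\<Pi>\<^sub>M i\<in>(UNIV::nat set). \<kappa>) (\<lambda>_. borel) (\<lambda>j \<omega>. \<Sum>i\<in>K j. \<omega> i) L"
proof -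
  interpret prob_space "\<Pi>\<^sub>M i\<in>(UNIV::nat set). \<kappa>" by (rule prob_space_iid[OF assms(1)])
  have "indep_vars (\<lambda>j. \<Pi>\<^sub>M i\<in>K j. borel) (\<lambda>j \<omega>. \<lambda>i\<in>K j. \<omega> i) L"
    by (rule indep_vars_restrict[OF iid_indep_vars[OF assms(1)] _ assms(2)]) simp
  then have "indep_vars (\<lambda>_. borel) (\<lambda>j \<omega>. \<Sum>i\<in>K j. (\<lambda>i\<in>K j. \<omega> i) i) L"
    by (rule indep_vars_compose2) measurable
  then show ?thesis by simp
qed

lemma charfun_iid_sum:
  fixes \<kappa> :: "(real ^ 'd) measure"
  assumes "\<kappa> \<in> borel_probs" "finite A"
  shows "charfun (distr (\<Pi>\<^sub>M i\<in>(UNIV::nat set). \<kappa>) borel (\<lambda>\<omega>. \<Sum>i\<in>A. \<omega> i)) y = charfun \<kappa> y ^ card A"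
proof -
  let ?S = "\<Pi>\<^sub>M i\<in>(UNIV::nat set). \<kappa>"
  interpret prob_space ?S by (rule prob_space_iid[OF assms(1)])
  note [measurable] = iid_component_measurable[OF assms(1)]
  have "charfun (distr ?S borel (\<lambda>\<omega>. \<Sum>i\<in>A. \<omega> i)) y = (CLINT \<omega>|?S. (\<Prod>i\<in>A. iexp (y \<bullet> \<omega> i)))"
    by (subst charfun_distr) (auto simp: inner_sum_right sum_distrib_left exp_sum[OF assms(2)])
  also have "\<dots> = (\<Prod>i\<in>A. CLINT \<omega>|?S. iexp (y \<bullet> \<omega> i))"
  proof (rule indep_vars_lebesgue_integral[OF assms(2)])
    show "indep_vars (\<lambda>_. borel) (\<lambda>i \<omega>. iexp (y \<bullet> \<omega> i)) A"
      by (rule indep_vars_compose2[OF indep_vars_subset[OF iid_indep_vars[OF assms(1)] subset_UNIV]]) measurable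
    show "complex_integrable ?S (\<lambda>\<omega>. iexp (y \<bullet> \<omega> i))" for i
      by (rule complex_integrable_iexp[OF prob_space_axioms]) measurable
  qed
  also have "\<dots> = (\<Prod>i\<in>A. charfun \<kappa> y)"
  proof (rule prod.cong[OF refl])
    fix i
    have "(CLINT \<omega>|?S. iexp (y \<bullet> \<omega> i)) = (CLINT x|distr ?S \<kappa> (\<lambda>\<omega>. \<omega> i). iexp (y \<bullet> x))"
      by (subst integral_distr) (auto simp: measurable_cong_sets[OF borel_probsD(2)[OF assms(1)] refl])
    then show "(CLINT \<omega>|?S. iexp (y \<bullet> \<omega> i)) = charfun \<kappa> y"
      using distr_PiM_component[of "UNIV::nat set" "\<lambda>_. \<kappa>" i] borel_probsD(1)[OF assms(1)]
      by (simp add: charfun_def)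
  qed
  finally show ?thesis by simp
qed

text \<open>Passes from the increments over dyadic intervals of level \<open>n + 1\<close> to those
  of level \<open>n\<close>.\<close>

definition coarsen :: "(nat \<Rightarrow> 'a::plus) \<Rightarrow> nat \<Rightarrow> 'a" where
  "coarsen x k = x (2 * k) + x (Suc (2 * k))"

lemma measurable_coarsen [measurable]:
  "(coarsen :: (nat \<Rightarrow> real ^ 'd) \<Rightarrow> _) \<in> borel_measurable borel"
proof -
  have "(coarsen :: (nat \<Rightarrow> real ^ 'd) \<Rightarrow> _) \<in> (\<Pi>\<^sub>M i\<in>UNIV. borel) \<rightarrow>\<^sub>M (\<Pi>\<^sub>M i\<in>UNIV. borel)"
    by (rule measurable_PiM_single') (auto simp: coarsen_def space_PiM)
  then show ?thesis by (simp add: measurable_cong_sets[OF sets_PiM_equal_borel sets_PiM_equal_borel])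
qed

lemma measurable_funpow_coarsen [measurable]:
  "(coarsen ^^ k :: (nat \<Rightarrow> real ^ 'd) \<Rightarrow> _) \<in> borel_measurable borel"
  by (induction k) auto

text \<open>The pairs being added are disjoint, so their sums are independent, and characteristic
  functions identify the law of each sum. This is the compatibility between neighbouring
  levels.\<close>

lemma distr_coarsen:
  fixes \<kappa> \<kappa>' :: "(real ^ 'd) measure"
  assumes \<kappa>: "\<kappa> \<in> borel_probs" and \<kappa>': "\<kappa>' \<in> borel_probs" and eq: "\<And>y. charfun \<kappa> y ^ 2 = charfun \<kappa>' y"
  shows "distr (\<Pi>\<^sub>M i\<in>(UNIV::nat set). \<kappa>) (\<Pi>\<^sub>M i\<in>UNIV. borel) coarsen = (\<Pi>\<^sub>M i\<in>(UNIV::nat set). \<kappa>')"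
proof -
  let ?S = "\<Pi>\<^sub>M i\<in>(UNIV::nat set). \<kappa>"
  interpret prob_space ?S by (rule prob_space_iid[OF assms(1)])
  note [measurable] = iid_component_measurable[OF assms(1)]
  have c: "coarsen x k = (\<Sum>i\<in>{2*k, Suc (2*k)}. x i)" for x :: "nat \<Rightarrow> real^'d" and k
    by (simp add: coarsen_def)
  have law: "distr ?S borel (\<lambda>\<omega>. coarsen \<omega> k) = \<kappa>'" for k
  proof (rule charfun_unique[OF _ \<kappa>'])
    show "distr ?S borel (\<lambda>\<omega>. coarsen \<omega> k) \<in> borel_probs"
      unfolding c by (intro borel_probs_distr prob_space_axioms) measurable
    show "charfun (distr ?S borel (\<lambda>\<omega>. coarsen \<omega> k)) y = charfun \<kappa>' y" for y
      unfolding c by (subst charfun_iid_sum[OF \<kappa>]) (auto simp: eq[symmetric] power2_eq_square)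
  qed
  have "indep_vars (\<lambda>_. borel) (\<lambda>k \<omega>. coarsen \<omega> k) UNIV"
    unfolding c by (rule iid_blocks_indep_vars[OF \<kappa>]) (auto simp: disjoint_family_on_def)
  moreover have "random_variable borel (\<lambda>\<omega>. coarsen \<omega> k)" for k
    unfolding c by measurable
  ultimately have "distr ?S (\<Pi>\<^sub>M i\<in>UNIV. borel) (\<lambda>\<omega>. \<lambda>k\<in>UNIV. coarsen \<omega> k) = (\<Pi>\<^sub>M k\<in>UNIV. distr ?S borel (\<lambda>\<omega>. coarsen \<omega> k))"
    using indep_vars_iff_distr_eq_PiM[where I=UNIV and M'="\<lambda>_. borel" and X="\<lambda>k \<omega>. coarsen \<omega> k"] by simp
  then show ?thesis by (simp add: law restrict_UNIV)
qed

text \<open>A whole sequence of increments, one for each level, is a point of a Polish space, and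
  Kolmogorov extension is applied with the levels as index set. A finite family of levels is a
  function of its finest member, which determines the joint laws.\<close>

lemma dyadic_projective_limit:
  fixes \<kappa> :: "nat \<Rightarrow> (real ^ 'd) measure"
  assumes \<kappa>: "\<And>n. \<kappa> n \<in> borel_probs" and eq: "\<And>n y. charfun (\<kappa> (Suc n)) y ^ 2 = charfun (\<kappa> n) y"
  obtains Q :: "(nat \<Rightarrow> nat \<Rightarrow> real ^ 'd) measure"
  where "prob_space Q" "\<And>n. (\<lambda>\<omega>. \<omega> n) \<in> borel_measurable Q"
    "\<And>n. distr Q borel (\<lambda>\<omega>. \<omega> n) = (\<Pi>\<^sub>M i\<in>(UNIV::nat set). \<kappa> n)"
    "AE \<omega> in Q. \<forall>n. \<omega> n = coarsen (\<omega> (Suc n))"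
proof -
  define P where "P n = (\<Pi>\<^sub>M i\<in>(UNIV::nat set). \<kappa> n)" for n
  have P: "prob_space (P n)" and sets_Pn[measurable_cong]: "sets (P n) = sets borel" for n
    unfolding P_def using prob_space_iid[OF \<kappa>] sets_PiM_borel_probs[OF \<kappa>] by auto
  have push: "distr (P (Suc n)) borel coarsen = P n" for n
    using distr_coarsen[OF \<kappa> \<kappa> eq, of n]
    unfolding P_def by (subst distr_cong[OF refl sets_PiM_equal_borel[symmetric] refl])
  have push': "distr (P (m + d)) borel (coarsen ^^ d) = P m" for m d
  proof (induction d)
    case 0
    then show ?case by (simp add: id_def distr_id2[OF sets_Pn[symmetric]])
  next
    case (Suc d)
    have "distr (P (m + Suc d)) borel (coarsen ^^ Suc d) = distr (distr (P (m + Suc d)) borel coarsen) borel (coarsen ^^ d)"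
      by (subst distr_distr) (auto simp: funpow_Suc_right simp del: funpow.simps)
    then show ?case using Suc push[of "m + d"] by (simp only: add_Suc_right)
  qed
  \<comment> \<open>The finest level occurring in \<open>J\<close>; the inserted 0 covers the empty
    family.\<close>
  define b where "b J = Max (insert 0 J)" for J :: "nat set"
  have b_mono: "b J \<le> b H" if "J \<subseteq> H" "finite H" for J H
    unfolding b_def using that by (intro Max_mono) auto
  have b_ge: "j \<le> b J" if "j \<in> J" "finite J" for j J
    unfolding b_def using that by simp
  define PF where "PF J = distr (P (b J)) (\<Pi>\<^sub>M j\<in>J. borel) (\<lambda>x. \<lambda>j\<in>J. (coarsen ^^ (b J - j)) x)" for J
  have meas: "(\<lambda>x. \<lambda>j\<in>J. (coarsen ^^ (k - j)) x) \<in> borel \<rightarrow>\<^sub>M (\<Pi>\<^sub>M j\<in>J. (borel :: (nat \<Rightarrow> real^'d) measure))" for J :: "nat set" and k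
    by (rule measurable_restrict) (auto)
  have meas': "(\<lambda>x. \<lambda>j\<in>J. (coarsen ^^ (k - j)) x) \<in> P n \<rightarrow>\<^sub>M (\<Pi>\<^sub>M j\<in>J. (borel :: (nat \<Rightarrow> real^'d) measure))" for J :: "nat set" and k n
    using meas by (simp add: measurable_cong_sets[OF sets_Pn refl])
  interpret polish_projective UNIV PF
  proof (unfold polish_projective_def, rule projective_family.intro)
    fix J :: "nat set" assume J: "finite J"
    show "prob_space (PF J)"
      unfolding PF_def by (rule prob_space.prob_space_distr[OF P meas'])
  next
    fix J H :: "nat set" assume JH: "J \<subseteq> H" "finite H"
    \<comment> \<open>Passing from \<open>H\<close> to \<open>J\<close> may lower the finest level;
      the \<open>d\<close> surplus coarsenings are absorbed by \<open>push'\<close>.\<close>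
    define d where "d = b H - b J"
    have d: "b H = b J + d" using b_mono[OF JH] by (simp add: d_def)
    have "distr (PF H) (\<Pi>\<^sub>M j\<in>J. borel) (\<lambda>f. restrict f J) =
        distr (P (b H)) (\<Pi>\<^sub>M j\<in>J. borel) (\<lambda>x. \<lambda>j\<in>J. (coarsen ^^ (b H - j)) x)"
      unfolding PF_def using JH
      by (subst distr_distr[OF measurable_restrict_subset meas'])
         (auto simp: comp_def restrict_def fun_eq_iff intro!: distr_cong)
    also have "\<dots> = distr (P (b H)) (\<Pi>\<^sub>M j\<in>J. borel) ((\<lambda>x. \<lambda>j\<in>J. (coarsen ^^ (b J - j)) x) \<circ> (coarsen ^^ d))"
    proof (rule distr_cong[OF refl refl], rule ext)
      fix x :: "nat \<Rightarrow> real^'d" and j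
      have "(coarsen ^^ (b H - j)) x = (coarsen ^^ (b J - j)) ((coarsen ^^ d) x)" if "j \<in> J"
        using b_ge[OF that] finite_subset[OF JH] by (simp add: d flip: funpow_add comp_apply[of "coarsen ^^ _"])
      then show "(\<lambda>j\<in>J. (coarsen ^^ (b H - j)) x) j = ((\<lambda>x. \<lambda>j\<in>J. (coarsen ^^ (b J - j)) x) \<circ> (coarsen ^^ d)) x j"
        by simp
    qed
    also have "\<dots> = distr (distr (P (b J + d)) borel (coarsen ^^ d)) (\<Pi>\<^sub>M j\<in>J. borel) (\<lambda>x. \<lambda>j\<in>J. (coarsen ^^ (b J - j)) x)"
      by (subst distr_distr[OF meas]) (auto simp: d)
    also have "\<dots> = PF J" by (simp add: push' PF_def)
    finally show "PF J = distr (PF H) (\<Pi>\<^sub>M j\<in>J. borel) (\<lambda>f. restrict f J)" ..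
  qed
  have rest: "(\<lambda>\<omega>. restrict \<omega> J) \<in> lim \<rightarrow>\<^sub>M (\<Pi>\<^sub>M j\<in>J. borel)" for J
    by (simp add: measurable_cong_sets[OF sets_lim refl] measurable_restrict_subset)
  have distr_lim: "distr lim (\<Pi>\<^sub>M j\<in>J. borel) (\<lambda>\<omega>. restrict \<omega> J) = PF J" if "finite J" for J
  proof (rule measure_eqI)
    fix A assume "A \<in> sets (distr lim (\<Pi>\<^sub>M j\<in>J. borel) (\<lambda>\<omega>. restrict \<omega> J))"
    then have A: "A \<in> sets (\<Pi>\<^sub>M j\<in>J. borel)" by simp
    show "emeasure (distr lim (\<Pi>\<^sub>M j\<in>J. borel) (\<lambda>\<omega>. restrict \<omega> J)) A = emeasure (PF J) A"
      using emeasure_lim_emb[OF _ that A]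
      by (simp add: emeasure_distr[OF rest A] prod_emb_def space_PiM Int_commute)
  qed (simp add: PF_def)
  have comp[measurable]: "(\<lambda>\<omega>. \<omega> n) \<in> borel_measurable lim" for n
    by (simp add: measurable_cong_sets[OF sets_lim refl])
  show ?thesis
  proof
    show "prob_space lim" by (rule P.prob_space_axioms)
    show "(\<lambda>\<omega>. \<omega> n) \<in> borel_measurable lim" for n by (rule comp)
    show "distr lim borel (\<lambda>\<omega>. \<omega> n) = (\<Pi>\<^sub>M i\<in>(UNIV::nat set). \<kappa> n)" for n
    proof -
      have "distr lim borel (\<lambda>\<omega>. \<omega> n) = distr (distr lim (\<Pi>\<^sub>M j\<in>{n}. borel) (\<lambda>\<omega>. restrict \<omega> {n})) borel (\<lambda>f. f n)"
        by (subst distr_distr[OF _ rest]) (auto simp: comp_def)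
      also have "\<dots> = distr (P n) borel (\<lambda>x. x)"
        by (subst distr_lim, simp, unfold PF_def, subst distr_distr[OF _ meas']) (auto simp: comp_def b_def)
      finally show ?thesis by (simp only: distr_id2[OF sets_Pn[symmetric]] P_def[symmetric])
    qed
    \<comment> \<open>The event involves only two levels, and under the law \<open>PF\<close> of
      these two it holds by construction.\<close>
    have "AE \<omega> in lim. \<omega> n = coarsen (\<omega> (Suc n))" for n
    proof -
      let ?J = "{n, Suc n}" and ?Q = "\<lambda>f. f n = coarsen (f (Suc n))"
      have b: "b ?J = Suc n" by (simp add: b_def)
      have Q: "{f \<in> space (\<Pi>\<^sub>M j\<in>?J. borel). ?Q f} \<in> sets (\<Pi>\<^sub>M j\<in>?J. (borel :: (nat \<Rightarrow> real^'d) measure))"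
        by (intro measurable_equality_set measurable_compose[OF _ measurable_coarsen] measurable_component_singleton) auto
      have "AE f in PF ?J. ?Q f"
        unfolding PF_def by (subst AE_distr_iff[OF meas' Q]) (simp add: b)
      then show ?thesis
        by (subst (asm) distr_lim[symmetric], simp, subst (asm) AE_distr_iff[OF rest Q]) simp
    qed
    then show "AE \<omega> in lim. \<forall>n. \<omega> n = coarsen (\<omega> (Suc n))" by (simp add: AE_all_countable)
  qed
qed

section \<open>Regularization of paths\<close>

text \<open>A substitute for upcrossing numbers that makes sense for paths in a metric space.
  Successive intervals may share an endpoint.\<close>

definition oscillates :: "real set \<Rightarrow> (real \<Rightarrow> 'a::metric_space) \<Rightarrow> real \<Rightarrow> nat \<Rightarrow> bool" where
  "oscillates D X e p \<longleftrightarrow> (\<exists>a b. (\<forall>i<p. a i \<in> D \<and> b i \<in> D \<and> a i < b i \<and> e \<le> dist (X (a i)) (X (b i))) \<and>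
     (\<forall>i. Suc i < p \<longrightarrow> b i \<le> a (Suc i)))"

lemma ex_limit_if_small_oscillation:
  fixes f :: "'a \<Rightarrow> 'b::complete_space"
  assumes "\<And>e. e > 0 \<Longrightarrow> \<exists>P. eventually P F \<and> (\<forall>x y. P x \<and> P y \<longrightarrow> dist (f x) (f y) < e)"
  shows "\<exists>l. (f \<longlongrightarrow> l) F"
proof (cases "F = bot")
  case False
  have "cauchy_filter (filtermap f F)"
    unfolding cauchy_filter_metric_filtermap using assms by blast
  moreover have "filtermap f F \<noteq> bot" using False by (simp add: filtermap_bot_iff)
  ultimately obtain l where "filtermap f F \<le> nhds l"
    using complete_UNIV[where 'a='b] unfolding complete_uniform by auto
  then show ?thesis unfolding filterlim_def by blast
qed simp

text \<open>If the Cauchy criterion fails at scale \<open>e\<close>, every left neighbourhood of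
  \<open>t\<close> contains a pair of points of \<open>D\<close> with displacement at least
  \<open>e\<close>. Choosing each pair to the right of the previous one yields arbitrarily many
  oscillations.\<close>

lemma left_limit_if_not_oscillates:
  fixes X :: "real \<Rightarrow> 'a::complete_space"
  assumes "\<And>e. e > 0 \<Longrightarrow> \<exists>s p. s < t \<and> \<not> oscillates (D \<inter> {s<..<t}) X e p"
  shows "\<exists>l. (X \<longlongrightarrow> l) (at t within D \<inter> {..<t})"
proof (rule ex_limit_if_small_oscillation, rule ccontr)
  fix e :: real assume "e > 0"
    and no: "\<nexists>P. eventually P (at t within D \<inter> {..<t}) \<and> (\<forall>x y. P x \<and> P y \<longrightarrow> dist (X x) (X y) < e)"
  obtain s p where s: "s < t" and p: "\<not> oscillates (D \<inter> {s<..<t}) X e p"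
    using assms[OF \<open>e > 0\<close>] by auto
  have pair: "\<exists>a b. a \<in> D \<and> b \<in> D \<and> u < a \<and> a < b \<and> b < t \<and> e \<le> dist (X a) (X b)" if "u < t" for u
  proof -
    have "eventually (\<lambda>x. x \<in> D \<and> u < x \<and> x < t) (at t within D \<inter> {..<t})"
      unfolding eventually_at using that by (intro exI[of _ "t - u"]) (auto simp: dist_real_def)
    with no have "\<not> (\<forall>x y. (x \<in> D \<and> u < x \<and> x < t) \<and> (y \<in> D \<and> u < y \<and> y < t) \<longrightarrow> dist (X x) (X y) < e)"
      by blast
    then obtain x y where xy: "x \<in> D" "u < x" "x < t" "y \<in> D" "u < y" "y < t" "e \<le> dist (X x) (X y)"
      by (auto simp: not_less)
    with \<open>e > 0\<close> have "x \<noteq> y" by auto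
    then consider "x < y" | "y < x" by linarith
    then show ?thesis
    proof cases
      case 1
      with xy show ?thesis by blast
    next
      case 2
      moreover have "e \<le> dist (X y) (X x)" using xy by (simp add: dist_commute)
      ultimately show ?thesis using xy by blast
    qed
  qed
  have "\<exists>f. \<forall>n. (fst (f n) \<in> D \<and> snd (f n) \<in> D \<and> s < fst (f n) \<and> fst (f n) < snd (f n) \<and> snd (f n) < t \<and>
            e \<le> dist (X (fst (f n))) (X (snd (f n)))) \<and> snd (f n) < fst (f (Suc n))"
  proof (rule dependent_nat_choice)
    obtain a b where "a \<in> D" "b \<in> D" "s < a" "a < b" "b < t" "e \<le> dist (X a) (X b)" using pair[OF s] by blast
    then show "\<exists>x. fst x \<in> D \<and> snd x \<in> D \<and> s < fst x \<and> fst x < snd x \<and> snd x < t \<and>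
        e \<le> dist (X (fst x)) (X (snd x))"
      by (intro exI[of _ "(a, b)"]) simp
  next
    fix x :: "real \<times> real" and n :: nat
    assume x: "fst x \<in> D \<and> snd x \<in> D \<and> s < fst x \<and> fst x < snd x \<and> snd x < t \<and>
        e \<le> dist (X (fst x)) (X (snd x))"
    then have "snd x < t" by simp
    then obtain a b where "a \<in> D" "b \<in> D" "snd x < a" "a < b" "b < t" "e \<le> dist (X a) (X b)" using pair by blast
    then show "\<exists>y. (fst y \<in> D \<and> snd y \<in> D \<and> s < fst y \<and> fst y < snd y \<and> snd y < t \<and>
        e \<le> dist (X (fst y)) (X (snd y))) \<and> snd x < fst y"
      using x by (intro exI[of _ "(a, b)"]) auto
  qed
  then obtain f where f: "\<And>n. fst (f n) \<in> D" "\<And>n. snd (f n) \<in> D" "\<And>n. s < fst (f n)" "\<And>n. fst (f n) < snd (f n)"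
    "\<And>n. snd (f n) < t" "\<And>n. e \<le> dist (X (fst (f n))) (X (snd (f n)))" "\<And>n. snd (f n) < fst (f (Suc n))" by blast
  have "fst (f n) < t" "s < snd (f n)" for n using f(3-5)[of n] by linarith+
  then have "oscillates (D \<inter> {s<..<t}) X e p"
    unfolding oscillates_def using f
    by (intro exI[of _ "\<lambda>n. fst (f n)"] exI[of _ "\<lambda>n. snd (f n)"])
       (auto intro: less_imp_le)
  with p show False ..
qed

lemma right_limit_if_not_oscillates:
  fixes X :: "real \<Rightarrow> 'a::complete_space"
  assumes "\<And>e. e > 0 \<Longrightarrow> \<exists>s p. t < s \<and> \<not> oscillates (D \<inter> {t<..<s}) X e p"
  shows "\<exists>l. (X \<longlongrightarrow> l) (at t within D \<inter> {t<..})"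
proof (rule ex_limit_if_small_oscillation, rule ccontr)
  fix e :: real assume "e > 0"
    and no: "\<nexists>P. eventually P (at t within D \<inter> {t<..}) \<and> (\<forall>x y. P x \<and> P y \<longrightarrow> dist (X x) (X y) < e)"
  obtain s p where s: "t < s" and p: "\<not> oscillates (D \<inter> {t<..<s}) X e p"
    using assms[OF \<open>e > 0\<close>] by auto
  have pair: "\<exists>a b. a \<in> D \<and> b \<in> D \<and> t < a \<and> a < b \<and> b < u \<and> e \<le> dist (X a) (X b)" if "t < u" for u
  proof -
    have "eventually (\<lambda>x. x \<in> D \<and> t < x \<and> x < u) (at t within D \<inter> {t<..})"
      unfolding eventually_at using that by (intro exI[of _ "u - t"]) (auto simp: dist_real_def)
    with no have "\<not> (\<forall>x y. (x \<in> D \<and> t < x \<and> x < u) \<and> (y \<in> D \<and> t < y \<and> y < u) \<longrightarrow> dist (X x) (X y) < e)"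
      by blast
    then obtain x y where xy: "x \<in> D" "t < x" "x < u" "y \<in> D" "t < y" "y < u" "e \<le> dist (X x) (X y)"
      by (auto simp: not_less)
    with \<open>e > 0\<close> have "x \<noteq> y" by auto
    then consider "x < y" | "y < x" by linarith
    then show ?thesis
    proof cases
      case 1
      with xy show ?thesis by blast
    next
      case 2
      moreover have "e \<le> dist (X y) (X x)" using xy by (simp add: dist_commute)
      ultimately show ?thesis using xy by blast
    qed
  qed
  have "\<exists>f. \<forall>n. (fst (f n) \<in> D \<and> snd (f n) \<in> D \<and> t < fst (f n) \<and> fst (f n) < snd (f n) \<and> snd (f n) < s \<and>
            e \<le> dist (X (fst (f n))) (X (snd (f n)))) \<and> snd (f (Suc n)) < fst (f n)"
  proof (rule dependent_nat_choice)
    obtain a b where "a \<in> D" "b \<in> D" "t < a" "a < b" "b < s" "e \<le> dist (X a) (X b)" using pair[OF s] by blast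
    then show "\<exists>x. fst x \<in> D \<and> snd x \<in> D \<and> t < fst x \<and> fst x < snd x \<and> snd x < s \<and>
        e \<le> dist (X (fst x)) (X (snd x))"
      by (intro exI[of _ "(a, b)"]) simp
  next
    fix x :: "real \<times> real" and n :: nat
    assume x: "fst x \<in> D \<and> snd x \<in> D \<and> t < fst x \<and> fst x < snd x \<and> snd x < s \<and>
        e \<le> dist (X (fst x)) (X (snd x))"
    then have "t < fst x" by simp
    then obtain a b where "a \<in> D" "b \<in> D" "t < a" "a < b" "b < fst x" "e \<le> dist (X a) (X b)" using pair by blast
    then show "\<exists>y. (fst y \<in> D \<and> snd y \<in> D \<and> t < fst y \<and> fst y < snd y \<and> snd y < s \<and>
        e \<le> dist (X (fst y)) (X (snd y))) \<and> snd y < fst x"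
      using x by (intro exI[of _ "(a, b)"]) auto
  qed
  then obtain f where f: "\<And>n. fst (f n) \<in> D" "\<And>n. snd (f n) \<in> D" "\<And>n. t < fst (f n)" "\<And>n. fst (f n) < snd (f n)"
    "\<And>n. snd (f n) < s" "\<And>n. e \<le> dist (X (fst (f n))) (X (snd (f n)))" "\<And>n. snd (f (Suc n)) < fst (f n)" by blast
  \<comment> \<open>Pairs approaching \<open>t\<close> from the right are found in decreasing order;
    the first \<open>p\<close> of them are listed backwards to make the intervals increase.\<close>
  have "snd (f (p - Suc i)) \<le> fst (f (p - Suc (Suc i)))" if "Suc i < p" for i
  proof -
    have "p - Suc i = Suc (p - Suc (Suc i))" using that by simp
    then show ?thesis using f(7)[of "p - Suc (Suc i)"] by simp
  qed
  moreover have "fst (f n) < s" "t < snd (f n)" for n using f(3-5)[of n] by linarith+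
  ultimately have "oscillates (D \<inter> {t<..<s}) X e p"
    unfolding oscillates_def using f
    by (intro exI[of _ "\<lambda>n. fst (f (p - Suc n))"] exI[of _ "\<lambda>n. snd (f (p - Suc n))"])
       (auto intro: less_imp_le)
  with p show False ..
qed

text \<open>The value \<open>Y u\<close> is a limit of values of \<open>X\<close> at points of
  \<open>D\<close> just after \<open>u\<close>. A strict bound for \<open>X\<close> on the points of
  \<open>D\<close> in an interval thus passes to \<open>Y\<close> there as a weak one, which
  explains the margins \<open>e / 2\<close>.\<close>

lemma right_limit_regular:
  fixes X Y :: "real \<Rightarrow> 'a::metric_space"
  assumes D: "\<And>t. t \<ge> 0 \<Longrightarrow> at t within D \<inter> {t<..} \<noteq> bot"
    and Y: "\<And>t. t \<ge> 0 \<Longrightarrow> (X \<longlongrightarrow> Y t) (at t within D \<inter> {t<..})"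
    and left: "\<And>t. t > 0 \<Longrightarrow> \<exists>l. (X \<longlongrightarrow> l) (at t within D \<inter> {..<t})"
  shows "t \<ge> 0 \<Longrightarrow> continuous (at_right t) Y" "t > 0 \<Longrightarrow> \<exists>l. (Y \<longlongrightarrow> l) (at_left t)"
proof -
  have close: "dist (Y u) l \<le> e" if "0 \<le> u" "u < v" "\<And>a. a \<in> D \<Longrightarrow> u < a \<Longrightarrow> a < v \<Longrightarrow> dist (X a) l < e" for u v l e
  proof (rule tendsto_upperbound[OF tendsto_dist[OF Y[OF that(1)] tendsto_const] _ D[OF that(1)]])
    show "\<forall>\<^sub>F x in at u within D \<inter> {u<..}. dist (X x) l \<le> e"
      unfolding eventually_at using that(2)
      by (intro exI[of _ "v - u"]) (auto simp: dist_real_def intro!: less_imp_le[OF that(3)])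
  qed
  show "continuous (at_right t) Y" if "t \<ge> 0"
    unfolding continuous_within
  proof (rule tendstoI)
    fix e :: real assume "e > 0"
    then have "\<forall>\<^sub>F x in at t within D \<inter> {t<..}. dist (X x) (Y t) < e / 2"
      using Y[OF that] by (intro tendstoD) auto
    then obtain d where d: "d > 0" "\<And>a. a \<in> D \<Longrightarrow> t < a \<Longrightarrow> dist a t < d \<Longrightarrow> dist (X a) (Y t) < e / 2"
      unfolding eventually_at by auto
    have "dist (Y u) (Y t) < e" if "t < u" "u < t + d" for u
    proof -
      have "dist (Y u) (Y t) \<le> e / 2"
      proof (rule close[of u "t + d"])
        fix a assume "a \<in> D" "u < a" "a < t + d"
        then show "dist (X a) (Y t) < e / 2" using that by (intro d(2)) (auto simp: dist_real_def)
      qed (use that \<open>t \<ge> 0\<close> in auto)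
      then show ?thesis using \<open>e > 0\<close> by simp
    qed
    then show "\<forall>\<^sub>F x in at_right t. dist (Y x) (Y t) < e"
      unfolding eventually_at using d(1) by (intro exI[of _ d]) (auto simp: dist_real_def)
  qed
  show "\<exists>l. (Y \<longlongrightarrow> l) (at_left t)" if "t > 0"
  proof -
    obtain l where l: "(X \<longlongrightarrow> l) (at t within D \<inter> {..<t})" using left[of t] \<open>t > 0\<close> by auto
    have "(Y \<longlongrightarrow> l) (at_left t)"
    proof (rule tendstoI)
      fix e :: real assume "e > 0"
      then have "\<forall>\<^sub>F x in at t within D \<inter> {..<t}. dist (X x) l < e / 2"
        using l by (intro tendstoD) auto
      then obtain d where d: "d > 0" "\<And>a. a \<in> D \<Longrightarrow> a < t \<Longrightarrow> dist a t < d \<Longrightarrow> dist (X a) l < e / 2"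
        unfolding eventually_at by auto
      have "dist (Y u) l < e" if "u < t" "t - d < u" "0 \<le> u" for u
      proof -
        have "dist (Y u) l \<le> e / 2"
        proof (rule close[of u t])
          fix a assume "a \<in> D" "u < a" "a < t"
          then show "dist (X a) l < e / 2" using that by (intro d(2)) (auto simp: dist_real_def)
        qed (use that in auto)
        then show ?thesis using \<open>e > 0\<close> by simp
      qed
      \<comment> \<open>The radius \<open>min d t\<close> keeps the arguments nonnegative, where
        \<open>Y\<close> is controlled by \<open>X\<close>.\<close>
      then show "\<forall>\<^sub>F x in at_left t. dist (Y x) l < e"
        unfolding eventually_at using d(1) \<open>t > 0\<close> by (intro exI[of _ "min d t"]) (auto simp: dist_real_def)
    qed
    then show ?thesis by blast
  qed
qed


section \<open>Almost sure limits, small tails and transfer of processes\<close>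

text \<open>Continuous approximations from above to the indicator of a closed set. The empty set is
  separated because \<open>infdist\<close> to it is 0 by convention, which would give the constant
  1.\<close>

definition bump :: "'a::metric_space set \<Rightarrow> nat \<Rightarrow> 'a \<Rightarrow> real" where
  "bump C k x = (if C = {} then 0 else max 0 (1 - real k * infdist x C))"

lemma bump_bounds: "0 \<le> bump C k x" "bump C k x \<le> 1" "\<bar>bump C k x\<bar> \<le> 1"
  by (auto simp: bump_def infdist_nonneg)

lemma isCont_bump: "isCont (bump C k) x"
  unfolding bump_def[abs_def] by (cases "C = {}") (auto intro!: continuous_intros continuous_infdist)

lemma bump_tendsto_indicator:
  assumes "closed C" shows "(\<lambda>k. bump C k x) \<longlonglongrightarrow> indicator C x"
proof (cases "x \<in> C")
  case True
  then have "C \<noteq> {}" by auto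
  with True show ?thesis by (simp add: bump_def infdist_zero)
next
  case False
  show ?thesis
  proof (cases "C = {}")
    case ne: False
    have d: "infdist x C > 0"
      using assms False ne in_closed_iff_infdist_zero[of C x] infdist_nonneg[of x C] by force
    obtain K :: nat where K: "1 / infdist x C < K" using reals_Archimedean2 by blast
    have "bump C k x = 0" if "k \<ge> K" for k
    proof -
      have "1 < real K * infdist x C" using K d by (simp add: field_simps)
      also have "\<dots> \<le> real k * infdist x C" using that d by (intro mult_right_mono) auto
      finally show ?thesis by (simp add: bump_def)
    qed
    then show ?thesis using False by (intro tendsto_eventually) (auto simp: eventually_sequentially)
  qed (simp add: bump_def)
qed

text \<open>Applied twice in the next proof: from approximating variables to their limits, then from
  bumps to indicators.\<close>

lemma (in prob_space) expectation_prod_LIMSEQ: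
  fixes f g :: "nat \<Rightarrow> 'i \<Rightarrow> 'a \<Rightarrow> real"
  assumes "finite I"
    and meas: "\<And>m j. j \<in> I \<Longrightarrow> f m j \<in> borel_measurable M" "\<And>j. j \<in> I \<Longrightarrow> F j \<in> borel_measurable M"
    and bound: "\<And>m j \<omega>. j \<in> I \<Longrightarrow> \<bar>f m j \<omega>\<bar> \<le> 1"
    and lim: "\<And>j. j \<in> I \<Longrightarrow> AE \<omega> in M. (\<lambda>m. f m j \<omega>) \<longlonglongrightarrow> F j \<omega>"
    and prod: "\<And>m. expectation (\<lambda>\<omega>. \<Prod>j\<in>I. f m j \<omega>) = (\<Prod>j\<in>I. expectation (f m j))"
  shows "expectation (\<lambda>\<omega>. \<Prod>j\<in>I. F j \<omega>) = (\<Prod>j\<in>I. expectation (F j))"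
proof (rule LIMSEQ_unique)
  have ae: "AE \<omega> in M. \<forall>j\<in>I. (\<lambda>m. f m j \<omega>) \<longlonglongrightarrow> F j \<omega>"
    using lim assms(1) by (simp add: AE_finite_all)
  show "(\<lambda>m. expectation (\<lambda>\<omega>. \<Prod>j\<in>I. f m j \<omega>)) \<longlonglongrightarrow> expectation (\<lambda>\<omega>. \<Prod>j\<in>I. F j \<omega>)"
  proof (rule integral_dominated_convergence[where w="\<lambda>_. 1"])
    show "AE \<omega> in M. (\<lambda>m. \<Prod>j\<in>I. f m j \<omega>) \<longlonglongrightarrow> (\<Prod>j\<in>I. F j \<omega>)"
      using ae by eventually_elim (auto intro!: tendsto_prod)
    show "AE \<omega> in M. norm (\<Prod>j\<in>I. f m j \<omega>) \<le> 1" for m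
      using bound by (auto simp: abs_prod intro!: prod_le_1)
  qed (use meas in \<open>auto intro!: borel_measurable_prod\<close>)
  have "(\<lambda>m. expectation (f m j)) \<longlonglongrightarrow> expectation (F j)" if "j \<in> I" for j
    by (rule integral_dominated_convergence[where w="\<lambda>_. 1"]) (use that meas lim bound in auto)
  then show "(\<lambda>m. expectation (\<lambda>\<omega>. \<Prod>j\<in>I. f m j \<omega>)) \<longlonglongrightarrow> (\<Prod>j\<in>I. expectation (F j))"
    unfolding prod by (intro tendsto_prod) auto
qed

text \<open>Indicators do not pass to the limit of the variables, but continuous bumps do. Letting
  the bumps shrink afterwards gives the product rule for preimages of closed sets, an
  intersection-stable generator of the preimages of Borel sets.\<close>

lemma (in prob_space) indep_vars_AE_limit:
  fixes W :: "nat \<Rightarrow> 'i \<Rightarrow> 'a \<Rightarrow> 'b::metric_space"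
  assumes indep: "\<And>m. indep_vars (\<lambda>_. borel) (W m) I"
    and V: "\<And>i. i \<in> I \<Longrightarrow> V i \<in> borel_measurable M"
    and lim: "\<And>i. i \<in> I \<Longrightarrow> AE \<omega> in M. (\<lambda>m. W m i \<omega>) \<longlonglongrightarrow> V i \<omega>"
  shows "indep_vars (\<lambda>_. borel) V I"
proof -
  have W: "W m i \<in> borel_measurable M" if "i \<in> I" for m i
    using indep that by (auto simp: indep_vars_def)
  have bump_meas: "bump C k \<in> borel_measurable borel" for C :: "'b set" and k
    by (intro borel_measurable_continuous_onI continuous_at_imp_continuous_on ballI isCont_bump)
  define E where "E i = {V i -` C \<inter> space M | C. C \<in> Collect closed}" for i
  have "indep_sets E I"
  proof (rule indep_setsI)
    show "E i \<subseteq> events" if "i \<in> I" for i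
      using V[OF that] by (auto simp: E_def)
    fix A J assume J: "J \<noteq> {}" "J \<subseteq> I" "finite J" and "\<forall>j\<in>J. A j \<in> E j"
    then have "\<forall>j\<in>J. \<exists>C. closed C \<and> A j = V j -` C \<inter> space M" by (auto simp: E_def)
    then obtain C where C: "\<And>j. j \<in> J \<Longrightarrow> closed (C j)" "\<And>j. j \<in> J \<Longrightarrow> A j = V j -` C j \<inter> space M"
      by metis
    have 1: "expectation (\<lambda>\<omega>. \<Prod>j\<in>J. bump (C j) k (V j \<omega>)) = (\<Prod>j\<in>J. expectation (\<lambda>\<omega>. bump (C j) k (V j \<omega>)))" for k
    proof (rule expectation_prod_LIMSEQ[where f="\<lambda>m j \<omega>. bump (C j) k (W m j \<omega>)"])
      show "expectation (\<lambda>\<omega>. \<Prod>j\<in>J. bump (C j) k (W m j \<omega>)) = (\<Prod>j\<in>J. expectation (\<lambda>\<omega>. bump (C j) k (W m j \<omega>)))" for m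
      proof (rule indep_vars_lebesgue_integral[OF J(3)])
        show "indep_vars (\<lambda>_. borel) (\<lambda>j \<omega>. bump (C j) k (W m j \<omega>)) J"
          by (rule indep_vars_compose2[OF indep_vars_subset[OF indep J(2)] bump_meas])
        show "integrable M (\<lambda>\<omega>. bump (C j) k (W m j \<omega>))" if "j \<in> J" for j
          using that J
          by (intro integrable_bounded_prob[OF prob_space_axioms, where B=1] measurable_compose[OF W bump_meas]) (auto simp: bump_bounds)
      qed
      show "AE \<omega> in M. (\<lambda>m. bump (C j) k (W m j \<omega>)) \<longlonglongrightarrow> bump (C j) k (V j \<omega>)" if "j \<in> J" for j
        using lim[OF subsetD[OF J(2) that]] by eventually_elim (rule isCont_tendsto_compose[OF isCont_bump])
    qed (use J in \<open>auto simp: bump_bounds intro: measurable_compose[OF W bump_meas] measurable_compose[OF V bump_meas]\<close>)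
    have 2: "expectation (\<lambda>\<omega>. \<Prod>j\<in>J. indicator (C j) (V j \<omega>) :: real) = (\<Prod>j\<in>J. expectation (\<lambda>\<omega>. indicator (C j) (V j \<omega>)))"
    proof (rule expectation_prod_LIMSEQ[where f="\<lambda>k j \<omega>. bump (C j) k (V j \<omega>)" and F="\<lambda>j \<omega>. indicator (C j) (V j \<omega>)"])
      show "AE \<omega> in M. (\<lambda>k. bump (C j) k (V j \<omega>)) \<longlonglongrightarrow> indicator (C j) (V j \<omega>)" if "j \<in> J" for j
        using bump_tendsto_indicator[OF C(1)[OF that]] by auto
      show "(\<lambda>\<omega>. indicator (C j) (V j \<omega>) :: real) \<in> borel_measurable M" if "j \<in> J" for j
        using V J C(1)[OF that] that by (intro measurable_compose[OF V borel_measurable_indicator]) auto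
    qed (use 1 J in \<open>auto simp: bump_bounds intro: measurable_compose[OF V bump_meas]\<close>)
    have ev: "A j \<in> events" if "j \<in> J" for j
      using V[of j] C that J by (auto intro!: measurable_sets_borel)
    have "prob (\<Inter>j\<in>J. A j) = expectation (indicator (\<Inter>j\<in>J. A j))"
      using ev J by (subst Bochner_Integration.integral_indicator) (auto simp: sets.finite_INT intro!: arg_cong[where f=prob] dest: sets.sets_into_space)
    also have "\<dots> = expectation (\<lambda>\<omega>. \<Prod>j\<in>J. indicator (C j) (V j \<omega>))"
      using C(2) J(1,3) by (intro Bochner_Integration.integral_cong refl)
         (auto simp: indicator_def prod_zero_iff intro!: prod.neutral[symmetric])
    also have "\<dots> = (\<Prod>j\<in>J. prob (A j))"
      unfolding 2
    proof (rule prod.cong[OF refl])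
      fix j assume j: "j \<in> J"
      have "expectation (\<lambda>\<omega>. indicator (C j) (V j \<omega>) :: real) = expectation (indicator (A j))"
        using C(2)[OF j] by (intro Bochner_Integration.integral_cong) (auto simp: indicator_def)
      then show "expectation (\<lambda>\<omega>. indicator (C j) (V j \<omega>)) = prob (A j)"
        using ev[OF j] sets.sets_into_space[OF ev[OF j]] by (simp add: Int_absorb2)
    qed
    finally show "prob (\<Inter>j\<in>J. A j) = (\<Prod>j\<in>J. prob (A j))" .
  qed
  then have "indep_sets (\<lambda>i. sigma_sets (space M) (E i)) I"
  proof (rule indep_sets_sigma)
    show "Int_stable (E i)" for i
      unfolding Int_stable_def E_def by clarsimp (rule_tac x="C \<inter> Ca" in exI, auto)
  qed
  then have "indep_sets (\<lambda>i. {V i -` A \<inter> space M | A. A \<in> sets borel}) I"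
  proof (rule indep_sets_mono_sets)
    fix i
    have "sets (borel :: 'b measure) = sigma_sets UNIV (Collect closed)"
      unfolding borel_eq_closed by simp
    then show "{V i -` A \<inter> space M | A. A \<in> sets borel} \<subseteq> sigma_sets (space M) (E i)"
      unfolding E_def by (simp add: sigma_sets_vimage_commute)
  qed
  then show ?thesis using V by (simp add: indep_vars_def2)
qed

text \<open>One \<delta> has to serve all measures. If none did, laws with \<open>t\<close> tending
  to 0 would keep a large tail, although their characteristic functions tend to 1 and so every
  coordinate converges weakly to 0. The threshold 1/3 is the one required by
  \<open>exceed_some_le\<close>.\<close>

lemma small_tail_of_charfun:
  fixes \<psi> :: "real ^ 'd \<Rightarrow> complex"
  assumes "e > 0"
  shows "\<exists>\<delta>>0. \<forall>\<mu>\<in>borel_probs. \<forall>t. 0 \<le> t \<and> t \<le> \<delta> \<and> (\<forall>y. charfun \<mu> y = exp (of_real t * \<psi> y)) \<longrightarrow>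
           3 * emeasure \<mu> {x. norm x > e} \<le> 1"
proof (rule ccontr)
  assume no: "\<not> ?thesis"
  have "\<exists>\<mu> t. \<mu> \<in> borel_probs \<and> 0 \<le> t \<and> t \<le> 1 / real (Suc m) \<and> (\<forall>y. charfun \<mu> y = exp (of_real t * \<psi> y)) \<and>
      \<not> 3 * emeasure \<mu> {x. norm x > e} \<le> 1" for m
    using no by (metis divide_pos_pos of_nat_0_less_iff zero_less_Suc zero_less_one)
  then obtain \<mu> t where \<mu>: "\<And>m. \<mu> m \<in> borel_probs" and t: "\<And>m. 0 \<le> t m" "\<And>m. t m \<le> 1 / real (Suc m)"
    and cf: "\<And>m y. charfun (\<mu> m) y = exp (of_real (t m) * \<psi> y)" and large: "\<And>m. \<not> 3 * emeasure (\<mu> m) {x. norm x > e} \<le> 1"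
    by metis
  note \<mu>' = borel_probsD[OF \<mu>] and [measurable_cong] = borel_probsD(2)[OF \<mu>]
  have t0: "t \<longlonglongrightarrow> 0"
    by (rule tendsto_sandwich[OF _ _ tendsto_const LIMSEQ_Suc[OF lim_1_over_n]]) (use t in auto)
  \<comment> \<open>If the norm exceeds \<open>e\<close>, some coordinate exceeds \<open>c\<close>,
    since the norm is at most the sum of the absolute coordinates. The bounded continuous function
    \<open>f\<close> below is 1 from \<open>c\<close> on, so the sum of its coordinate values
    dominates the tail indicator.\<close>
  define c where "c = e / real CARD('d)"
  have c: "c > 0" unfolding c_def using assms by simp
  define f where "f x = min 1 (\<bar>x\<bar> / c)" for x :: real
  have f_cont: "isCont f x" for x unfolding f_def using c by (auto intro!: continuous_intros)
  have f_bound: "norm (f x) \<le> 1" for x unfolding f_def using c by auto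
  have [measurable]: "f \<in> borel_measurable borel"
    by (intro borel_measurable_continuous_onI continuous_at_imp_continuous_on ballI f_cont)
  have lim: "(\<lambda>m. \<integral>x. f (x $ i) \<partial>\<mu> m) \<longlonglongrightarrow> 0" for i
  proof -
    define M where "M m = distr (\<mu> m) borel (\<lambda>x. x $ i)" for m
    have M: "real_distribution (M m)" for m
      unfolding M_def real_distribution_def real_distribution_axioms_def
      by (auto intro!: prob_space.prob_space_distr \<mu>')
    have R: "real_distribution (return borel 0)"
      unfolding real_distribution_def real_distribution_axioms_def by (auto intro!: prob_space_return)
    have "char (M m) s = exp (of_real (t m) * \<psi> (axis i s))" for m s
      unfolding cf[symmetric] char_def charfun_def M_def
      by (subst integral_distr) (auto simp: inner_axis')
    moreover have "(\<lambda>m. exp (of_real (t m) * \<psi> y)) \<longlonglongrightarrow> exp (of_real 0 * \<psi> y)" for y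
      by (intro tendsto_intros t0)
    ultimately have "weak_conv_m M (return borel 0)"
      by (intro levy_continuity M R) (simp add: char_def integral_return)
    then have "(\<lambda>m. \<integral>x. f x \<partial>M m) \<longlonglongrightarrow> (\<integral>x. f x \<partial>return borel 0)"
      by (intro weak_conv_imp_integral_bdd_continuous_conv[OF M R, where B=1] f_cont f_bound)
    then show ?thesis
      unfolding M_def by (simp add: integral_distr integral_return f_def[of 0])
  qed
  have "(\<lambda>m. \<Sum>i\<in>UNIV. \<integral>x. f (x $ i) \<partial>\<mu> m) \<longlonglongrightarrow> (\<Sum>i\<in>(UNIV :: 'd set). 0)"
    by (intro tendsto_sum lim)
  then have "\<forall>\<^sub>F m in sequentially. (\<Sum>i\<in>UNIV. \<integral>x. f (x $ i) \<partial>\<mu> m) < 1/3"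
    by (rule order_tendstoD) simp
  then obtain m where m: "(\<Sum>i\<in>UNIV. \<integral>x. f (x $ i) \<partial>\<mu> m) < 1/3" by (auto simp: eventually_sequentially)
  interpret prob_space "\<mu> m" by (rule \<mu>')
  have int: "integrable (\<mu> m) (\<lambda>x. f (x $ i))" for i
    by (rule integrable_const_bound[where B=1]) (use f_bound in auto)
  have "prob {x. norm x > e} = (\<integral>x. indicator {x. norm x > e} x \<partial>\<mu> m)"
    by (simp add: \<mu>')
  also have "\<dots> \<le> (\<integral>x. (\<Sum>i\<in>UNIV. f (x $ i)) \<partial>\<mu> m)"
  proof (rule integral_mono)
    have "{x :: real^'d. norm x > e} \<in> sets borel" by measurable
    then show "integrable (\<mu> m) (indicator {x. norm x > e} :: _ \<Rightarrow> real)"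
      by (simp add: \<mu>' integrable_real_indicator less_top[symmetric])
    show "integrable (\<mu> m) (\<lambda>x. \<Sum>i\<in>UNIV. f (x $ i))" by (intro Bochner_Integration.integrable_sum int)
    fix x :: "real^'d"
    have f0: "0 \<le> f z" for z unfolding f_def using c by auto
    have "\<exists>i. \<bar>x $ i\<bar> > c" if "norm x > e"
    proof (rule ccontr)
      assume "\<nexists>i. \<bar>x $ i\<bar> > c"
      then have "(\<Sum>i\<in>UNIV. \<bar>x $ i\<bar>) \<le> (\<Sum>i\<in>(UNIV :: 'd set). c)" by (intro sum_mono) (auto simp: not_less)
      with norm_le_l1_cart[of x] that show False by (simp add: c_def)
    qed
    moreover have "1 \<le> (\<Sum>i\<in>UNIV. f (x $ i))" if "\<bar>x $ i\<bar> > c" for i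
    proof -
      have "1 = f (x $ i)" using that c by (simp add: f_def min_def field_simps)
      also have "\<dots> \<le> (\<Sum>i\<in>UNIV. f (x $ i))" by (intro member_le_sum) (auto simp: f0)
      finally show ?thesis .
    qed
    ultimately show "indicator {x. norm x > e} x \<le> (\<Sum>i\<in>UNIV. f (x $ i))"
      by (auto simp: indicator_def intro!: sum_nonneg f0)
  qed
  also have "\<dots> < 1/3" using m int by simp
  finally have "ennreal (3 * prob {x. norm x > e}) \<le> ennreal 1" by (intro ennreal_leI) simp
  then have "3 * emeasure (\<mu> m) {x. norm x > e} \<le> 1"
    by (simp add: emeasure_eq_measure ennreal_mult')
  with large show False by blast
qed

text \<open>Independence is a statement about the joint law, which is the same on both sides; the
  product criterion requires a nonempty index set, hence the case distinction.\<close>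

lemma indep_vars_distr:
  assumes M: "prob_space M" and T: "T \<in> M \<rightarrow>\<^sub>M N"
    and indep: "prob_space.indep_vars (distr M N T) (\<lambda>_. borel) V I"
  shows "prob_space.indep_vars M (\<lambda>_. borel) (\<lambda>i \<omega>. V i (T \<omega>)) I"
proof -
  interpret M: prob_space M by fact
  interpret N: prob_space "distr M N T" by (rule M.prob_space_distr[OF T])
  show ?thesis
  proof (cases "I = {}")
    case True
    then show ?thesis by (simp add: M.indep_vars_def M.indep_sets_def)
  next
    case False
    have V: "V i \<in> borel_measurable N" if "i \<in> I" for i
      using indep that by (auto simp: N.indep_vars_def)
    have V': "V i \<in> borel_measurable (distr M N T)" if "i \<in> I" for i
      using V[OF that] by simp
    have "distr M (\<Pi>\<^sub>M i\<in>I. borel) (\<lambda>\<omega>. \<lambda>i\<in>I. V i (T \<omega>)) = distr (distr M N T) (\<Pi>\<^sub>M i\<in>I. borel) (\<lambda>\<omega>. \<lambda>i\<in>I. V i \<omega>)"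
      by (subst distr_distr[OF _ T]) (auto simp: comp_def intro!: measurable_restrict V)
    also have "\<dots> = (\<Pi>\<^sub>M i\<in>I. distr (distr M N T) borel (V i))"
      using indep N.indep_vars_iff_distr_eq_PiM'[OF False V'] by simp
    also have "\<dots> = (\<Pi>\<^sub>M i\<in>I. distr M borel (\<lambda>\<omega>. V i (T \<omega>)))"
      using distr_distr[OF V T] by (intro PiM_cong refl) (simp add: comp_def)
    finally show ?thesis
      by (subst M.indep_vars_iff_distr_eq_PiM'[OF False]) (auto intro: measurable_compose[OF T V])
  qed
qed

lemma charfun_AE_limit:
  fixes W :: "nat \<Rightarrow> 'a \<Rightarrow> real ^ 'd"
  assumes M: "prob_space M" and W: "\<And>m. W m \<in> borel_measurable M" and V: "V \<in> borel_measurable M"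
    and lim: "AE \<omega> in M. (\<lambda>m. W m \<omega>) \<longlonglongrightarrow> V \<omega>"
  shows "(\<lambda>m. charfun (distr M borel (W m)) y) \<longlonglongrightarrow> charfun (distr M borel V) y"
proof -
  interpret prob_space M by fact
  note [measurable] = W V
  show ?thesis
    unfolding charfun_distr[OF W] charfun_distr[OF V]
  proof (rule integral_dominated_convergence[where w="\<lambda>_. 1"])
    show "AE \<omega> in M. (\<lambda>m. iexp (y \<bullet> W m \<omega>)) \<longlonglongrightarrow> iexp (y \<bullet> V \<omega>)"
      using lim by eventually_elim (auto intro!: tendsto_intros)
  qed auto
qed

text \<open>The defining properties concern either joint laws or single paths; a measure-preserving
  map respects both. It moves the constructed process to the sample space demanded by
  \<open>J\<close>.\<close>

lemma levy_process_transfer: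
  assumes L: "levy_process Q Y" and T: "T \<in> M \<rightarrow>\<^sub>M Q" "distr M Q T = Q" and M: "prob_space M"
  shows "levy_process M (\<lambda>t \<omega>. Y t (T \<omega>))"
proof -
  note L' = L[unfolded levy_process_def]
  interpret Q: prob_space Q using L' by blast
  interpret M: prob_space M by fact
  have Y[measurable]: "t \<ge> 0 \<Longrightarrow> Y t \<in> borel_measurable Q" for t using L' by blast
  note [measurable] = T(1)
  have TQ: "T \<omega> \<in> space Q" if "\<omega> \<in> space M" for \<omega> using measurable_space[OF T(1) that] .
  have law: "distr M borel (\<lambda>\<omega>. f (T \<omega>)) = distr Q borel f" if "f \<in> borel_measurable Q" for f
    using distr_distr[OF that T(1)] by (simp add: T(2) comp_def)
  have indep: "M.indep_vars (\<lambda>_. borel) (\<lambda>i \<omega>. V i (T \<omega>)) I"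
    if "Q.indep_vars (\<lambda>_. borel) V I" for V :: "nat \<Rightarrow> _ \<Rightarrow> real^'b" and I
    using indep_vars_distr[OF M T(1)] that by (simp add: T(2))
  show ?thesis
    unfolding levy_process_def
  proof (intro conjI allI impI ballI)
    fix n and t :: "nat \<Rightarrow> real" assume "0 \<le> t 0 \<and> (\<forall>i<n. t i \<le> t (Suc i))"
    then show "M.indep_vars (\<lambda>_. borel) (\<lambda>i \<omega>. Y (t (Suc i)) (T \<omega>) - Y (t i) (T \<omega>)) {..<n}"
      using indep[of "\<lambda>i \<omega>. Y (t (Suc i)) \<omega> - Y (t i) \<omega>" "{..<n}"] L' by blast
  next
    fix s t :: real assume st: "0 \<le> s" "0 \<le> t"
    then have "distr M borel (\<lambda>\<omega>. Y (s + t) (T \<omega>) - Y s (T \<omega>)) = distr Q borel (\<lambda>\<omega>. Y (s + t) \<omega> - Y s \<omega>)"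
      using law[of "\<lambda>\<omega>. Y (s + t) \<omega> - Y s \<omega>"] by simp
    also have "\<dots> = distr M borel (\<lambda>\<omega>. Y t (T \<omega>))"
      using L' st law[OF Y, of t] by simp
    finally show "distr M borel (\<lambda>\<omega>. Y (s + t) (T \<omega>) - Y s (T \<omega>)) = distr M borel (\<lambda>\<omega>. Y t (T \<omega>))" .
  qed (use L' TQ M in \<open>auto intro: measurable_compose[OF T(1) Y]\<close>)
qed


section \<open>Paths along the dyadic numbers and their one-sided limits\<close>

definition dyadic :: "real set" where
  "dyadic = {r. \<exists>n k::nat. r * 2 ^ n = real k}"

text \<open>Taking the least level makes \<open>dyadic_path\<close> a definite function of any array
  \<omega>; for consistent levels every admissible level gives the same value, by
  \<open>dyadic_path_eq\<close>.\<close>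

definition dyadic_level :: "real \<Rightarrow> nat" where
  "dyadic_level r = (LEAST n. \<exists>k::nat. r * 2 ^ n = real k)"

definition dyadic_path :: "(nat \<Rightarrow> nat \<Rightarrow> 'a::comm_monoid_add) \<Rightarrow> real \<Rightarrow> 'a" where
  "dyadic_path \<omega> r = (\<Sum>i<nat \<lfloor>r * 2 ^ dyadic_level r\<rfloor>. \<omega> (dyadic_level r) i)"

lemma sum_coarsen: "(\<Sum>i<k. coarsen x i) = (\<Sum>i<2 * k. x i :: 'a::comm_monoid_add)"
  by (induction k) (auto simp: coarsen_def add.assoc)

lemma sum_refine:
  fixes \<omega> :: "nat \<Rightarrow> nat \<Rightarrow> 'a::comm_monoid_add"
  assumes "\<And>n. \<omega> n = coarsen (\<omega> (Suc n))"
  shows "(\<Sum>i<k. \<omega> n i) = (\<Sum>i<2 ^ d * k. \<omega> (n + d) i)"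
proof (induction d)
  case (Suc d)
  have "(\<Sum>i<2 ^ d * k. \<omega> (n + d) i) = (\<Sum>i<2 * (2 ^ d * k). \<omega> (Suc (n + d)) i)"
    by (subst assms) (rule sum_coarsen)
  then show ?case using Suc by (simp add: mult.assoc)
qed simp

lemma dyadic_path_eq:
  assumes cons: "\<And>n. \<omega> n = coarsen (\<omega> (Suc n))" and r: "r * 2 ^ n = real k"
  shows "dyadic_path \<omega> r = (\<Sum>i<k. \<omega> n i)"
proof -
  let ?l = "dyadic_level r"
  have ex: "\<exists>k::nat. r * 2 ^ n = real k" using r by blast
  have "\<exists>k::nat. r * 2 ^ ?l = real k" and le: "?l \<le> n"
    unfolding dyadic_level_def using LeastI[of "\<lambda>n. \<exists>k::nat. r * 2 ^ n = real k", OF ex]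
      Least_le[of "\<lambda>n. \<exists>k::nat. r * 2 ^ n = real k", OF ex] by auto
  then obtain k0 :: nat where k0: "r * 2 ^ ?l = real k0" by blast
  define d where "d = n - ?l"
  have n: "n = ?l + d" using le by (simp add: d_def)
  have "real k = r * 2 ^ ?l * 2 ^ d" unfolding r[symmetric] by (subst n) (simp add: power_add)
  then have "real k = real (2 ^ d * k0)" unfolding k0 by simp
  then have k: "k = 2 ^ d * k0" by (simp only: of_nat_eq_iff)
  have "dyadic_path \<omega> r = (\<Sum>i<k0. \<omega> ?l i)" by (simp add: dyadic_path_def k0)
  also have "\<dots> = (\<Sum>i<2 ^ d * k0. \<omega> (?l + d) i)" by (intro sum_refine cons)
  finally show ?thesis by (simp add: k n[symmetric])
qed

lemma eventually_dyadic:
  assumes "r \<in> dyadic" shows "\<forall>\<^sub>F n in sequentially. \<exists>k::nat. r * 2 ^ n = real k"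
proof -
  obtain n and k :: nat where k: "r * 2 ^ n = real k" using assms by (auto simp: dyadic_def)
  have "r * 2 ^ m = real (k * 2 ^ (m - n))" if "n \<le> m" for m
  proof -
    have "r * 2 ^ m = r * 2 ^ n * 2 ^ (m - n)" using that by (simp add: power_add[symmetric])
    then show ?thesis by (simp add: k)
  qed
  then show ?thesis unfolding eventually_sequentially by blast
qed

text \<open>For \<open>t \<ge> 0\<close> the numerator of the smallest number of level
  \<open>n\<close> strictly above \<open>t\<close>. Strictness keeps the approximations in
  \<open>{t<..}\<close>, where right limits are taken.\<close>

definition dyadic_above :: "nat \<Rightarrow> real \<Rightarrow> nat" where
  "dyadic_above n t = Suc (nat \<lfloor>t * 2 ^ n\<rfloor>)"

lemma dyadic_above_mono: "s \<le> t \<Longrightarrow> dyadic_above n s \<le> dyadic_above n t"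
  by (auto simp: dyadic_above_def intro!: nat_mono floor_mono mult_right_mono)

lemma dyadic_above_bounds:
  assumes "0 \<le> t"
  shows "t < real (dyadic_above n t) / 2 ^ n" "real (dyadic_above n t) / 2 ^ n \<le> t + 1 / 2 ^ n"
proof -
  have "0 \<le> \<lfloor>t * 2 ^ n\<rfloor>" using assms by simp
  then have "real (dyadic_above n t) = of_int \<lfloor>t * 2 ^ n\<rfloor> + 1"
    unfolding dyadic_above_def by simp
  then have "t * 2 ^ n < real (dyadic_above n t)" "real (dyadic_above n t) \<le> t * 2 ^ n + 1"
    by linarith+
  then show "t < real (dyadic_above n t) / 2 ^ n" "real (dyadic_above n t) / 2 ^ n \<le> t + 1 / 2 ^ n"
    by (simp_all add: field_simps)
qed

lemma dyadic_above_tendsto: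
  assumes "0 \<le> t" shows "(\<lambda>n. real (dyadic_above n t) / 2 ^ n) \<longlonglongrightarrow> t"
proof (rule tendsto_sandwich[where f="\<lambda>_. t" and h="\<lambda>n. t + 1 / 2 ^ n"])
  have "(\<lambda>n. t + (1 / 2) ^ n) \<longlonglongrightarrow> t + 0"
    by (intro tendsto_intros LIMSEQ_realpow_zero) auto
  then show "(\<lambda>n. t + 1 / 2 ^ n) \<longlonglongrightarrow> t" by (simp add: power_one_over)
  show "(\<lambda>n. t) \<longlonglongrightarrow> t" by simp
qed (simp_all add: dyadic_above_bounds[OF assms] less_imp_le[OF dyadic_above_bounds(1)[OF assms]])

lemma filterlim_dyadic_above:
  assumes "0 \<le> t"
  shows "filterlim (\<lambda>n. real (dyadic_above n t) / 2 ^ n) (at t within dyadic \<inter> {t<..}) sequentially"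
  unfolding filterlim_at
proof (intro conjI always_eventually allI dyadic_above_tendsto[OF assms])
  fix n
  have "real (dyadic_above n t) / 2 ^ n \<in> dyadic"
    unfolding dyadic_def by (intro CollectI exI[of _ n] exI[of _ "dyadic_above n t"]) simp
  then show "real (dyadic_above n t) / 2 ^ n \<in> dyadic \<inter> {t<..}" "real (dyadic_above n t) / 2 ^ n \<noteq> t"
    using dyadic_above_bounds(1)[OF assms, of n] by auto
qed

lemma dyadic_right_nontrivial:
  assumes "0 \<le> t" shows "at t within dyadic \<inter> {t<..} \<noteq> bot"
proof
  assume "at t within dyadic \<inter> {t<..} = bot"
  with filterlim_dyadic_above[OF assms] show False
    by (simp add: filterlim_def bot_unique filtermap_bot_iff)
qed

lemma oscillates_mono:
  assumes "oscillates D X e p" "D \<subseteq> D'" "e' \<le> e" shows "oscillates D' X e' p"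
proof -
  obtain a b where ab: "\<And>i. i < p \<Longrightarrow> a i \<in> D" "\<And>i. i < p \<Longrightarrow> b i \<in> D" "\<And>i. i < p \<Longrightarrow> a i < b i"
    "\<And>i. i < p \<Longrightarrow> e \<le> dist (X (a i)) (X (b i))" "\<And>i. Suc i < p \<Longrightarrow> b i \<le> a (Suc i)"
    using assms(1) unfolding oscillates_def by blast
  have "a i \<in> D' \<and> b i \<in> D' \<and> a i < b i \<and> e' \<le> dist (X (a i)) (X (b i))" if "i < p" for i
    using ab(1-4)[OF that] assms(2,3) by auto
  with ab(5) show ?thesis
    unfolding oscillates_def by blast
qed

text \<open>Only countably many thresholds and blocks are tested, so countably many almost sure
  statements suffice. The block length may depend on the threshold but not on the block, whereas the
  bound \<open>p\<close> may depend on both.\<close>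

definition regular_dyadic :: "(nat \<Rightarrow> nat \<Rightarrow> 'a::real_normed_vector) \<Rightarrow> bool" where
  "regular_dyadic \<omega> \<longleftrightarrow> (\<forall>n. \<omega> n = coarsen (\<omega> (Suc n))) \<and>
     (\<forall>m. \<exists>N::nat. \<forall>j::nat. \<exists>p. \<not> oscillates (dyadic \<inter> {real j / 2 ^ N..(real j + 1) / 2 ^ N}) (dyadic_path \<omega>) (1 / real (Suc m)) p)"

lemma regular_dyadic_limits:
  fixes \<omega> :: "nat \<Rightarrow> nat \<Rightarrow> 'a::banach"
  assumes "regular_dyadic \<omega>"
  shows "0 < t \<Longrightarrow> \<exists>l. (dyadic_path \<omega> \<longlongrightarrow> l) (at t within dyadic \<inter> {..<t})"
    and "0 \<le> t \<Longrightarrow> \<exists>l. (dyadic_path \<omega> \<longlongrightarrow> l) (at t within dyadic \<inter> {t<..})"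
proof -
  have osc: "\<exists>N::nat. \<forall>j::nat. \<exists>p. \<not> oscillates (dyadic \<inter> {real j / 2 ^ N..(real j + 1) / 2 ^ N}) (dyadic_path \<omega>) e p"
    if "e > 0" for e :: real
  proof -
    obtain m where "1 / real (Suc m) < e"
      using reals_Archimedean[OF \<open>e > 0\<close>] by (auto simp: inverse_eq_divide)
    then show ?thesis
      using assms unfolding regular_dyadic_def by (meson less_imp_le oscillates_mono order_refl)
  qed
  show "\<exists>l. (dyadic_path \<omega> \<longlongrightarrow> l) (at t within dyadic \<inter> {..<t})" if "0 < t"
  proof (rule left_limit_if_not_oscillates)
    fix e :: real assume "e > 0"
    then obtain N :: nat where N: "\<And>j::nat. \<exists>p. \<not> oscillates (dyadic \<inter> {real j / 2 ^ N..(real j + 1) / 2 ^ N}) (dyadic_path \<omega>) e p"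
      using osc by blast
    \<comment> \<open>The block must reach to the left of \<open>t\<close>: if \<open>t\<close> is
      itself a grid point, this choice is the block that ends there.\<close>
    define j where "j = nat (\<lceil>t * 2 ^ N\<rceil> - 1)"
    have "0 < \<lceil>t * 2 ^ N\<rceil>" using \<open>0 < t\<close> by simp
    then have "real j = of_int \<lceil>t * 2 ^ N\<rceil> - 1" unfolding j_def by simp
    then have "real j < t * 2 ^ N" "t * 2 ^ N \<le> real j + 1" by linarith+
    then have j: "real j / 2 ^ N < t" "t \<le> (real j + 1) / 2 ^ N" by (simp_all add: field_simps)
    obtain p where "\<not> oscillates (dyadic \<inter> {real j / 2 ^ N..(real j + 1) / 2 ^ N}) (dyadic_path \<omega>) e p" using N by blast
    then have "\<not> oscillates (dyadic \<inter> {real j / 2 ^ N<..<t}) (dyadic_path \<omega>) e p"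
      by (rule contrapos_nn) (erule oscillates_mono, use j in auto)
    then show "\<exists>s p. s < t \<and> \<not> oscillates (dyadic \<inter> {s<..<t}) (dyadic_path \<omega>) e p" using j by blast
  qed
  show "\<exists>l. (dyadic_path \<omega> \<longlongrightarrow> l) (at t within dyadic \<inter> {t<..})" if "0 \<le> t"
  proof (rule right_limit_if_not_oscillates)
    fix e :: real assume "e > 0"
    then obtain N :: nat where N: "\<And>j::nat. \<exists>p. \<not> oscillates (dyadic \<inter> {real j / 2 ^ N..(real j + 1) / 2 ^ N}) (dyadic_path \<omega>) e p"
      using osc by blast
    \<comment> \<open>For the right limit a grid point \<open>t\<close> has to be the beginning of
      its block.\<close>
    define j where "j = nat \<lfloor>t * 2 ^ N\<rfloor>"
    have "0 \<le> \<lfloor>t * 2 ^ N\<rfloor>" using \<open>0 \<le> t\<close> by simp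
    then have "real j = of_int \<lfloor>t * 2 ^ N\<rfloor>" unfolding j_def by simp
    then have "real j \<le> t * 2 ^ N" "t * 2 ^ N < real j + 1" by linarith+
    then have j: "real j / 2 ^ N \<le> t" "t < (real j + 1) / 2 ^ N" by (simp_all add: field_simps)
    obtain p where "\<not> oscillates (dyadic \<inter> {real j / 2 ^ N..(real j + 1) / 2 ^ N}) (dyadic_path \<omega>) e p" using N by blast
    then have "\<not> oscillates (dyadic \<inter> {t<..<(real j + 1) / 2 ^ N}) (dyadic_path \<omega>) e p"
      by (rule contrapos_nn) (erule oscillates_mono, use j in auto)
    then show "\<exists>s p. t < s \<and> \<not> oscillates (dyadic \<inter> {t<..<s}) (dyadic_path \<omega>) e p" using j by blast
  qed
qed

text \<open>The finitely many endpoints lie on every sufficiently fine grid. There each displacement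
  is a sum of consecutive increments of block \<open>j\<close>, so each oscillation costs the greedy
  walk a reset.\<close>

lemma greedy_count_ge_if_oscillates:
  fixes \<omega> :: "nat \<Rightarrow> nat \<Rightarrow> 'a::real_normed_vector"
  assumes cons: "\<And>n. \<omega> n = coarsen (\<omega> (Suc n))" and c: "0 \<le> c" "2 * c < e"
    and osc: "oscillates (dyadic \<inter> {real j / 2 ^ N..(real j + 1) / 2 ^ N}) (dyadic_path \<omega>) e p"
  shows "\<forall>\<^sub>F n in sequentially. p \<le> snd (greedy c (\<lambda>i. \<omega> (N + n) (j * 2 ^ n + i)) (0, 0) (2 ^ n))"
proof -
  obtain a b where ab: "\<And>i. i < p \<Longrightarrow> a i \<in> dyadic" "\<And>i. i < p \<Longrightarrow> b i \<in> dyadic"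
    "\<And>i. i < p \<Longrightarrow> real j / 2 ^ N \<le> a i" "\<And>i. i < p \<Longrightarrow> b i \<le> (real j + 1) / 2 ^ N"
    "\<And>i. i < p \<Longrightarrow> a i < b i" "\<And>i. i < p \<Longrightarrow> e \<le> dist (dyadic_path \<omega> (a i)) (dyadic_path \<omega> (b i))"
    "\<And>i. Suc i < p \<Longrightarrow> b i \<le> a (Suc i)"
    using osc unfolding oscillates_def by auto
  have ev: "\<forall>\<^sub>F n in sequentially. \<exists>k::nat. r * 2 ^ (N + n) = real k" if "r \<in> dyadic" for r
    using eventually_dyadic[OF that] eventually_sequentially_seg[of "\<lambda>n. \<exists>k::nat. r * 2 ^ n = real k" N] by (simp add: add.commute)
  have "\<forall>\<^sub>F n in sequentially. \<forall>i\<in>{..<p}. (\<exists>k::nat. a i * 2 ^ (N + n) = real k) \<and> (\<exists>k::nat. b i * 2 ^ (N + n) = real k)"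
    by (intro eventually_ball_finite ballI eventually_conj ev ab) auto
  then show ?thesis
  proof eventually_elim
    case (elim n)
    then have "\<forall>i. \<exists>k l :: nat. i < p \<longrightarrow> a i * 2 ^ (N + n) = real k \<and> b i * 2 ^ (N + n) = real l"
      by (metis lessThan_iff)
    then obtain A B :: "nat \<Rightarrow> nat" where AB: "\<And>i. i < p \<Longrightarrow> a i * 2 ^ (N + n) = real (A i)" "\<And>i. i < p \<Longrightarrow> b i * 2 ^ (N + n) = real (B i)"
      by metis
    have scale: "x * 2 ^ (N + n) \<le> y * 2 ^ (N + n) \<longleftrightarrow> x \<le> y" for x y :: real by simp
    have jA: "j * 2 ^ n \<le> A i" and Bj: "B i \<le> j * 2 ^ n + 2 ^ n" and AB': "A i \<le> B i" if "i < p" for i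
    proof -
      have "real j / 2 ^ N * 2 ^ (N + n) \<le> real (A i)"
        unfolding AB(1)[OF that, symmetric] scale using ab(3)[OF that] .
      then have "real (j * 2 ^ n) \<le> real (A i)" by (simp add: power_add)
      then show "j * 2 ^ n \<le> A i" by (simp only: of_nat_le_iff)
      have "real (B i) \<le> (real j + 1) / 2 ^ N * 2 ^ (N + n)"
        unfolding AB(2)[OF that, symmetric] scale using ab(4)[OF that] .
      also have "\<dots> = real (j * 2 ^ n + 2 ^ n)" by (simp add: power_add field_simps)
      finally have "real (B i) \<le> real (j * 2 ^ n + 2 ^ n)" .
      then show "B i \<le> j * 2 ^ n + 2 ^ n" by (simp only: of_nat_le_iff)
      have "real (A i) \<le> real (B i)"
        unfolding AB(1)[OF that, symmetric] AB(2)[OF that, symmetric] scale using ab(5)[OF that] by simp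
      then show "A i \<le> B i" by simp
    qed
    show ?case
    \<comment> \<open>Indices are counted from \<open>j * 2 ^ n\<close>, the first increment of
      block \<open>j\<close> at level \<open>N + n\<close>.\<close>
    proof (rule greedy_count_ge[where a="\<lambda>i. A i - j * 2 ^ n" and b="\<lambda>i. B i - j * 2 ^ n"])
      show "B i - j * 2 ^ n \<le> A (Suc i) - j * 2 ^ n" if "Suc i < p" for i
      proof -
        have "real (B i) \<le> real (A (Suc i))"
          unfolding AB(1)[OF that, symmetric] AB(2)[OF Suc_lessD[OF that], symmetric] scale using ab(7)[OF that] .
        then show ?thesis by simp
      qed
      show "2 * c < norm (\<Sum>l=A i - j * 2 ^ n..<B i - j * 2 ^ n. \<omega> (N + n) (j * 2 ^ n + l))" if "i < p" for i
      proof -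
        have "(\<Sum>l=A i - j * 2 ^ n..<B i - j * 2 ^ n. \<omega> (N + n) (j * 2 ^ n + l)) =
            (\<Sum>l=A i..<B i. \<omega> (N + n) l)"
          using sum.shift_bounds_nat_ivl[of "\<lambda>l. \<omega> (N + n) l" "A i - j * 2 ^ n" "j * 2 ^ n" "B i - j * 2 ^ n"]
            jA[OF that] AB'[OF that] by (simp add: add.commute)
        also have "\<dots> = dyadic_path \<omega> (b i) - dyadic_path \<omega> (a i)"
          using sum_diff_nat_ivl[of 0 "A i" "B i" "\<omega> (N + n)"] AB'[OF that]
          unfolding dyadic_path_eq[where \<omega>=\<omega>, OF cons AB(1)[OF that]] dyadic_path_eq[where \<omega>=\<omega>, OF cons AB(2)[OF that]]
          by (simp add: lessThan_atLeast0)
        finally show ?thesis using ab(6)[OF that] c(2) by (simp add: dist_norm norm_minus_commute)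
      qed
      show "A i - j * 2 ^ n \<le> B i - j * 2 ^ n" "B i - j * 2 ^ n \<le> 2 ^ n" if "i < p" for i
        using AB'[OF that] Bj[OF that] by auto
    qed (use c in auto)
  qed
qed

lemma iid_sequence_borel_probs: "\<kappa> \<in> borel_probs \<Longrightarrow> iid_sequence \<kappa>"
  by (simp add: iid_sequence_def iid_sequence_axioms_def sequence_space_def product_prob_space_def
      product_sigma_finite_def product_prob_space_axioms_def borel_probsD prob_space_imp_sigma_finite)

section \<open>Existence of Levy processes\<close>

locale dyadic_increments =
  fixes \<kappa> :: "nat \<Rightarrow> (real ^ 'd) measure" and \<psi> :: "real ^ 'd \<Rightarrow> complex"
    and Q :: "(nat \<Rightarrow> nat \<Rightarrow> real ^ 'd) measure"
  assumes \<kappa>: "\<And>n. \<kappa> n \<in> borel_probs"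
    and charfun_\<kappa>: "\<And>n y. charfun (\<kappa> n) y = exp (of_real (1 / 2 ^ n) * \<psi> y)"
    and prob_Q: "prob_space Q"
    and measurable_level: "\<And>n. (\<lambda>\<omega>. \<omega> n) \<in> borel_measurable Q"
    and distr_level: "\<And>n. distr Q borel (\<lambda>\<omega>. \<omega> n) = (\<Pi>\<^sub>M i\<in>(UNIV::nat set). \<kappa> n)"
    and consistent: "AE \<omega> in Q. \<forall>n. \<omega> n = coarsen (\<omega> (Suc n))"
begin

sublocale Q: prob_space Q by (rule prob_Q)

abbreviation "iid n \<equiv> (\<Pi>\<^sub>M i\<in>(UNIV::nat set). \<kappa> n)"

lemma measurable_level': "(\<lambda>\<omega>. \<omega> n) \<in> Q \<rightarrow>\<^sub>M iid n"
  using measurable_level[of n] sets_PiM_borel_probs[OF \<kappa>, of n] by (simp cong: measurable_cong_sets)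

lemma distr_level': "distr Q (iid n) (\<lambda>\<omega>. \<omega> n) = iid n"
  using distr_level[of n] distr_cong[OF refl sets_PiM_borel_probs[OF \<kappa>, of n] refl] by metis

lemma measurable_increment [measurable]: "(\<lambda>\<omega>. \<omega> n i) \<in> borel_measurable Q"
  using measurable_compose[OF measurable_level' iid_component_measurable[OF \<kappa>]] .

lemma distr_level_compose:
  assumes "f \<in> iid n \<rightarrow>\<^sub>M N"
  shows "distr Q N (\<lambda>\<omega>. f (\<omega> n)) = distr (iid n) N f"
  using distr_distr[OF assms measurable_level'] by (simp add: distr_level' comp_def)

lemma charfun_block:
  assumes "finite A"
  shows "charfun (distr Q borel (\<lambda>\<omega>. \<Sum>i\<in>A. \<omega> n i)) y = exp (of_real (real (card A) / 2 ^ n) * \<psi> y)"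
proof -
  note [measurable] = iid_component_measurable[OF \<kappa>]
  have "distr Q borel (\<lambda>\<omega>. \<Sum>i\<in>A. \<omega> n i) = distr (iid n) borel (\<lambda>\<omega>. \<Sum>i\<in>A. \<omega> i)"
    by (rule distr_level_compose) measurable
  then show ?thesis
    by (simp add: charfun_iid_sum[OF \<kappa> assms] charfun_\<kappa> flip: exp_of_nat_mult)
qed


lemma nn_integral_greedy_block_le:
  assumes e: "0 \<le> e"
    and small: "\<And>k. k \<le> L \<Longrightarrow> 3 * emeasure (distr Q borel (\<lambda>\<omega>. \<Sum>i<k. \<omega> n i)) {x. norm x > e} \<le> 1"
  shows "(\<integral>\<^sup>+\<omega>. of_nat (snd (greedy (2 * e) (\<lambda>i. \<omega> n (a + i)) (0, 0) L)) \<partial>Q) \<le> 1"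
proof -
  interpret iid: iid_sequence "\<kappa> n" by (rule iid_sequence_borel_probs[OF \<kappa>])
  \<comment> \<open>Dropping the first \<open>a\<close> entries preserves the i.i.d. law, so every
    block behaves like the first one.\<close>
  have shift: "distr (iid n) (iid n) (\<lambda>\<omega> i. \<omega> (a + i)) = iid n"
    using distr_PiM_reindex[of UNIV "\<lambda>_. \<kappa> n" "\<lambda>i::nat. a + i" UNIV] borel_probsD(1)[OF \<kappa>]
    by (simp add: restrict_UNIV)
  have meas: "(\<lambda>\<omega> i. \<omega> (a + i)) \<in> iid n \<rightarrow>\<^sub>M iid n"
    by (rule measurable_PiM_single') (auto simp: space_PiM)
  have law: "distr Q (iid n) (\<lambda>\<omega> i. \<omega> n (a + i)) = iid n"
    using distr_level_compose[OF meas] by (simp add: shift)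
  have G: "(\<lambda>\<xi>. of_nat (snd (greedy (2 * e) \<xi> (0, 0) L)) :: ennreal) \<in> borel_measurable (iid n)"
    by measurable
  have "(\<integral>\<^sup>+\<omega>. of_nat (snd (greedy (2 * e) (\<lambda>i. \<omega> n (a + i)) (0, 0) L)) \<partial>Q) =
      (\<integral>\<^sup>+\<xi>. of_nat (snd (greedy (2 * e) \<xi> (0, 0) L)) \<partial>distr Q (iid n) (\<lambda>\<omega> i. \<omega> n (a + i)))"
    by (subst nn_integral_distr[OF measurable_compose[OF measurable_level' meas]]) (use G in simp_all)
  also have "\<dots> \<le> 1"
    unfolding law
  proof (rule iid.nn_integral_greedy_le[OF _ e])
    fix k assume "k \<le> L"
    note [measurable] = iid.measurable_component
    have ev: "{x :: real^'d. norm x > e} \<in> sets borel" by measurable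
    have "distr Q borel (\<lambda>\<omega>. \<Sum>i<k. \<omega> n i) = distr (iid n) borel (\<lambda>\<omega>. \<Sum>i<k. \<omega> i)"
      by (rule distr_level_compose) measurable
    then have "iid.exceed e k 0 = emeasure (distr Q borel (\<lambda>\<omega>. \<Sum>i<k. \<omega> n i)) {x. norm x > e}"
      unfolding iid.exceed_def using ev
      by (simp add: emeasure_distr vimage_def Int_def conj_commute)
    then show "3 * iid.exceed e k 0 \<le> 1" using small[OF \<open>k \<le> L\<close>] by simp
  qed
  finally show ?thesis .
qed

text \<open>The expected counts on a block are bounded by 1 uniformly over the levels, so by Fatou's
  lemma their liminf is almost surely finite; \<open>p\<close> oscillations would force this liminf
  to be at least \<open>p\<close>.\<close>

lemma AE_not_oscillates:
  assumes "e > 0"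
  shows "\<exists>N::nat. \<forall>j::nat. AE \<omega> in Q.
     \<exists>p. \<not> oscillates (dyadic \<inter> {real j / 2 ^ N..(real j + 1) / 2 ^ N}) (dyadic_path \<omega>) e p"
proof -
  \<comment> \<open>Tails are measured at \<open>c\<close>, resets happen at \<open>2 * c\<close>,
    and oscillations are detected above \<open>2 * (2 * c)\<close>, which has to stay below
    \<open>e\<close>.\<close>
  define c where "c = e / 8"
  have c: "c > 0" "2 * (2 * c) < e" using assms by (auto simp: c_def)
  obtain \<delta> where \<delta>: "\<delta> > 0"
    and tail: "\<And>\<mu> t. \<lbrakk>\<mu> \<in> borel_probs; 0 \<le> t; t \<le> \<delta>; \<And>y. charfun \<mu> y = exp (of_real t * \<psi> y)\<rbrakk> \<Longrightarrow>
      3 * emeasure \<mu> {x. norm x > c} \<le> 1"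
    using small_tail_of_charfun[OF c(1), of \<psi>] by blast
  \<comment> \<open>Blocks are shorter than \<delta>, so every partial sum inside a block has a law
    with time parameter at most \<delta>.\<close>
  obtain N :: nat where N: "(1 / 2) ^ N < \<delta>" using real_arch_pow_inv[OF \<delta>, of "1/2"] by auto
  show ?thesis
  proof (intro exI[of _ N] allI)
    fix j :: nat
    define G where "G n \<omega> = (of_nat (snd (greedy (2 * c) (\<lambda>i. \<omega> (N + n) (j * 2 ^ n + i)) (0, 0) (2 ^ n))) :: ennreal)" for n and \<omega> :: "nat \<Rightarrow> nat \<Rightarrow> real^'d"
    have G_le: "(\<integral>\<^sup>+\<omega>. G n \<omega> \<partial>Q) \<le> 1" for n
      unfolding G_def
    proof (rule nn_integral_greedy_block_le)
      fix k :: nat assume k: "k \<le> 2 ^ n"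
      show "3 * emeasure (distr Q borel (\<lambda>\<omega>. \<Sum>i<k. \<omega> (N + n) i)) {x. norm x > c} \<le> 1"
      proof (rule tail)
        show "distr Q borel (\<lambda>\<omega>. \<Sum>i<k. \<omega> (N + n) i) \<in> borel_probs"
          by (intro borel_probs_distr prob_Q) measurable
        show "charfun (distr Q borel (\<lambda>\<omega>. \<Sum>i<k. \<omega> (N + n) i)) y = exp (of_real (real k / 2 ^ (N + n)) * \<psi> y)" for y
          by (subst charfun_block) auto
        have "real k / 2 ^ (N + n) \<le> 2 ^ n / 2 ^ (N + n)"
          using of_nat_mono[OF k, where 'a=real] by (intro divide_right_mono) simp_all
        also have "\<dots> = (1 / 2) ^ N" by (simp add: power_add power_one_over)
        finally show "real k / 2 ^ (N + n) \<le> \<delta>" using N by simp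
      qed simp
    qed (use c in auto)
    have [measurable]: "G n \<in> borel_measurable Q" for n
    proof -
      interpret iid: iid_sequence "\<kappa> (N + n)" by (rule iid_sequence_borel_probs[OF \<kappa>])
      have meas: "(\<lambda>\<omega> i. \<omega> (j * 2 ^ n + i)) \<in> iid (N + n) \<rightarrow>\<^sub>M iid (N + n)"
        by (rule measurable_PiM_single') (auto simp: space_PiM)
      have "(\<lambda>\<xi>. of_nat (snd (greedy (2 * c) \<xi> (0, 0) (2 ^ n))) :: ennreal) \<in> borel_measurable (iid (N + n))"
        by measurable
      from measurable_compose[OF measurable_compose[OF measurable_level' meas] this]
      show ?thesis unfolding G_def[abs_def] .
    qed
    have "(\<integral>\<^sup>+\<omega>. liminf (\<lambda>n. G n \<omega>) \<partial>Q) \<le> liminf (\<lambda>n. \<integral>\<^sup>+\<omega>. G n \<omega> \<partial>Q)"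
      by (rule nn_integral_liminf) measurable
    also have "\<dots> \<le> limsup (\<lambda>n. \<integral>\<^sup>+\<omega>. G n \<omega> \<partial>Q)" by (rule Liminf_le_Limsup) simp
    also have "\<dots> \<le> 1" by (rule Limsup_bounded) (simp add: G_le)
    finally have "(\<integral>\<^sup>+\<omega>. liminf (\<lambda>n. G n \<omega>) \<partial>Q) \<noteq> \<infinity>" by (auto simp: top_unique)
    then have "AE \<omega> in Q. liminf (\<lambda>n. G n \<omega>) \<noteq> \<infinity>"
      by (intro nn_integral_PInf_AE) measurable
    with consistent show "AE \<omega> in Q. \<exists>p. \<not> oscillates (dyadic \<inter> {real j / 2 ^ N..(real j + 1) / 2 ^ N}) (dyadic_path \<omega>) e p"
    proof eventually_elim
      case (elim \<omega>)
      obtain p :: nat where p: "liminf (\<lambda>n. G n \<omega>) < of_nat p"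
        using ennreal_Ex_less_of_nat elim(2) by (metis infinity_ennreal_def less_top)
      have "\<not> oscillates (dyadic \<inter> {real j / 2 ^ N..(real j + 1) / 2 ^ N}) (dyadic_path \<omega>) e p"
      proof
        assume osc: "oscillates (dyadic \<inter> {real j / 2 ^ N..(real j + 1) / 2 ^ N}) (dyadic_path \<omega>) e p"
        have "\<forall>\<^sub>F n in sequentially. of_nat p \<le> G n \<omega>"
          using greedy_count_ge_if_oscillates[where \<omega>=\<omega>, OF spec[OF elim(1)] _ c(2) osc] c(1)
          by (simp add: G_def)
        then have "of_nat p \<le> liminf (\<lambda>n. G n \<omega>)" by (rule Liminf_bounded)
        with p show False by simp
      qed
      then show ?case ..
    qed
  qed
qed

lemma AE_regular: "AE \<omega> in Q. regular_dyadic \<omega>"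
proof -
  have "\<exists>N::nat. \<forall>j::nat. AE \<omega> in Q.
     \<exists>p. \<not> oscillates (dyadic \<inter> {real j / 2 ^ N..(real j + 1) / 2 ^ N}) (dyadic_path \<omega>) (1 / real (Suc m)) p" for m
    by (rule AE_not_oscillates) simp
  then obtain N :: "nat \<Rightarrow> nat" where N: "\<And>m j. AE \<omega> in Q.
     \<exists>p. \<not> oscillates (dyadic \<inter> {real j / 2 ^ N m..(real j + 1) / 2 ^ N m}) (dyadic_path \<omega>) (1 / real (Suc m)) p"
    by metis
  have "AE \<omega> in Q. \<forall>m j. \<exists>p. \<not> oscillates (dyadic \<inter> {real j / 2 ^ N m..(real j + 1) / 2 ^ N m}) (dyadic_path \<omega>) (1 / real (Suc m)) p"
    using N by (simp add: AE_all_countable)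
  with consistent show ?thesis
  proof eventually_elim
    case (elim \<omega>)
    show ?case
      unfolding regular_dyadic_def
      by (intro conjI elim(1) allI, rule_tac x="N m" in exI) (use elim(2) in blast)
  qed
qed

text \<open>The process consists of right limits of the dyadic path. Its increments are almost sure
  limits of sums over blocks of one level, and these sums are independent with known characteristic
  functions; both facts survive the limit.\<close>

lemma ex_levy_process:
  "\<exists>Y. levy_process Q Y \<and> (\<forall>t\<ge>0. \<forall>y. charfun (distr Q borel (Y t)) y = exp (of_real t * \<psi> y))"
proof -
  \<comment> \<open>A measurable set \<open>Gd\<close> of full measure is taken inside the regular
    arrays; off it the process is set to 0, because every path, not just almost every one, must be
    regular.\<close>
  obtain Z where Z: "{\<omega> \<in> space Q. \<not> regular_dyadic \<omega>} \<subseteq> Z" "emeasure Q Z = 0" "Z \<in> sets Q"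
    by (rule AE_E[OF AE_regular]) blast
  define Gd where "Gd = space Q - Z"
  have Gd[measurable]: "Gd \<in> sets Q" using Z by (auto simp: Gd_def)
  have Gd_AE: "AE \<omega> in Q. \<omega> \<in> Gd"
    by (rule AE_I[OF _ Z(2,3)]) (auto simp: Gd_def)
  have reg: "regular_dyadic \<omega>" if "\<omega> \<in> Gd" for \<omega> using that Z(1) by (auto simp: Gd_def)
  have cons: "\<omega> n = coarsen (\<omega> (Suc n))" if "\<omega> \<in> Gd" for \<omega> n
    using reg[OF that] unfolding regular_dyadic_def by blast
  define X where "X t \<omega> = (if \<omega> \<in> Gd then Lim (at t within dyadic \<inter> {t<..}) (dyadic_path \<omega>) else 0)" for t \<omega>
  define F where "F n t \<omega> = (\<Sum>i<dyadic_above n t. \<omega> n i)" for n t and \<omega> :: "nat \<Rightarrow> nat \<Rightarrow> real^'d"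
  have lim: "(dyadic_path \<omega> \<longlongrightarrow> X t \<omega>) (at t within dyadic \<inter> {t<..})" if "\<omega> \<in> Gd" "0 \<le> t" for \<omega> t
    using regular_dyadic_limits(2)[OF reg[OF that(1)] that(2)] that(1) tendsto_Lim[OF dyadic_right_nontrivial[OF that(2)]]
    by (auto simp: X_def)
  have F_lim: "(\<lambda>n. F n t \<omega>) \<longlonglongrightarrow> X t \<omega>" if "\<omega> \<in> Gd" "0 \<le> t" for \<omega> t
  proof -
    have "F n t \<omega> = dyadic_path \<omega> (real (dyadic_above n t) / 2 ^ n)" for n
      unfolding F_def by (rule dyadic_path_eq[symmetric, where \<omega>=\<omega>, OF cons[OF that(1)]]) simp
    then show ?thesis
      using filterlim_compose[OF lim[OF that] filterlim_dyadic_above[OF that(2)]] by simp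
  qed
  have F_meas: "F n t \<in> borel_measurable Q" for n t unfolding F_def by measurable
  have X_meas[measurable]: "X t \<in> borel_measurable Q" if "0 \<le> t" for t
  proof (rule borel_measurable_LIMSEQ_metric)
    show "(\<lambda>\<omega>. if \<omega> \<in> Gd then F n t \<omega> else 0) \<in> borel_measurable Q" for n
      using F_meas by measurable
    show "(\<lambda>n. if \<omega> \<in> Gd then F n t \<omega> else 0) \<longlonglongrightarrow> X t \<omega>" for \<omega>
      using F_lim[OF _ that] by (cases "\<omega> \<in> Gd") (auto simp: X_def)
  qed
  define W where "W n s t \<omega> = (\<Sum>i\<in>{dyadic_above n s..<dyadic_above n t}. \<omega> n i)" for n s t and \<omega> :: "nat \<Rightarrow> nat \<Rightarrow> real^'d"
  have W_meas[measurable]: "W n s t \<in> borel_measurable Q" for n s t unfolding W_def by measurable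
  have W_lim: "AE \<omega> in Q. (\<lambda>n. W n s t \<omega>) \<longlonglongrightarrow> X t \<omega> - X s \<omega>" if "0 \<le> s" "s \<le> t" for s t
    using Gd_AE
  proof eventually_elim
    case (elim \<omega>)
    have "W n s t \<omega> = F n t \<omega> - F n s \<omega>" for n
      using sum_diff_nat_ivl[of 0 "dyadic_above n s" "dyadic_above n t" "\<omega> n"] dyadic_above_mono[OF that(2), of n]
      by (simp add: W_def F_def lessThan_atLeast0)
    then show ?case
      using tendsto_diff[OF F_lim[OF elim] F_lim[OF elim], of t s] that by simp
  qed
  have law: "charfun (distr Q borel (\<lambda>\<omega>. X t \<omega> - X s \<omega>)) y = exp (of_real (t - s) * \<psi> y)"
    if st: "0 \<le> s" "s \<le> t" for s t y
  proof (rule LIMSEQ_unique)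
    show "(\<lambda>n. charfun (distr Q borel (W n s t)) y) \<longlonglongrightarrow> charfun (distr Q borel (\<lambda>\<omega>. X t \<omega> - X s \<omega>)) y"
      by (rule charfun_AE_limit[OF prob_Q W_meas _ W_lim[OF st]]) (use st in simp)
    have "charfun (distr Q borel (W n s t)) y = exp (of_real (real (dyadic_above n t) / 2 ^ n - real (dyadic_above n s) / 2 ^ n) * \<psi> y)" for n
      unfolding W_def using dyadic_above_mono[OF st(2), of n]
      by (subst charfun_block) (auto simp: of_nat_diff diff_divide_distrib)
    moreover have "(\<lambda>n. exp (of_real (real (dyadic_above n t) / 2 ^ n - real (dyadic_above n s) / 2 ^ n) * \<psi> y)) \<longlonglongrightarrow> exp (of_real (t - s) * \<psi> y)"
      by (intro tendsto_intros dyadic_above_tendsto) (use st in auto)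
    ultimately show "(\<lambda>n. charfun (distr Q borel (W n s t)) y) \<longlonglongrightarrow> exp (of_real (t - s) * \<psi> y)" by simp
  qed
  \<comment> \<open>\<open>X 0 \<omega>\<close> is a right limit at 0 and may be nonzero for
    exceptional \<omega>; subtracting it makes every path start in 0 without changing
    increments.\<close>
  define Y where "Y t \<omega> = X t \<omega> - X 0 \<omega>" for t \<omega>
  have "levy_process Q Y"
    unfolding levy_process_def
  proof (intro conjI allI impI ballI prob_Q)
    show "Y t \<in> borel_measurable Q" if "0 \<le> t" for t
      unfolding Y_def using that by measurable
    show "Y 0 \<omega> = 0" for \<omega> by (simp add: Y_def)
  next
    fix n and t :: "nat \<Rightarrow> real" assume t: "0 \<le> t 0 \<and> (\<forall>i<n. t i \<le> t (Suc i))"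
    have mono: "t i \<le> t j" if "i \<le> j" "j \<le> n" for i j
      using that
    proof (induction rule: dec_induct)
      case (step k)
      then show ?case using t by (meson Suc_le_lessD Suc_leD order_trans)
    qed simp
    have pos: "0 \<le> t i" if "i \<le> n" for i using mono[of 0 i] that t by simp
    have "Q.indep_vars (\<lambda>_. borel) (\<lambda>i \<omega>. X (t (Suc i)) \<omega> - X (t i) \<omega>) {..<n}"
    proof (rule Q.indep_vars_AE_limit[where W="\<lambda>m i. W m (t i) (t (Suc i))"])
      fix m
      have "disjoint_family_on (\<lambda>i. {dyadic_above m (t i)..<dyadic_above m (t (Suc i))}) {..<n}"
        unfolding disjoint_family_on_def
      proof (intro ballI impI)
        have *: "{dyadic_above m (t i)..<dyadic_above m (t (Suc i))} \<inter> {dyadic_above m (t j)..<dyadic_above m (t (Suc j))} = {}"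
          if "i < j" "j < n" for i j
          using dyadic_above_mono[OF mono[of "Suc i" j], of m] that by auto
        fix i j assume "i \<in> {..<n}" "j \<in> {..<n}" "i \<noteq> j"
        then show "{dyadic_above m (t i)..<dyadic_above m (t (Suc i))} \<inter> {dyadic_above m (t j)..<dyadic_above m (t (Suc j))} = {}"
          using *[of i j] *[of j i] by (cases i j rule: linorder_cases) auto
      qed
      from iid_blocks_indep_vars[OF \<kappa>[of m] this]
      have "prob_space.indep_vars (distr Q (iid m) (\<lambda>\<omega>. \<omega> m)) (\<lambda>_. borel)
          (\<lambda>j \<omega>. \<Sum>i\<in>{dyadic_above m (t j)..<dyadic_above m (t (Suc j))}. \<omega> i) {..<n}"
        by (simp only: distr_level')
      from indep_vars_distr[OF prob_Q measurable_level' this]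
      show "Q.indep_vars (\<lambda>_. borel) (\<lambda>i. W m (t i) (t (Suc i))) {..<n}"
        unfolding W_def .
    next
      fix i assume i: "i \<in> {..<n}"
      then have [simp]: "0 \<le> t i" "0 \<le> t (Suc i)" "t i \<le> t (Suc i)" using pos mono by auto
      show "(\<lambda>\<omega>. X (t (Suc i)) \<omega> - X (t i) \<omega>) \<in> borel_measurable Q" by simp
      show "AE \<omega> in Q. (\<lambda>m. W m (t i) (t (Suc i)) \<omega>) \<longlonglongrightarrow> X (t (Suc i)) \<omega> - X (t i) \<omega>"
        by (rule W_lim) simp_all
    qed
    then show "Q.indep_vars (\<lambda>_. borel) (\<lambda>i \<omega>. Y (t (Suc i)) \<omega> - Y (t i) \<omega>) {..<n}"
      by (simp add: Y_def)
  next
    fix s t :: real assume st: "0 \<le> s" "0 \<le> t"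
    have "distr Q borel (\<lambda>\<omega>. X (s + t) \<omega> - X s \<omega>) = distr Q borel (\<lambda>\<omega>. X t \<omega> - X 0 \<omega>)"
      using st by (intro charfun_unique borel_probs_distr prob_Q) (auto simp: law)
    then show "distr Q borel (\<lambda>\<omega>. Y (s + t) \<omega> - Y s \<omega>) = distr Q borel (Y t)"
      by (simp add: Y_def[abs_def])
  next
    fix \<omega> and t :: real assume "0 \<le> t"
    show "continuous (at_right t) (\<lambda>s. Y s \<omega>)"
    proof (cases "\<omega> \<in> Gd")
      case True
      have "continuous (at_right t) (\<lambda>s. X s \<omega>)"
        by (rule right_limit_regular(1)[where D=dyadic, OF dyadic_right_nontrivial lim[OF True] regular_dyadic_limits(1)[OF reg[OF True]] \<open>0 \<le> t\<close>])
      then show ?thesis unfolding Y_def by (intro continuous_intros)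
    qed (simp add: Y_def X_def)
  next
    fix \<omega> and t :: real assume "0 < t"
    show "\<exists>l. ((\<lambda>s. Y s \<omega>) \<longlongrightarrow> l) (at_left t)"
    proof (cases "\<omega> \<in> Gd")
      case True
      obtain l where "((\<lambda>s. X s \<omega>) \<longlongrightarrow> l) (at_left t)"
        using right_limit_regular(2)[where D=dyadic, OF dyadic_right_nontrivial lim[OF True] regular_dyadic_limits(1)[OF reg[OF True]] \<open>0 < t\<close>]
        by blast
      then show ?thesis unfolding Y_def by (intro exI[of _ "l - X 0 \<omega>"] tendsto_intros)
    qed (auto simp: Y_def X_def)
  qed
  moreover have "charfun (distr Q borel (Y t)) y = exp (of_real t * \<psi> y)" if "0 \<le> t" for t y
    using law[of 0 t y] that by (simp add: Y_def[abs_def])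
  ultimately show ?thesis by blast
qed

end

lemma ex_levy_process_path_space:
  fixes \<nu> :: "(real ^ 'd) measure"
  assumes "\<nu> \<in> ID"
  shows "\<exists>(M :: (real \<Rightarrow> real ^ 'd) measure) Y. levy_process M Y \<and>
    (\<forall>t\<ge>0. \<forall>y. charfun (distr M borel (Y t)) y = exp (of_real t * log_charfun \<nu> y))"
proof -
  have "\<exists>\<kappa>\<in>borel_probs. \<forall>y. charfun \<kappa> y = exp (of_real (1 / 2 ^ n) * log_charfun \<nu> y)" for n
    using ID_root[OF assms, of "2 ^ n"] by (auto simp: field_simps)
  then obtain \<kappa> where \<kappa>: "\<And>n. \<kappa> n \<in> borel_probs"
    "\<And>n y. charfun (\<kappa> n) y = exp (of_real (1 / 2 ^ n) * log_charfun \<nu> y)"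
    by metis
  have sq: "charfun (\<kappa> (Suc n)) y ^ 2 = charfun (\<kappa> n) y" for n y
    by (simp add: \<kappa>(2) flip: exp_of_nat_mult)
  obtain Q :: "(nat \<Rightarrow> nat \<Rightarrow> real ^ 'd) measure"
    where Q: "prob_space Q" "\<And>n. (\<lambda>\<omega>. \<omega> n) \<in> borel_measurable Q"
      "\<And>n. distr Q borel (\<lambda>\<omega>. \<omega> n) = (\<Pi>\<^sub>M i\<in>(UNIV::nat set). \<kappa> n)"
      "AE \<omega> in Q. \<forall>n. \<omega> n = coarsen (\<omega> (Suc n))"
    by (rule dyadic_projective_limit[of \<kappa>, OF \<kappa>(1) sq]) (rule that)
  interpret dyadic_increments \<kappa> "log_charfun \<nu>" Q
    by (rule dyadic_increments.intro) (rule \<kappa> Q)+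
  obtain Y where Y: "levy_process Q Y" "\<And>t y. t \<ge> 0 \<Longrightarrow> charfun (distr Q borel (Y t)) y = exp (of_real t * log_charfun \<nu> y)"
    using ex_levy_process by blast
  \<comment> \<open>An array is stored in the values of a function at the natural numbers:
    \<open>G\<close> writes it as a step function and \<open>T\<close> reads it back. The
    sigma-algebra pulled back along \<open>T\<close> makes both maps measurable.\<close>
  define T where "T f m n = f (real (prod_encode (m, n)))" for f :: "real \<Rightarrow> real ^ 'd" and m n
  define G where "G \<omega> r = \<omega> (fst (prod_decode (nat \<lfloor>r\<rfloor>))) (snd (prod_decode (nat \<lfloor>r\<rfloor>)))"
    for \<omega> :: "nat \<Rightarrow> nat \<Rightarrow> real ^ 'd" and r :: real
  have TG: "T (G \<omega>) = \<omega>" for \<omega> by (simp add: T_def G_def fun_eq_iff)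
  define V where "V = vimage_algebra (T -` space Q) T Q"
  have T: "T \<in> V \<rightarrow>\<^sub>M Q" unfolding V_def by (rule measurable_vimage_algebra1) auto
  have G: "G \<in> Q \<rightarrow>\<^sub>M V" unfolding V_def by (rule measurable_vimage_algebra2) (auto simp: TG)
  define M where "M = distr Q V G"
  have TM: "T \<in> M \<rightarrow>\<^sub>M Q" using T by (simp add: M_def)
  have law: "distr M N (\<lambda>\<omega>. f (T \<omega>)) = distr Q N f" if "f \<in> Q \<rightarrow>\<^sub>M N" for f and N :: "'x measure"
    unfolding M_def by (subst distr_distr[OF measurable_compose[OF T that] G]) (simp add: comp_def TG)
  have "distr M Q T = Q"
    unfolding M_def by (subst distr_distr[OF T G]) (simp add: comp_def TG distr_id2)
  then have "levy_process M (\<lambda>t \<omega>. Y t (T \<omega>))"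
    by (rule levy_process_transfer[OF Y(1) TM]) (simp add: M_def Q.prob_space_distr[OF G])
  moreover have "charfun (distr M borel (\<lambda>\<omega>. Y t (T \<omega>))) y = exp (of_real t * log_charfun \<nu> y)" if "t \<ge> 0" for t y
  proof -
    have "Y t \<in> borel_measurable Q" using Y(1) that unfolding levy_process_def by blast
    then show ?thesis using Y(2)[OF that] by (simp add: law)
  qed
  ultimately show ?thesis by (intro exI[of _ M] exI[of _ "\<lambda>t \<omega>. Y t (T \<omega>)"]) simp
qed

section \<open>Random integrals\<close>

lemma levy_processD:
  assumes "levy_process M Y"
  shows "prob_space M" "t \<ge> 0 \<Longrightarrow> Y t \<in> borel_measurable M" "\<omega> \<in> space M \<Longrightarrow> Y 0 \<omega> = 0"
    "0 \<le> s 0 \<Longrightarrow> (\<And>i. i < n \<Longrightarrow> s i \<le> s (Suc i)) \<Longrightarrow>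
       prob_space.indep_vars M (\<lambda>_. borel) (\<lambda>i \<omega>. Y (s (Suc i)) \<omega> - Y (s i) \<omega>) {..<n}"
    "u \<ge> 0 \<Longrightarrow> v \<ge> 0 \<Longrightarrow> distr M borel (\<lambda>\<omega>. Y (u + v) \<omega> - Y u \<omega>) = distr M borel (Y v)"
    "\<omega> \<in> space M \<Longrightarrow> t \<ge> 0 \<Longrightarrow> continuous (at_right t) (\<lambda>s. Y s \<omega>)"
    "\<omega> \<in> space M \<Longrightarrow> t > 0 \<Longrightarrow> \<exists>l. ((\<lambda>s. Y s \<omega>) \<longlongrightarrow> l) (at_left t)"
  using assms unfolding levy_process_def by blast+

lemma charfun_weighted_increments:
  assumes L: "levy_process M Y" and t0: "0 \<le> t 0" and t: "\<And>i. i < n \<Longrightarrow> t i \<le> t (Suc i)"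
  shows "charfun (distr M borel (\<lambda>\<omega>. \<Sum>i<n. c i *\<^sub>R (Y (t (Suc i)) \<omega> - Y (t i) \<omega>))) y =
    (\<Prod>i<n. charfun (distr M borel (Y (t (Suc i) - t i))) (c i *\<^sub>R y))"
proof -
  interpret prob_space M by (rule levy_processD(1)[OF L])
  have pos: "i \<le> n \<Longrightarrow> 0 \<le> t i" for i
    by (induction i) (use t0 t in \<open>auto intro: order_trans simp: Suc_le_eq\<close>)
  have meas[measurable]: "i < n \<Longrightarrow> (\<lambda>\<omega>. Y (t (Suc i)) \<omega> - Y (t i) \<omega>) \<in> borel_measurable M" for i
    using levy_processD(2)[OF L pos[of i]] levy_processD(2)[OF L pos[of "Suc i"]] by auto
  have "charfun (distr M borel (\<lambda>\<omega>. \<Sum>i<n. c i *\<^sub>R (Y (t (Suc i)) \<omega> - Y (t i) \<omega>))) y =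
      (CLINT \<omega>|M. (\<Prod>i<n. iexp ((c i *\<^sub>R y) \<bullet> (Y (t (Suc i)) \<omega> - Y (t i) \<omega>))))"
    by (subst charfun_distr)
       (auto simp: inner_sum_right sum_distrib_left exp_sum[symmetric] intro!: Bochner_Integration.integral_cong)
  also have "\<dots> = (\<Prod>i<n. CLINT \<omega>|M. iexp ((c i *\<^sub>R y) \<bullet> (Y (t (Suc i)) \<omega> - Y (t i) \<omega>)))"
  proof (rule indep_vars_lebesgue_integral)
    show "indep_vars (\<lambda>_. borel) (\<lambda>i \<omega>. iexp ((c i *\<^sub>R y) \<bullet> (Y (t (Suc i)) \<omega> - Y (t i) \<omega>))) {..<n}"
      by (rule indep_vars_compose2[OF levy_processD(4)[OF L t0 t]]) auto
    show "complex_integrable M (\<lambda>\<omega>. iexp ((c i *\<^sub>R y) \<bullet> (Y (t (Suc i)) \<omega> - Y (t i) \<omega>)))" if "i \<in> {..<n}" for i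
      using that by (intro complex_integrable_iexp prob_space_axioms) simp
  qed simp
  also have "\<dots> = (\<Prod>i<n. charfun (distr M borel (Y (t (Suc i) - t i))) (c i *\<^sub>R y))"
  proof (rule prod.cong[OF refl])
    fix i assume i: "i \<in> {..<n}"
    then have "distr M borel (Y (t (Suc i) - t i)) = distr M borel (\<lambda>\<omega>. Y (t (Suc i)) \<omega> - Y (t i) \<omega>)"
      using levy_processD(5)[OF L pos[of i], of "t (Suc i) - t i"] t[of i] by simp
    then show "(CLINT \<omega>|M. iexp ((c i *\<^sub>R y) \<bullet> (Y (t (Suc i)) \<omega> - Y (t i) \<omega>))) =
        charfun (distr M borel (Y (t (Suc i) - t i))) (c i *\<^sub>R y)"
      using i by (simp only: charfun_distr[OF meas] lessThan_iff)
  qed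
  finally show ?thesis .
qed

lemma charfun_levy_multiple:
  assumes L: "levy_process M Y" and h: "0 \<le> h"
  shows "charfun (distr M borel (Y (real n * h))) y = charfun (distr M borel (Y h)) y ^ n"
proof -
  interpret prob_space M by (rule levy_processD(1)[OF L])
  have "distr M borel (Y (real n * h)) =
      distr M borel (\<lambda>\<omega>. \<Sum>i<n. 1 *\<^sub>R (Y (real (Suc i) * h) \<omega> - Y (real i * h) \<omega>))"
    using levy_processD(3)[OF L]
    by (intro distr_cong refl) (simp del: of_nat_Suc add: sum_lessThan_telescope[of "\<lambda>i. Y (real i * h) _"])
  also have "charfun \<dots> y = (\<Prod>i<n. charfun (distr M borel (Y (real (Suc i) * h - real i * h))) (1 *\<^sub>R y))"
    using h by (intro charfun_weighted_increments[OF L]) (auto intro: mult_right_mono)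
  finally show ?thesis by (simp add: ring_distribs)
qed

text \<open>At time \<open>1 / 2 ^ n\<close> the law is a root of \<nu>, whose branch
  \<open>charfun_root\<close> determines; multiples give the dyadic times, and right continuity
  gives the rest. Hence every process with law \<nu> at time 1 has the same one-dimensional
  laws.\<close>

lemma charfun_levy:
  fixes Y :: "real \<Rightarrow> 'w \<Rightarrow> real ^ 'd"
  assumes L: "levy_process M Y" and \<nu>: "distr M borel (Y 1) = \<nu>" "\<nu> \<in> ID" and t: "0 \<le> t"
  shows "charfun (distr M borel (Y t)) y = exp (of_real t * log_charfun \<nu> y)"
proof -
  note M = levy_processD(1)[OF L]
  have root: "charfun (distr M borel (Y (1 / 2 ^ n))) y = exp (log_charfun \<nu> y / 2 ^ n)" for n y
  proof -
    have "charfun (distr M borel (Y (1 / 2 ^ n))) y ^ (2 ^ n) = charfun \<nu> y" for y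
      using charfun_levy_multiple[OF L, of "1 / 2 ^ n" "2 ^ n" y] by (simp add: \<nu>(1))
    from charfun_root[OF \<nu>(2) _ _ this] show ?thesis
      using levy_processD(2)[OF L, of "1 / 2 ^ n"] by (simp add: borel_probs_distr[OF M])
  qed
  have "(\<lambda>n. charfun (distr M borel (Y (real (dyadic_above n t) / 2 ^ n))) y) \<longlonglongrightarrow> charfun (distr M borel (Y t)) y"
  proof (rule charfun_AE_limit[OF M])
    have "filterlim (\<lambda>n. real (dyadic_above n t) / 2 ^ n) (at_right t) sequentially"
      by (rule filterlim_mono[OF filterlim_dyadic_above[OF t] at_le order_refl]) auto
    then show "AE \<omega> in M. (\<lambda>n. Y (real (dyadic_above n t) / 2 ^ n) \<omega>) \<longlonglongrightarrow> Y t \<omega>"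
      using levy_processD(6)[OF L _ t, unfolded continuous_within]
      by (intro AE_I2) (rule filterlim_compose)
  qed (use levy_processD(2)[OF L] t in auto)
  moreover have "charfun (distr M borel (Y (real (dyadic_above n t) / 2 ^ n))) y =
      exp (of_real (real (dyadic_above n t) / 2 ^ n) * log_charfun \<nu> y)" for n
    using charfun_levy_multiple[OF L, of "1 / 2 ^ n" "dyadic_above n t" y] by (simp add: root flip: exp_of_nat_mult)
  moreover have "(\<lambda>n. exp (of_real (real (dyadic_above n t) / 2 ^ n) * log_charfun \<nu> y)) \<longlonglongrightarrow> exp (of_real t * log_charfun \<nu> y)"
    by (intro tendsto_intros dyadic_above_tendsto t)
  ultimately show ?thesis by (simp add: LIMSEQ_unique)
qed

text \<open>One-sided limits give local bounds, and compactness of the interval makes finitely many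
  of them suffice.\<close>

lemma cadlag_bounded:
  fixes f :: "real \<Rightarrow> 'a::real_normed_vector"
  assumes right: "\<And>t. 0 \<le> t \<Longrightarrow> continuous (at_right t) f"
    and left: "\<And>t. 0 < t \<Longrightarrow> \<exists>l. (f \<longlongrightarrow> l) (at_left t)"
  shows "\<exists>B. \<forall>t\<in>{0..T}. norm (f t) \<le> B"
proof -
  have loc: "\<exists>d>0. \<exists>B. \<forall>s. dist s t < d \<and> 0 \<le> s \<longrightarrow> norm (f s) \<le> B" if t: "0 \<le> t" for t
  proof -
    have lim: "\<exists>d>0. \<forall>s. s \<in> S \<and> s \<noteq> t \<and> dist s t < d \<longrightarrow> norm (f s) \<le> norm l + 1"
      if "(f \<longlongrightarrow> l) (at t within S)" for l S
    proof -
      have "\<forall>\<^sub>F s in at t within S. norm (f s) < norm l + 1"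
        by (rule order_tendstoD(2)[OF tendsto_norm[OF that]]) simp
      then show ?thesis unfolding eventually_at by (auto intro: less_imp_le)
    qed
    obtain d1 where d1: "d1 > 0" "\<And>s. t < s \<Longrightarrow> dist s t < d1 \<Longrightarrow> norm (f s) \<le> norm (f t) + 1"
      using lim[OF right[OF t, unfolded continuous_within]] by auto
    have "\<exists>d>0. \<exists>B. \<forall>s. 0 \<le> s \<and> s < t \<and> dist s t < d \<longrightarrow> norm (f s) \<le> B"
    proof (cases "t = 0")
      case False
      then obtain l where "(f \<longlongrightarrow> l) (at_left t)" using left[of t] t by auto
      from lim[OF this] show ?thesis by auto
    qed (auto intro: exI[of _ 1])
    then obtain d2 B where d2: "d2 > 0" "\<And>s. 0 \<le> s \<Longrightarrow> s < t \<Longrightarrow> dist s t < d2 \<Longrightarrow> norm (f s) \<le> B" by blast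
    have "norm (f s) \<le> max B (norm (f t) + 1)" if "dist s t < min d1 d2" "0 \<le> s" for s
      using that d1(2)[of s] d2(2)[of s] by (cases s t rule: linorder_cases) (auto simp: max_def)
    then show ?thesis using d1(1) d2(1) by (intro exI[of _ "min d1 d2"]) auto
  qed
  then obtain d B where d: "\<And>t. 0 \<le> t \<Longrightarrow> d t > 0"
    "\<And>t s. 0 \<le> t \<Longrightarrow> dist s t < d t \<Longrightarrow> 0 \<le> s \<Longrightarrow> norm (f s) \<le> B t" by metis
  obtain F where F: "F \<subseteq> {0..T}" "finite F" "{0..T} \<subseteq> (\<Union>t\<in>F. ball t (d t))"
    by (rule compactE_image[of "{0..T}" "{0..T}" "\<lambda>t. ball t (d t)"]) (use d(1) in auto)
  have "norm (f s) \<le> (\<Sum>t\<in>F. max 0 (B t))" if "s \<in> {0..T}" for s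
  proof -
    obtain t where t: "t \<in> F" "dist t s < d t" using F(3) \<open>s \<in> {0..T}\<close> by auto
    then have "norm (f s) \<le> B t" using d(2)[of t s] F(1) that by (auto simp: dist_commute)
    also have "\<dots> \<le> max 0 (B t)" by simp
    also have "\<dots> \<le> (\<Sum>t\<in>F. max 0 (B t))" by (rule member_le_sum[OF t(1)]) (use F in auto)
    finally show ?thesis .
  qed
  then show ?thesis by blast
qed

text \<open>Summation by parts turns the sums with weights \<open>h\<close> at right endpoints into
  boundary terms minus Stieltjes sums of \<open>y\<close> at left endpoints. The latter converge by
  dominated convergence, as a path with one-sided limits is bounded on the unit interval.\<close>

lemma path_integral_LIMSEQ:
  fixes y :: "real \<Rightarrow> real ^ 'd" and h :: "real \<Rightarrow> real"
  assumes right: "\<And>t. 0 \<le> t \<Longrightarrow> continuous (at_right t) y"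
    and left: "\<And>t. 0 < t \<Longrightarrow> \<exists>l. (y \<longlongrightarrow> l) (at_left t)"
    and h: "continuous_on {0..1} h" "\<And>s t. 0 \<le> s \<Longrightarrow> s \<le> t \<Longrightarrow> t \<le> 1 \<Longrightarrow> h s \<le> h t"
  shows "(\<lambda>n. \<Sum>k<Suc n. h (real (Suc k) / real (Suc n)) *\<^sub>R (y (real (Suc k) / real (Suc n)) - y (real k / real (Suc n))))
           \<longlonglongrightarrow> path_integral h (\<lambda>t. t) y"
proof -
  define H where "H t = h (max 0 (min 1 t))" for t
  have H_mono: "H s \<le> H t" if "s \<le> t" for s t unfolding H_def by (rule h(2)) (use that in auto)
  have "continuous_on UNIV H" unfolding H_def
    by (rule continuous_on_compose2[OF h(1)]) (auto intro!: continuous_intros)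
  then have H_cont: "continuous (at_right t) H" for t
    by (simp add: continuous_on_eq_continuous_within continuous_at_imp_continuous_at_within)
  have H_eq: "H t = h t" if "0 \<le> t" "t \<le> 1" for t using that by (simp add: H_def)
  let ?m = "interval_measure H"
  have m: "emeasure ?m {a<..b} = ennreal (H b - H a)" if "a \<le> b" for a b
    by (rule emeasure_interval_measure_Ioc[OF that H_mono H_cont])
  obtain B where "\<forall>t\<in>{0..1}. norm (y t) \<le> B"
    using cadlag_bounded[OF right left, of 1] by blast
  then have B: "\<And>t. 0 \<le> t \<Longrightarrow> t \<le> 1 \<Longrightarrow> norm (y t) \<le> B" by auto
  define x where "x n k = real k / real (Suc n)" for n k
  \<comment> \<open>On each half-open piece the left endpoint is used. It lies strictly below
    \<open>t\<close> even if \<open>t\<close> is a grid point, so the pointwise limit is the left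
    limit of \<open>y\<close>.\<close>
  define s where "s n t = (\<Sum>k<Suc n. indicator {x n k<..x n (Suc k)} t *\<^sub>R y (x n k))" for n t
  have x01: "0 \<le> x n k" "k \<le> Suc n \<Longrightarrow> x n k \<le> 1" "x n k \<le> x n (Suc k)" for n k
    by (auto simp: x_def divide_simps)
  have s_eq: "s n t = indicator {0<..1} t *\<^sub>R y (x n (nat (\<lceil>real (Suc n) * t\<rceil> - 1)))" for n t
  proof -
    have *: "t \<in> {x n k<..x n (Suc k)} \<longleftrightarrow> \<lceil>real (Suc n) * t\<rceil> = int k + 1" for k
      unfolding x_def by (subst ceiling_eq_iff) (auto simp: field_simps)
    show ?thesis
    proof (cases "t \<in> {0<..1}")
      case True
      define k where "k = nat (\<lceil>real (Suc n) * t\<rceil> - 1)"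
      have "0 < \<lceil>real (Suc n) * t\<rceil>" using True by simp
      then have k: "\<lceil>real (Suc n) * t\<rceil> = int k + 1" by (simp add: k_def)
      have "real (Suc n) * t \<le> of_int (int (Suc n))" using True by (simp add: mult_left_le)
      then have "\<lceil>real (Suc n) * t\<rceil> \<le> int (Suc n)" by (rule ceiling_le)
      then have "k < Suc n" using k by simp
      have "s n t = (\<Sum>j<Suc n. if j = k then y (x n k) else 0)"
        unfolding s_def indicator_def * k by (intro sum.cong refl) auto
      also have "\<dots> = y (x n k)" using \<open>k < Suc n\<close> by (subst sum.delta) auto
      finally show ?thesis using True by (simp add: k_def)
    next
      case False
      have "t \<notin> {x n k<..x n (Suc k)}" if "k < Suc n" for k
        using False x01(1)[of n k] x01(2)[of "Suc k" n] that by auto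
      then show ?thesis using False by (simp add: s_def)
    qed
  qed
  define g where "g t = indicator {0<..1} t *\<^sub>R Lim (at_left t) y" for t
  have s_lim: "(\<lambda>n. s n t) \<longlonglongrightarrow> g t" for t
  proof (cases "t \<in> {0<..1}")
    case True
    have b: "x n (nat (\<lceil>real (Suc n) * t\<rceil> - 1)) < t" "t - 1 / real (Suc n) \<le> x n (nat (\<lceil>real (Suc n) * t\<rceil> - 1))" for n
    proof -
      define k where "k = nat (\<lceil>real (Suc n) * t\<rceil> - 1)"
      have "0 < \<lceil>real (Suc n) * t\<rceil>" using True by simp
      then have "real k = of_int \<lceil>real (Suc n) * t\<rceil> - 1" by (simp add: k_def)
      then have "real k < real (Suc n) * t" "real (Suc n) * t \<le> real k + 1" by linarith+
      moreover have "t - 1 / real (Suc n) = (real (Suc n) * t - 1) / real (Suc n)"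
        by (simp add: diff_divide_distrib del: of_nat_Suc)
      ultimately show "x n (nat (\<lceil>real (Suc n) * t\<rceil> - 1)) < t" "t - 1 / real (Suc n) \<le> x n (nat (\<lceil>real (Suc n) * t\<rceil> - 1))"
        unfolding k_def[symmetric] x_def
        by (simp add: field_simps, simp only: divide_right_mono[of "real (Suc n) * t - 1" "real k"] of_nat_0_le_iff)
    qed
    have "(\<lambda>n. x n (nat (\<lceil>real (Suc n) * t\<rceil> - 1))) \<longlonglongrightarrow> t"
    proof (rule tendsto_sandwich[where f="\<lambda>n. t - 1 / real (Suc n)" and h="\<lambda>_. t"])
      have "(\<lambda>n. t - 1 / real (Suc n)) \<longlonglongrightarrow> t - 0"
        by (intro tendsto_intros LIMSEQ_Suc[OF lim_1_over_n])
      then show "(\<lambda>n. t - 1 / real (Suc n)) \<longlonglongrightarrow> t" by simp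
    qed (simp_all add: b less_imp_le[OF b(1)] del: of_nat_Suc)
    then have fl: "filterlim (\<lambda>n. x n (nat (\<lceil>real (Suc n) * t\<rceil> - 1))) (at_left t) sequentially"
      unfolding filterlim_at using b(1) by (auto simp: less_le intro!: always_eventually)
    obtain l where l: "(y \<longlongrightarrow> l) (at_left t)" using left[of t] True by auto
    then have "(\<lambda>n. y (x n (nat (\<lceil>real (Suc n) * t\<rceil> - 1)))) \<longlonglongrightarrow> l"
      by (rule filterlim_compose[OF _ fl])
    moreover have "Lim (at_left t) y = l" using l by (intro tendsto_Lim) auto
    ultimately show ?thesis using True by (simp add: s_eq g_def del: of_nat_Suc)
  qed (simp add: s_eq g_def)
  have s_bound: "norm (s n t) \<le> B * indicator {0<..1} t" for n t
  proof (cases "t \<in> {0<..1}")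
    case True
    have "\<lceil>real (Suc n) * t\<rceil> \<le> int (Suc n)"
      by (rule ceiling_le) (use True in \<open>simp add: mult_left_le\<close>)
    then have "nat (\<lceil>real (Suc n) * t\<rceil> - 1) \<le> Suc n" by simp
    then show ?thesis unfolding s_eq using True by (simp del: of_nat_Suc add: B x01)
  qed (simp add: s_eq)
  have fin: "emeasure ?m {a<..b} < \<infinity>" if "a \<le> b" for a b using m[OF that] by simp
  have s_meas: "s n \<in> borel_measurable ?m" for n unfolding s_def by measurable
  have "(\<lambda>n. \<integral>t. s n t \<partial>?m) \<longlonglongrightarrow> (\<integral>t. g t \<partial>?m)"
  proof (rule integral_dominated_convergence[where w="\<lambda>t. B * indicator {0<..1} t"])
    show "g \<in> borel_measurable ?m" by (rule borel_measurable_LIMSEQ_metric[OF s_meas s_lim])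
    show "integrable ?m (\<lambda>t. B * indicator {0<..1} t)"
      using fin[of 0 1] by (intro integrable_mult_right) (simp add: integrable_real_indicator)
  qed (use s_meas s_lim s_bound in auto)
  moreover have "(\<integral>t. s n t \<partial>?m) = (\<Sum>k<Suc n. (h (x n (Suc k)) - h (x n k)) *\<^sub>R y (x n k))" for n
  proof -
    have "(\<integral>t. s n t \<partial>?m) = (\<Sum>k<Suc n. \<integral>t. indicator {x n k<..x n (Suc k)} t *\<^sub>R y (x n k) \<partial>?m)"
      unfolding s_def using fin[OF x01(3)] by (intro Bochner_Integration.integral_sum integrable_scaleR_left) (simp add: integrable_real_indicator)
    also have "\<dots> = (\<Sum>k<Suc n. (h (x n (Suc k)) - h (x n k)) *\<^sub>R y (x n k))"
    proof (rule sum.cong[OF refl])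
      fix k assume "k \<in> {..<Suc n}"
      then have "measure ?m {x n k<..x n (Suc k)} = h (x n (Suc k)) - h (x n k)"
        using m[OF x01(3)[of n k]] H_mono[OF x01(3)[of n k]] x01
        by (simp add: measure_def H_eq del: of_nat_Suc)
      then show "(\<integral>t. indicator {x n k<..x n (Suc k)} t *\<^sub>R y (x n k) \<partial>?m) = (h (x n (Suc k)) - h (x n k)) *\<^sub>R y (x n k)"
        using fin[OF x01(3)[of n k]] by simp
    qed
    finally show ?thesis .
  qed
  ultimately have "(\<lambda>n. h 1 *\<^sub>R y 1 - h 0 *\<^sub>R y 0 - (\<Sum>k<Suc n. (h (x n (Suc k)) - h (x n k)) *\<^sub>R y (x n k)))
      \<longlonglongrightarrow> h 1 *\<^sub>R y 1 - h 0 *\<^sub>R y 0 - (\<integral>t. g t \<partial>?m)"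
    by (intro tendsto_intros) simp
  moreover have "h 1 *\<^sub>R y 1 - h 0 *\<^sub>R y 0 - (\<Sum>k<Suc n. (h (x n (Suc k)) - h (x n k)) *\<^sub>R y (x n k)) =
     (\<Sum>k<Suc n. h (x n (Suc k)) *\<^sub>R (y (x n (Suc k)) - y (x n k)))" for n
  proof -
    \<comment> \<open>Abel summation: the boundary terms are the telescoped increments of the
      product of \<open>h\<close> and \<open>y\<close>.\<close>
    have "h 1 *\<^sub>R y 1 - h 0 *\<^sub>R y 0 = (\<Sum>k<Suc n. h (x n (Suc k)) *\<^sub>R y (x n (Suc k)) - h (x n k) *\<^sub>R y (x n k))"
      by (subst sum_lessThan_telescope) (simp add: x_def)
    then show ?thesis
      by (simp only: sum_subtractf[symmetric]) (intro sum.cong refl, simp add: algebra_simps)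
  qed
  ultimately show ?thesis
    unfolding path_integral_def set_lebesgue_integral_def x_def g_def H_def by simp
qed

text \<open>Right endpoints are used to match the weighted increments of
  \<open>path_integral_LIMSEQ\<close>.\<close>

lemma integral_riemann_sum_LIMSEQ:
  fixes g :: "real \<Rightarrow> 'a::banach"
  assumes g: "continuous_on {0..1} g"
  shows "(\<lambda>n. \<Sum>k<Suc n. (1 / real (Suc n)) *\<^sub>R g (real (Suc k) / real (Suc n))) \<longlonglongrightarrow> integral {0..1} g"
proof (rule LIMSEQ_I)
  fix r :: real assume "r > 0"
  define e where "e = r / 2"
  have e: "e > 0" "e < r" using \<open>r > 0\<close> by (auto simp: e_def)
  have "uniformly_continuous_on {0..1} g" by (rule compact_uniformly_continuous[OF g]) simp
  then obtain d where d: "d > 0" "\<And>s t. s \<in> {0..1} \<Longrightarrow> t \<in> {0..1} \<Longrightarrow> dist t s < d \<Longrightarrow> dist (g t) (g s) < e"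
    unfolding uniformly_continuous_on_def using e by metis
  obtain N :: nat where N: "1 / real (Suc N) < d"
    using reals_Archimedean[OF d(1)] by (auto simp: inverse_eq_divide)
  show "\<exists>N. \<forall>n\<ge>N. norm ((\<Sum>k<Suc n. (1 / real (Suc n)) *\<^sub>R g (real (Suc k) / real (Suc n))) - integral {0..1} g) < r"
  proof (intro exI[of _ N] allI impI)
    fix n assume "N \<le> n"
    define x where "x k = real k / real (Suc n)" for k
    have step: "x (Suc k) - x k = 1 / real (Suc n)" for k by (simp add: x_def diff_divide_distrib[symmetric])
    have "1 / real (Suc n) \<le> 1 / real (Suc N)" using \<open>N \<le> n\<close> by (intro divide_left_mono) auto
    then have small: "x (Suc k) - x k < d" for k using N step by simp
    have x01: "0 \<le> x k" "k \<le> Suc n \<Longrightarrow> x k \<le> 1" "x k \<le> x (Suc k)" for k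
      by (auto simp: x_def divide_simps)
    have int: "g integrable_on {a..b}" if "0 \<le> a" "b \<le> 1" for a b
      by (rule integrable_continuous_interval[OF continuous_on_subset[OF g]]) (use that in auto)
    have split: "k \<le> Suc n \<Longrightarrow> integral {0..x k} g = (\<Sum>j<k. integral {x j..x (Suc j)} g)" for k
    proof (induction k)
      case (Suc k)
      have "integral {0..x k} g + integral {x k..x (Suc k)} g = integral {0..x (Suc k)} g"
        by (rule Henstock_Kurzweil_Integration.integral_combine) (use x01[of k] x01(2)[of "Suc k"] Suc.prems int in auto)
      then show ?case using Suc by simp
    qed (simp add: x_def)
    have piece: "norm ((1 / real (Suc n)) *\<^sub>R g (x (Suc k)) - integral {x k..x (Suc k)} g) \<le> e * (1 / real (Suc n))"
      if "k < Suc n" for k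
    proof -
      have sub: "{x k..x (Suc k)} \<subseteq> {0..1}" using x01[of k] x01(2)[of "Suc k"] that by auto
      have "((\<lambda>t. g (x (Suc k)) - g t) has_integral ((1 / real (Suc n)) *\<^sub>R g (x (Suc k)) - integral {x k..x (Suc k)} g)) {x k..x (Suc k)}"
        using has_integral_const_real[of "g (x (Suc k))" "x k" "x (Suc k)"] step[of k] x01(3)[of k]
        by (intro has_integral_diff integrable_integral int) (use sub x01[of k] x01(2)[of "Suc k"] that in \<open>auto simp del: of_nat_Suc\<close>)
      then have "norm ((1 / real (Suc n)) *\<^sub>R g (x (Suc k)) - integral {x k..x (Suc k)} g) \<le> e * measure lborel {x k..x (Suc k)}"
      proof (rule has_integral_bound_real[where S="{}", rotated 2])
        show "0 \<le> e" using e by simp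
        fix t assume "t \<in> {x k..x (Suc k)} - {}"
        then have t: "t \<in> {x k..x (Suc k)}" by simp
        then have "dist (x (Suc k)) t < d" using small[of k] by (auto simp: dist_real_def)
        moreover have "x (Suc k) \<in> {0..1}" "t \<in> {0..1}" using t sub x01(3)[of k] by auto
        ultimately show "norm (g (x (Suc k)) - g t) \<le> e"
          using d(2)[of t "x (Suc k)"] by (simp add: dist_norm)
      qed simp
      then show ?thesis using step[of k] x01(3)[of k] by (simp del: of_nat_Suc)
    qed
    have "norm ((\<Sum>k<Suc n. (1 / real (Suc n)) *\<^sub>R g (x (Suc k))) - integral {0..1} g) =
        norm (\<Sum>k<Suc n. (1 / real (Suc n)) *\<^sub>R g (x (Suc k)) - integral {x k..x (Suc k)} g)"
      using split[of "Suc n"] by (simp only: sum_subtractf) (simp add: x_def)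
    also have "\<dots> \<le> (\<Sum>k<Suc n. e * (1 / real (Suc n)))"
      by (intro order_trans[OF norm_sum] sum_mono piece) simp
    also have "\<dots> = e" by (simp add: field_simps)
    finally show "norm ((\<Sum>k<Suc n. (1 / real (Suc n)) *\<^sub>R g (real (Suc k) / real (Suc n))) - integral {0..1} g) < r"
      using e by (simp add: x_def)
  qed
qed

section \<open>The factorization\<close>

definition radial_mean :: "real \<Rightarrow> (real ^ 'd \<Rightarrow> complex) \<Rightarrow> real ^ 'd \<Rightarrow> complex" where
  "radial_mean \<beta> \<psi> y = integral {0..1} (\<lambda>t. \<psi> (t powr (1 / \<beta>) *\<^sub>R y))"

lemma continuous_on_powr_nonneg:
  assumes "0 < p" shows "continuous_on {0..} (\<lambda>t::real. t powr p)"
  by (rule continuous_on_powr') (use assms in \<open>auto intro!: continuous_intros\<close>)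

lemma continuous_radial_integrand:
  fixes \<psi> :: "real ^ 'd \<Rightarrow> complex"
  assumes "continuous_on UNIV \<psi>" "0 < \<beta>"
  shows "continuous_on {0..} (\<lambda>t. \<psi> (t powr (1 / \<beta>) *\<^sub>R y))"
proof (rule continuous_on_compose2[OF assms(1)])
  have "continuous_on {0..} (\<lambda>t::real. t powr (1 / \<beta>))"
    using assms(2) by (intro continuous_on_powr_nonneg) simp
  then show "continuous_on {0..} (\<lambda>t. t powr (1 / \<beta>) *\<^sub>R y)"
    by (rule continuous_on_scaleR[OF _ continuous_on_const])
qed simp

lemma continuous_radial_mean:
  fixes \<psi> :: "real ^ 'd \<Rightarrow> complex"
  assumes "continuous_on UNIV \<psi>" "0 < \<beta>"
  shows "continuous_on UNIV (radial_mean \<beta> \<psi>)"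
proof -
  have "continuous_on (UNIV \<times> {0..1}) (\<lambda>z. \<psi> (snd z powr (1 / \<beta>) *\<^sub>R fst z))"
  proof (rule continuous_on_compose2[OF assms(1)])
    have "continuous_on (UNIV \<times> {0..1}) (\<lambda>z :: (real ^ 'd) \<times> real. snd z powr (1 / \<beta>))"
      by (rule continuous_on_compose2[OF continuous_on_powr_nonneg[of "1 / \<beta>"]])
         (use assms(2) in \<open>auto intro!: continuous_intros\<close>)
    then show "continuous_on (UNIV \<times> {0..1}) (\<lambda>z :: (real ^ 'd) \<times> real. snd z powr (1 / \<beta>) *\<^sub>R fst z)"
      by (intro continuous_on_scaleR continuous_on_fst continuous_on_id)
  qed simp
  then show ?thesis
    unfolding radial_mean_def[abs_def]
    using integral_continuous_on_param[of UNIV 0 1 "\<lambda>y t. \<psi> (t powr (1 / \<beta>) *\<^sub>R y)"]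
    by (simp add: split_beta)
qed

lemma radial_mean_0: "\<psi> 0 = 0 \<Longrightarrow> radial_mean \<beta> \<psi> 0 = 0"
  by (simp add: radial_mean_def)

lemma radial_mean_cmult: "radial_mean \<beta> (\<lambda>y. c * \<psi> y) y = c * radial_mean \<beta> \<psi> y"
  by (simp add: radial_mean_def)

lemma radial_mean_scale:
  fixes \<psi> :: "real ^ 'd \<Rightarrow> complex"
  assumes "continuous_on UNIV \<psi>" "0 < \<beta>" "0 < v"
  shows "of_real v * radial_mean \<beta> \<psi> (v powr (1 / \<beta>) *\<^sub>R y) = integral {0..v} (\<lambda>u. \<psi> (u powr (1 / \<beta>) *\<^sub>R y))"
proof -
  let ?f = "\<lambda>u. \<psi> (u powr (1 / \<beta>) *\<^sub>R y)"
  have "(?f has_integral integral {0..v} ?f) {0..v}"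
    by (intro integrable_integral integrable_continuous_interval
        continuous_on_subset[OF continuous_radial_integrand[OF assms(1,2)]]) auto
  from has_integral_stretch_real[OF this, of v]
  have "((\<lambda>t. ?f (v * t)) has_integral (1 / v) *\<^sub>R integral {0..v} ?f) {0..1}"
    using assms(3) image_divide_atLeastAtMost[of v 0 v] by simp
  moreover have "((\<lambda>t. \<psi> (t powr (1 / \<beta>) *\<^sub>R (v powr (1 / \<beta>) *\<^sub>R y))) has_integral i) {0..1} \<longleftrightarrow>
      ((\<lambda>t. ?f (v * t)) has_integral i) {0..1}" for i
    by (intro has_integral_cong) (use assms(3) in \<open>simp add: powr_mult mult.commute\<close>)
  ultimately have "radial_mean \<beta> \<psi> (v powr (1 / \<beta>) *\<^sub>R y) = (1 / v) *\<^sub>R integral {0..v} ?f"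
    unfolding radial_mean_def by (intro integral_unique) blast
  then show ?thesis using assms(3) by (simp add: scaleR_conv_of_real[where 'a=complex])
qed

text \<open>Although \<psi> is merely continuous, its mean is differentiable along rays: the radius
  moves into the upper limit of integration and into a factor \<open>s powr (- \<beta>)\<close>, so
  the fundamental theorem and the product rule apply.\<close>

lemma radial_mean_deriv_1:
  fixes \<psi> :: "real ^ 'd \<Rightarrow> complex"
  assumes \<psi>: "continuous_on UNIV \<psi>" and \<beta>: "0 < \<beta>"
  shows "((\<lambda>s. radial_mean \<beta> \<psi> (s *\<^sub>R y)) has_vector_derivative of_real \<beta> * (\<psi> y - radial_mean \<beta> \<psi> y)) (at 1)"
proof -
  let ?f = "\<lambda>u. \<psi> (u powr (1 / \<beta>) *\<^sub>R y)"
  have "((\<lambda>v. integral {0..v} ?f) has_vector_derivative ?f 1) (at 1 within {0..2})"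
    by (rule integral_has_vector_derivative[OF continuous_on_subset[OF continuous_radial_integrand[OF \<psi> \<beta>]]]) auto
  then have I: "((\<lambda>v. integral {0..v} ?f) has_vector_derivative \<psi> y) (at 1)"
    by (simp add: at_within_Icc_at[of 0 1 2])
  have p: "((\<lambda>s. s powr c) has_vector_derivative c) (at 1)" for c :: real
    using DERIV_fun_powr[OF DERIV_ident, of 1 c]
    by (simp add: has_real_derivative_iff_has_vector_derivative)
  have "((\<lambda>v. integral {0..v} ?f) has_vector_derivative \<psi> y) (at (1 powr \<beta>))" using I by simp
  from vector_diff_chain_at[OF p this]
  have "((\<lambda>s. integral {0..s powr \<beta>} ?f) has_vector_derivative \<beta> *\<^sub>R \<psi> y) (at 1)"
    by (simp add: comp_def)
  from has_vector_derivative_scaleR[OF p[of "- \<beta>", folded has_real_derivative_iff_has_vector_derivative] this]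
  have "((\<lambda>s. s powr (- \<beta>) *\<^sub>R integral {0..s powr \<beta>} ?f) has_vector_derivative
      of_real \<beta> * (\<psi> y - radial_mean \<beta> \<psi> y)) (at 1)"
    by (simp add: radial_mean_def scaleR_conv_of_real[where 'a=complex] algebra_simps)
  then show ?thesis
  proof (rule has_vector_derivative_transform_within_open[where S="{0<..}"])
    fix s :: real assume s: "s \<in> {0<..}"
    have "of_real (s powr \<beta>) * radial_mean \<beta> \<psi> (s *\<^sub>R y) = integral {0..s powr \<beta>} ?f"
      using radial_mean_scale[OF \<psi> \<beta>, of "s powr \<beta>" y] s \<beta> by (simp add: powr_powr)
    then show "s powr (- \<beta>) *\<^sub>R integral {0..s powr \<beta>} ?f = radial_mean \<beta> \<psi> (s *\<^sub>R y)"
      using s by (simp add: scaleR_conv_of_real[where 'a=complex] powr_minus field_simps flip: of_real_mult)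
  qed auto
qed

lemma radial_mean_deriv:
  fixes \<psi> :: "real ^ 'd \<Rightarrow> complex"
  assumes \<psi>: "continuous_on UNIV \<psi>" and \<beta>: "0 < \<beta>" and s: "0 < s"
  shows "((\<lambda>s. radial_mean \<beta> \<psi> (s *\<^sub>R y)) has_vector_derivative
     (\<beta> / s) *\<^sub>R (\<psi> (s *\<^sub>R y) - radial_mean \<beta> \<psi> (s *\<^sub>R y))) (at s)"
proof -
  have d: "((\<lambda>u. u / s) has_vector_derivative 1 / s) (at s)"
    using DERIV_cdivide[OF DERIV_ident, of s s] by (simp add: has_real_derivative_iff_has_vector_derivative)
  have "((\<lambda>u. radial_mean \<beta> \<psi> (u *\<^sub>R (s *\<^sub>R y))) has_vector_derivative
      of_real \<beta> * (\<psi> (s *\<^sub>R y) - radial_mean \<beta> \<psi> (s *\<^sub>R y))) (at (s / s))"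
    using radial_mean_deriv_1[OF \<psi> \<beta>, of "s *\<^sub>R y"] s by simp
  from vector_diff_chain_at[OF d this] show ?thesis
    using s by (simp add: comp_def scaleR_conv_of_real[where 'a=complex])
qed

text \<open>
  For the converse, the factorization makes \<open>s powr \<beta>\<close> times the difference of the two means at \<open>s *\<^sub>R y\<close>
  constant in \<open>s\<close>; it vanishes at \<open>s = 0\<close>.
\<close>

lemma radial_mean_eq_iff:
  fixes \<phi> \<psi> :: "real ^ 'd \<Rightarrow> complex"
  assumes \<phi>: "continuous_on UNIV \<phi>" and \<psi>: "continuous_on UNIV \<psi>" and \<alpha>: "0 < \<alpha>" and \<beta>: "0 < \<beta>"
  shows "radial_mean \<beta> \<phi> = radial_mean \<alpha> \<psi> \<longleftrightarrow>
    (\<forall>y. \<phi> y = of_real (1 - \<alpha> / \<beta>) * radial_mean \<alpha> \<psi> y + of_real (\<alpha> / \<beta>) * \<psi> y)"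
proof -
  have alg: "of_real \<beta> * (p - F) = of_real \<alpha> * (q - F) \<longleftrightarrow> p = of_real (1 - \<alpha> / \<beta>) * F + of_real (\<alpha> / \<beta>) * q"
    for p q F :: complex
    using \<beta> by (simp add: field_simps)
  show ?thesis
  proof
    assume eq: "radial_mean \<beta> \<phi> = radial_mean \<alpha> \<psi>"
    show "\<forall>y. \<phi> y = of_real (1 - \<alpha> / \<beta>) * radial_mean \<alpha> \<psi> y + of_real (\<alpha> / \<beta>) * \<psi> y"
    proof
      fix y
      have "of_real \<beta> * (\<phi> y - radial_mean \<alpha> \<psi> y) = of_real \<alpha> * (\<psi> y - radial_mean \<alpha> \<psi> y)"
        using vector_derivative_unique_at[OF radial_mean_deriv_1[OF \<phi> \<beta>, of y, unfolded eq] radial_mean_deriv_1[OF \<psi> \<alpha>, of y]] .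
      then show "\<phi> y = of_real (1 - \<alpha> / \<beta>) * radial_mean \<alpha> \<psi> y + of_real (\<alpha> / \<beta>) * \<psi> y"
        by (simp only: alg)
    qed
  next
    assume fact: "\<forall>y. \<phi> y = of_real (1 - \<alpha> / \<beta>) * radial_mean \<alpha> \<psi> y + of_real (\<alpha> / \<beta>) * \<psi> y"
    show "radial_mean \<beta> \<phi> = radial_mean \<alpha> \<psi>"
    proof
      fix y
      define D where "D s = radial_mean \<beta> \<phi> (s *\<^sub>R y) - radial_mean \<alpha> \<psi> (s *\<^sub>R y)" for s
      have D': "(D has_vector_derivative (- (\<beta> / s)) *\<^sub>R D s) (at s)" if "0 < s" for s
      proof -
        \<comment> \<open>Writing G for the \<alpha>-mean of \<psi>, the factorization replaces
          \<alpha> (\<psi> - G) by \<beta> (\<phi> - G). The function \<phi> then cancels from the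
          derivative of \<open>D\<close> and only a multiple of \<open>D\<close> remains.\<close>
        have *: "of_real \<beta> * (\<phi> (s *\<^sub>R y) - radial_mean \<alpha> \<psi> (s *\<^sub>R y)) = of_real \<alpha> * (\<psi> (s *\<^sub>R y) - radial_mean \<alpha> \<psi> (s *\<^sub>R y))"
          unfolding alg using fact by blast
        have "(\<beta> / s) *\<^sub>R (\<phi> (s *\<^sub>R y) - radial_mean \<beta> \<phi> (s *\<^sub>R y)) - (\<alpha> / s) *\<^sub>R (\<psi> (s *\<^sub>R y) - radial_mean \<alpha> \<psi> (s *\<^sub>R y)) =
          (1 / s) *\<^sub>R (of_real \<beta> * (\<phi> (s *\<^sub>R y) - radial_mean \<beta> \<phi> (s *\<^sub>R y)) - of_real \<alpha> * (\<psi> (s *\<^sub>R y) - radial_mean \<alpha> \<psi> (s *\<^sub>R y)))"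
          by (simp add: scaleR_conv_of_real[where 'a=complex] algebra_simps)
        also have "\<dots> = (- (\<beta> / s)) *\<^sub>R D s"
          unfolding *[symmetric] D_def by (simp add: scaleR_conv_of_real[where 'a=complex] algebra_simps)
        finally show ?thesis
          unfolding D_def
          using has_vector_derivative_diff[OF radial_mean_deriv[OF \<phi> \<beta> that, of y] radial_mean_deriv[OF \<psi> \<alpha> that, of y]]
          by simp
      qed
      \<comment> \<open>The point 0 is excepted from differentiation; there continuity is enough,
        and the factor \<open>s powr \<beta>\<close> supplies the initial value 0.\<close>
      have "1 powr \<beta> *\<^sub>R D 1 = 0"
      proof (rule has_derivative_zero_unique_strong_interval[of "{0}" 0 1 "\<lambda>s. s powr \<beta> *\<^sub>R D s"])
        have "continuous_on {0..1} D"
          unfolding D_def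
          by (intro continuous_intros continuous_on_compose2[OF continuous_radial_mean[OF \<phi> \<beta>]]
              continuous_on_compose2[OF continuous_radial_mean[OF \<psi> \<alpha>]]) auto
        then show "continuous_on {0..1} (\<lambda>s. s powr \<beta> *\<^sub>R D s)"
          by (intro continuous_intros continuous_on_subset[OF continuous_on_powr_nonneg[OF \<beta>]]) auto
        show "0 powr \<beta> *\<^sub>R D 0 = 0" by simp
        fix s :: real assume "s \<in> {0..1} - {0}"
        then have s: "0 < s" by simp
        have "((\<lambda>s. s powr \<beta>) has_real_derivative \<beta> * s powr (\<beta> - 1)) (at s)"
          using DERIV_fun_powr[OF DERIV_ident s, of \<beta>] by simp
        from has_vector_derivative_scaleR[OF this D'[OF s]]
        have "((\<lambda>s. s powr \<beta> *\<^sub>R D s) has_vector_derivative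
            s powr \<beta> *\<^sub>R ((- (\<beta> / s)) *\<^sub>R D s) + (\<beta> * s powr (\<beta> - 1)) *\<^sub>R D s) (at s)" .
        also have "s powr \<beta> *\<^sub>R ((- (\<beta> / s)) *\<^sub>R D s) + (\<beta> * s powr (\<beta> - 1)) *\<^sub>R D s = 0"
          using s by (simp add: powr_diff flip: scaleR_left.add)
        finally show "((\<lambda>s. s powr \<beta> *\<^sub>R D s) has_derivative (\<lambda>h. 0)) (at s within {0..1})"
          by (auto simp: has_vector_derivative_def intro: has_derivative_at_withinI)
      qed auto
      then show "radial_mean \<beta> \<phi> y = radial_mean \<alpha> \<psi> y" by (simp add: D_def)
    qed
  qed
qed

section \<open>Logarithms of powers, convolutions and \<open>J\<close>\<close>

lemma ex_levy_process_with_law: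
  fixes \<nu> :: "(real ^ 'd) measure"
  assumes "\<nu> \<in> ID"
  obtains M :: "(real \<Rightarrow> real ^ 'd) measure" and Y where "levy_process M Y" "distr M borel (Y 1) = \<nu>"
proof -
  obtain M :: "(real \<Rightarrow> real ^ 'd) measure" and Y where L: "levy_process M Y"
    and cf: "\<And>t y. t \<ge> 0 \<Longrightarrow> charfun (distr M borel (Y t)) y = exp (of_real t * log_charfun \<nu> y)"
    using ex_levy_process_path_space[OF assms] by blast
  have "distr M borel (Y 1) = \<nu>"
    using assms levy_processD(1,2)[OF L]
    by (intro charfun_unique borel_probs_distr) (auto simp: ID_iff_charfun cf log_charfun_ID(3)[OF assms])
  with L that show thesis by blast
qed

lemma ID_eqI:
  fixes \<mu> \<nu> :: "(real ^ 'd) measure"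
  assumes "\<mu> \<in> ID" "\<nu> \<in> ID" "\<And>y. log_charfun \<mu> y = log_charfun \<nu> y"
  shows "\<mu> = \<nu>"
  using assms(1,2) log_charfun_ID(3)[OF assms(1)] log_charfun_ID(3)[OF assms(2)] assms(3)
  by (metis ID_iff_charfun charfun_unique)

text \<open>The power with exponent \<open>c\<close> is the law at time \<open>c\<close> of a Levy
  process with law \<nu> at time 1. Cutting the time \<open>c\<close> into \<open>n\<close> equal
  parts shows that this law is again infinitely divisible.\<close>

lemma convolution_powr_ID:
  fixes \<nu> :: "(real ^ 'd) measure"
  assumes \<nu>: "\<nu> \<in> ID" and c: "0 \<le> c"
  shows "convolution_powr \<nu> c \<in> ID" "log_charfun (convolution_powr \<nu> c) = (\<lambda>y. of_real c * log_charfun \<nu> y)"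
proof -
  obtain M :: "(real \<Rightarrow> real ^ 'd) measure" and Y where L: "levy_process M Y" and 1: "distr M borel (Y 1) = \<nu>"
    by (rule ex_levy_process_with_law[OF \<nu>])
  note cf = charfun_levy[OF L 1 \<nu>]
  have bp: "distr M borel (Y t) \<in> borel_probs" if "0 \<le> t" for t
    using levy_processD(1,2)[OF L] that by (intro borel_probs_distr) auto
  have eq: "convolution_powr \<nu> c = distr M borel (Y c)"
    unfolding convolution_powr_def
    by (rule the_equality) (use cf[OF c] bp[OF c] in \<open>auto intro: charfun_unique\<close>)
  show "convolution_powr \<nu> c \<in> ID"
    unfolding ID_iff_charfun eq
  proof (intro conjI allI impI bp c)
    fix n :: nat assume n: "n \<ge> 1"
    have "charfun (distr M borel (Y (c / n))) y ^ n = charfun (distr M borel (Y c)) y" for y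
      using charfun_levy_multiple[OF L, of "c / n" n y] c n by simp
    then show "\<exists>\<kappa>\<in>borel_probs. \<forall>y. charfun \<kappa> y ^ n = charfun (distr M borel (Y c)) y"
      using bp[of "c / n"] c by auto
  qed
  show "log_charfun (convolution_powr \<nu> c) = (\<lambda>y. of_real c * log_charfun \<nu> y)"
    by (rule log_charfun_eqI) (use log_charfun_ID[OF \<nu>] in \<open>auto intro!: continuous_intros simp: eq cf[OF c]\<close>)
qed

lemma convolution_ID:
  fixes \<mu> \<nu> :: "(real ^ 'd) measure"
  assumes \<mu>: "\<mu> \<in> ID" and \<nu>: "\<nu> \<in> ID"
  shows "(\<mu> \<star> \<nu>) \<in> ID" "log_charfun (\<mu> \<star> \<nu>) = (\<lambda>y. log_charfun \<mu> y + log_charfun \<nu> y)"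
proof -
  have bp: "\<mu> \<in> borel_probs" "\<nu> \<in> borel_probs" using assms by (auto simp: ID_iff_charfun)
  show "(\<mu> \<star> \<nu>) \<in> ID"
    unfolding ID_iff_charfun
  proof (intro conjI allI impI convolution_borel_probs bp)
    fix n :: nat assume n: "n \<ge> 1"
    obtain \<kappa> \<kappa>' where \<kappa>: "\<kappa> \<in> borel_probs" "\<forall>y. charfun \<kappa> y ^ n = charfun \<mu> y"
      and \<kappa>': "\<kappa>' \<in> borel_probs" "\<forall>y. charfun \<kappa>' y ^ n = charfun \<nu> y"
      using \<mu> \<nu> n unfolding ID_iff_charfun by blast
    show "\<exists>\<kappa>\<in>borel_probs. \<forall>y. charfun \<kappa> y ^ n = charfun (\<mu> \<star> \<nu>) y"
      by (rule bexI[of _ "\<kappa> \<star> \<kappa>'"])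
         (use \<kappa> \<kappa>' bp in \<open>auto simp: charfun_convolution power_mult_distrib convolution_borel_probs\<close>)
  qed
  show "log_charfun (\<mu> \<star> \<nu>) = (\<lambda>y. log_charfun \<mu> y + log_charfun \<nu> y)"
    by (rule log_charfun_eqI)
       (use log_charfun_ID[OF \<mu>] log_charfun_ID[OF \<nu>] bp in \<open>auto intro!: continuous_intros simp: exp_add charfun_convolution\<close>)
qed

text \<open>Independent stationary increments make the exponent of each approximating sum a Riemann
  sum of the integrand in \<open>radial_mean\<close>.\<close>

lemma charfun_path_integral:
  fixes Y :: "real \<Rightarrow> 'w \<Rightarrow> real ^ 'd"
  assumes L: "levy_process M Y" and 1: "distr M borel (Y 1) = \<nu>" and \<nu>: "\<nu> \<in> ID" and \<beta>: "0 < \<beta>"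
  defines "Z \<equiv> \<lambda>\<omega>. path_integral (\<lambda>t. t powr (1 / \<beta>)) (\<lambda>t. t) (\<lambda>t. Y t \<omega>)"
  shows "Z \<in> borel_measurable M" "charfun (distr M borel Z) y = exp (radial_mean \<beta> (log_charfun \<nu>) y)"
proof -
  interpret prob_space M by (rule levy_processD(1)[OF L])
  define h where "h t = t powr (1 / \<beta>)" for t :: real
  define W where "W n \<omega> = (\<Sum>k<Suc n. h (real (Suc k) / real (Suc n)) *\<^sub>R (Y (real (Suc k) / real (Suc n)) \<omega> - Y (real k / real (Suc n)) \<omega>))" for n \<omega>
  have W_lim: "(\<lambda>n. W n \<omega>) \<longlonglongrightarrow> Z \<omega>" if "\<omega> \<in> space M" for \<omega>
    unfolding W_def Z_def h_def
    by (rule path_integral_LIMSEQ)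
       (use levy_processD(6,7)[OF L that] \<beta> in
         \<open>auto intro!: continuous_on_subset[OF continuous_on_powr_nonneg] powr_mono2\<close>)
  have W_meas: "W n \<in> borel_measurable M" for n
    unfolding W_def by (intro borel_measurable_sum borel_measurable_scaleR borel_measurable_diff levy_processD(2)[OF L]) auto
  show Z_meas: "Z \<in> borel_measurable M"
    by (rule borel_measurable_LIMSEQ_metric[OF W_meas W_lim])
  have "charfun (distr M borel (W n)) y =
      exp (\<Sum>k<Suc n. (1 / real (Suc n)) *\<^sub>R log_charfun \<nu> (h (real (Suc k) / real (Suc n)) *\<^sub>R y))" for n
  proof -
    have "charfun (distr M borel (W n)) y =
        (\<Prod>k<Suc n. charfun (distr M borel (Y (real (Suc k) / real (Suc n) - real k / real (Suc n)))) (h (real (Suc k) / real (Suc n)) *\<^sub>R y))"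
      unfolding W_def by (rule charfun_weighted_increments[OF L]) (auto intro: divide_right_mono)
    also have "\<dots> = (\<Prod>k<Suc n. exp ((1 / real (Suc n)) *\<^sub>R log_charfun \<nu> (h (real (Suc k) / real (Suc n)) *\<^sub>R y)))"
    proof (rule prod.cong[OF refl])
      fix k
      have "real (Suc k) / real (Suc n) - real k / real (Suc n) = 1 / real (Suc n)"
        by (simp add: diff_divide_distrib[symmetric])
      then show "charfun (distr M borel (Y (real (Suc k) / real (Suc n) - real k / real (Suc n)))) (h (real (Suc k) / real (Suc n)) *\<^sub>R y) =
          exp ((1 / real (Suc n)) *\<^sub>R log_charfun \<nu> (h (real (Suc k) / real (Suc n)) *\<^sub>R y))"
        by (simp only: charfun_levy[OF L 1 \<nu>, of "1 / real (Suc n)"] zero_le_divide_1_iff of_nat_0_le_iff scaleR_conv_of_real[where 'a=complex])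
    qed
    finally show ?thesis by (simp only: exp_sum[OF finite_lessThan])
  qed
  moreover have "(\<lambda>n. exp (\<Sum>k<Suc n. (1 / real (Suc n)) *\<^sub>R log_charfun \<nu> (h (real (Suc k) / real (Suc n)) *\<^sub>R y)))
      \<longlonglongrightarrow> exp (radial_mean \<beta> (log_charfun \<nu>) y)"
    unfolding radial_mean_def h_def
    by (intro tendsto_exp integral_riemann_sum_LIMSEQ
        continuous_on_subset[OF continuous_radial_integrand[OF log_charfun_ID(1)[OF \<nu>] \<beta>]]) auto
  ultimately have "(\<lambda>n. charfun (distr M borel (W n)) y) \<longlonglongrightarrow> exp (radial_mean \<beta> (log_charfun \<nu>) y)"
    by simp
  moreover have "(\<lambda>n. charfun (distr M borel (W n)) y) \<longlonglongrightarrow> charfun (distr M borel Z) y"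
    by (rule charfun_AE_limit[OF prob_space_axioms W_meas Z_meas AE_I2[OF W_lim]])
  ultimately show "charfun (distr M borel Z) y = exp (radial_mean \<beta> (log_charfun \<nu>) y)"
    by (rule LIMSEQ_unique[rotated])
qed

text \<open>The characteristic function of the integral depends on \<nu> alone and not on the chosen
  process, so the description defining \<open>J\<close> has exactly one solution.\<close>

lemma charfun_J:
  fixes \<nu> :: "(real ^ 'd) measure"
  assumes \<nu>: "\<nu> \<in> ID" and \<beta>: "0 < \<beta>"
  shows "J \<beta> \<nu> \<in> borel_probs" "charfun (J \<beta> \<nu>) y = exp (radial_mean \<beta> (log_charfun \<nu>) y)"
proof -
  let ?P = "\<lambda>\<mu>. \<exists>(M :: (real \<Rightarrow> real ^ 'd) measure) Y. levy_process M Y \<and> distr M borel (Y 1) = \<nu> \<and>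
       \<mu> = distr M borel (\<lambda>\<omega>. path_integral (\<lambda>t. t powr (1 / \<beta>)) (\<lambda>t. t) (\<lambda>t. Y t \<omega>))"
  have P: "\<mu> \<in> borel_probs \<and> (\<forall>y. charfun \<mu> y = exp (radial_mean \<beta> (log_charfun \<nu>) y))" if \<mu>: "?P \<mu>" for \<mu>
  proof -
    obtain M :: "(real \<Rightarrow> real ^ 'd) measure" and Y where L: "levy_process M Y" and 1: "distr M borel (Y 1) = \<nu>"
      and \<mu>': "\<mu> = distr M borel (\<lambda>\<omega>. path_integral (\<lambda>t. t powr (1 / \<beta>)) (\<lambda>t. t) (\<lambda>t. Y t \<omega>))"
      using \<mu> by blast
    show ?thesis
      unfolding \<mu>' using charfun_path_integral[OF L 1 \<nu> \<beta>] levy_processD(1)[OF L] by (auto intro: borel_probs_distr)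
  qed
  obtain M :: "(real \<Rightarrow> real ^ 'd) measure" and Y where "levy_process M Y" "distr M borel (Y 1) = \<nu>"
    by (rule ex_levy_process_with_law[OF \<nu>])
  then have ex: "\<exists>\<mu>. ?P \<mu>" by blast
  have unique: "\<mu> = \<mu>'" if "?P \<mu>" "?P \<mu>'" for \<mu> \<mu>'
    using P[OF that(1)] P[OF that(2)] by (intro charfun_unique) auto
  have "?P (J \<beta> \<nu>)" unfolding J_def by (rule theI') (rule ex_ex1I[OF ex unique])
  from P[OF this] show "J \<beta> \<nu> \<in> borel_probs" "charfun (J \<beta> \<nu>) y = exp (radial_mean \<beta> (log_charfun \<nu>) y)"
    by auto
qed

lemma log_charfun_J:
  fixes \<nu> :: "(real ^ 'd) measure"
  assumes \<nu>: "\<nu> \<in> ID" and \<beta>: "0 < \<beta>"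
  shows "log_charfun (J \<beta> \<nu>) = radial_mean \<beta> (log_charfun \<nu>)"
  by (rule log_charfun_eqI)
     (use charfun_J[OF assms] log_charfun_ID[OF \<nu>] \<beta> in \<open>auto intro: continuous_radial_mean radial_mean_0\<close>)

text \<open>By linearity of the radial mean, \<open>J \<beta>\<close> maps the power of \<nu> with
  exponent \<open>1 / n\<close> to a root of order \<open>n\<close> of
  \<open>J \<beta> \<nu>\<close>.\<close>

lemma J_ID:
  fixes \<nu> :: "(real ^ 'd) measure"
  assumes \<nu>: "\<nu> \<in> ID" and \<beta>: "0 < \<beta>"
  shows "J \<beta> \<nu> \<in> ID"
  unfolding ID_iff_charfun
proof (intro conjI allI impI charfun_J(1)[OF assms])
  fix n :: nat assume n: "n \<ge> 1"
  let ?\<kappa> = "convolution_powr \<nu> (1 / n)"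
  have \<kappa>: "?\<kappa> \<in> ID" "log_charfun ?\<kappa> = (\<lambda>y. of_real (1 / n) * log_charfun \<nu> y)"
    using convolution_powr_ID[OF \<nu>, of "1 / n"] by auto
  have "charfun (J \<beta> ?\<kappa>) y = exp (of_real (1 / n) * radial_mean \<beta> (log_charfun \<nu>) y)" for y
    by (simp only: charfun_J(2)[OF \<kappa>(1) \<beta>] \<kappa>(2) radial_mean_cmult)
  then have "charfun (J \<beta> ?\<kappa>) y ^ n = charfun (J \<beta> \<nu>) y" for y
    using n by (simp add: charfun_J(2)[OF \<nu> \<beta>] flip: exp_of_nat_mult)
  then show "\<exists>\<kappa>\<in>borel_probs. \<forall>y. charfun \<kappa> y ^ n = charfun (J \<beta> \<nu>) y"
    using charfun_J(1)[OF \<kappa>(1) \<beta>] by blast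
qed

theorem corollary2:
  fixes \<alpha> \<beta> :: real and \<rho> :: "(real ^ 'd) measure"
  assumes "0 < \<alpha>" and "\<alpha> < \<beta>" and "\<rho> \<in> ID"
  shows "(J \<beta> \<rho> \<in> U \<alpha> \<longleftrightarrow>
            (\<exists>\<nu>\<in>ID. \<rho> = (J \<alpha> (convolution_powr \<nu> (1 - \<alpha> / \<beta>)) \<star> convolution_powr \<nu> (\<alpha> / \<beta>))))
       \<and> (\<forall>\<nu>\<in>(ID :: (real ^ 'd) measure set).
            (J \<alpha> (convolution_powr \<nu> (1 - \<alpha> / \<beta>)) \<star> convolution_powr \<nu> (\<alpha> / \<beta>))
            = (convolution_powr (J \<alpha> \<nu>) (1 - \<alpha> / \<beta>) \<star> convolution_powr \<nu> (\<alpha> / \<beta>)))"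
proof -
  have \<beta>: "0 < \<beta>" and c: "0 \<le> 1 - \<alpha> / \<beta>" "0 \<le> \<alpha> / \<beta>" using assms(1,2) by auto
  \<comment> \<open>The equivalence holds for each fixed \<nu>, so the same \<nu> witnesses
    membership in \<open>U \<alpha>\<close> and the factorization of \<rho>.\<close>
  have factor: "J \<beta> \<rho> = J \<alpha> \<nu> \<longleftrightarrow> \<rho> = (J \<alpha> (convolution_powr \<nu> (1 - \<alpha> / \<beta>)) \<star> convolution_powr \<nu> (\<alpha> / \<beta>))"
    if \<nu>: "\<nu> \<in> ID" for \<nu> :: "(real ^ 'd) measure"
  proof -
    let ?R = "J \<alpha> (convolution_powr \<nu> (1 - \<alpha> / \<beta>)) \<star> convolution_powr \<nu> (\<alpha> / \<beta>)"
    note p1 = convolution_powr_ID[OF \<nu> c(1)] and p2 = convolution_powr_ID[OF \<nu> c(2)]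
    note J1 = J_ID[OF p1(1) assms(1)]
    have R: "?R \<in> ID" "log_charfun ?R = (\<lambda>y. of_real (1 - \<alpha> / \<beta>) * radial_mean \<alpha> (log_charfun \<nu>) y + of_real (\<alpha> / \<beta>) * log_charfun \<nu> y)"
      using convolution_ID[OF J1 p2(1)]
      by (simp_all only: log_charfun_J[OF p1(1) assms(1)] p1(2) p2(2) radial_mean_cmult)
    have "J \<beta> \<rho> = J \<alpha> \<nu> \<longleftrightarrow> log_charfun (J \<beta> \<rho>) = log_charfun (J \<alpha> \<nu>)"
      using ID_eqI[OF J_ID[OF assms(3) \<beta>] J_ID[OF \<nu> assms(1)]] by auto
    also have "\<dots> \<longleftrightarrow> radial_mean \<beta> (log_charfun \<rho>) = radial_mean \<alpha> (log_charfun \<nu>)"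
      by (simp only: log_charfun_J[OF assms(3) \<beta>] log_charfun_J[OF \<nu> assms(1)])
    also have "\<dots> \<longleftrightarrow> (\<forall>y. log_charfun \<rho> y = log_charfun ?R y)"
      unfolding R(2) by (rule radial_mean_eq_iff[OF log_charfun_ID(1)[OF assms(3)] log_charfun_ID(1)[OF \<nu>] assms(1) \<beta>])
    also have "\<dots> \<longleftrightarrow> \<rho> = ?R" using ID_eqI[OF assms(3) R(1)] by auto
    finally show ?thesis .
  qed
  \<comment> \<open>Both sides have \<open>1 - \<alpha> / \<beta>\<close> times the \<alpha>-mean of
    the logarithm of \<nu> as logarithm, since constants pass through the mean.\<close>
  have commute: "J \<alpha> (convolution_powr \<nu> (1 - \<alpha> / \<beta>)) = convolution_powr (J \<alpha> \<nu>) (1 - \<alpha> / \<beta>)"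
    if \<nu>: "\<nu> \<in> ID" for \<nu> :: "(real ^ 'd) measure"
  proof (rule ID_eqI)
    note p = convolution_powr_ID[OF \<nu> c(1)] and q = convolution_powr_ID[OF J_ID[OF \<nu> assms(1)] c(1)]
    show "J \<alpha> (convolution_powr \<nu> (1 - \<alpha> / \<beta>)) \<in> ID" by (rule J_ID[OF p(1) assms(1)])
    show "convolution_powr (J \<alpha> \<nu>) (1 - \<alpha> / \<beta>) \<in> ID" by (rule q(1))
    show "log_charfun (J \<alpha> (convolution_powr \<nu> (1 - \<alpha> / \<beta>))) y = log_charfun (convolution_powr (J \<alpha> \<nu>) (1 - \<alpha> / \<beta>)) y" for y
      by (simp only: log_charfun_J[OF p(1) assms(1)] log_charfun_J[OF \<nu> assms(1)] p(2) q(2) radial_mean_cmult)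
  qed
  show ?thesis
    using factor commute unfolding U_def by (simp add: image_iff)
qed

end
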